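(* Let $f$ be an operator convex function, and let $\mathcal{E}_1$ and $\mathcal{E}_2$ be two completely positive trace-preserving (CPTP) quantum operations acting on a system $A$. Then the $f$-Holevo quantity $\chi_f$ satisfies the data processing inequality $$\chi_f(\mathcal{E}_2\circ\mathcal{E}_1)\ \leq\ \min\left\{\chi_f(\mathcal{E}_1),\,\chi_f(\mathcal{E}_2)\right\}.$$
   Context: All Hilbert spaces are finite-dimensional and complex. "Strictly positive" means Hermitian positive definite. For Hermitian $A$, $f(A)$ is defined by the spectral decomposition. A real function $f$ is operator convex if $f[\lambda A+(1-\lambda)B]\leq\lambda f(A)+(1-\lambda)f(B)$ for all Hermitian matrices $A,B$ (of the same size) with spectra in the domain of $f$ and all $0\le\lambda\le1$. Quantum $f$-relative entropy: for strictly positive $\rho,\sigma$ on the same $d$-dimensional space, $$S_f(\rho||\sigma)=\mathrm{vec}(\sqrt{\rho})^\dagger f\left[\sigma\otimes(\rho^{-1})^{\mathsf T}\right]\mathrm{vec}(\sqrt{\rho})=\sum_{i,j=1}^d p_i f\left(\frac{q_j}{p_i}\right)|\langle i_\rho|j_\sigma\rangle|^2,$$ where $\rho=\sum_i p_i|i_\rho\rangle\langle i_\rho|$ and $\sigma=\sum_j q_j|j_\sigma\rangle\langle j_\sigma|$ are spectral decompositions, ${}^{\mathsf T}$ is the transpose, and $\mathrm{vec}(A)$ stacks the entries of $A$ row by row. $f$-Holevo quantity: consider states of a composite system $AB$ of the form $$\rho_{AB}=\sum_i p_i\,\rho_i\otimes|i_B\rangle\langle i_B|,$$ where $\{p_i\}$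 is a probability vector, $\{|i_B\rangle\}$ is an orthonormal basis in $B$, and the $\rho_i$ are strictly positive matrices of unit trace on $A$; let $\rho_A=\mathrm{Tr}_B(\rho_{AB})$ and $\rho_B=\mathrm{Tr}_A(\rho_{AB})$. For a CPTP quantum operation $\mathcal{E}$ acting on $A$, $$\chi_f(\mathcal{E})=\max_{\{p_i,\rho_i\}}S_f\left[(\mathcal{E}\otimes\mathcal{I}_B)\rho_{AB}\,||\,\mathcal{E}(\rho_A)\otimes\rho_B\right],$$ where $\mathcal{I}_B$ is the identity operation on $B$. (The value does not depend on the choice of the orthonormal basis $\{|i_B\rangle\}$.) Standing conventions: the domain of $f$ is contained in $(0,a)$ for some finite $a>0$, and the spectrum of every matrix to which $f$ is applied lies in the domain of $f$; every matrix appearing as an argument of $S_f$, including those obtained after applying a quantum operation, is assumed to be strictly positive, which implicitly restricts the admissible states and operations.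
   Formalization: The finite bound a on the domain of f is dropped and every ensemble must be admissible, so for two or more states f is operator convex on (0,∞); with finite a and restricted ensembles the inequality fails, e.g. f(x)=1/(a−x) with amplitude damping. The maximum is read as a supremum. *)

theory Defs
  imports
    "HOL-Library.Extended_Real"
    "Jordan_Normal_Form.Spectral_Radius"
    "Jordan_Normal_Form.Schur_Decomposition"
    "Jordan_Normal_Form.Gauss_Jordan_Elimination"
begin

section \<open>Hermitian matrices and functional calculus\<close>

definition hermitian :: "nat \<Rightarrow> complex mat \<Rightarrow> bool" where
  "hermitian n A \<longleftrightarrow> A \<in> carrier_mat n n \<and> mat_adjoint A = A"

definition unitary :: "nat \<Rightarrow> complex mat \<Rightarrow> bool" where
  "unitary n U \<longleftrightarrow> U \<in> carrier_mat n n \<and> mat_adjoint U * U = 1\<^sub>m n"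

text \<open>Here \<open>(A *\<^sub>v v) \<bullet>c v\<close> is \<open>\<langle>v|A|v\<rangle>\<close>, a real number when \<open>A\<close> is Hermitian.\<close>

definition pos_semidef :: "nat \<Rightarrow> complex mat \<Rightarrow> bool" where
  "pos_semidef n A \<longleftrightarrow> hermitian n A \<and> (\<forall>v \<in> carrier_vec n. 0 \<le> Re ((A *\<^sub>v v) \<bullet>c v))"

definition strictly_positive :: "nat \<Rightarrow> complex mat \<Rightarrow> bool" where
  "strictly_positive n A \<longleftrightarrow> hermitian n A \<and>
     (\<forall>v \<in> carrier_vec n. v \<noteq> 0\<^sub>v n \<longrightarrow> 0 < Re ((A *\<^sub>v v) \<bullet>c v))"

definition loewner_le :: "nat \<Rightarrow> complex mat \<Rightarrow> complex mat \<Rightarrow> bool" where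
  "loewner_le n A B \<longleftrightarrow> A \<in> carrier_mat n n \<and> B \<in> carrier_mat n n \<and> pos_semidef n (B - A)"

definition spectrum_in :: "complex mat \<Rightarrow> real set \<Rightarrow> bool" where
  "spectrum_in A D \<longleftrightarrow> spectrum A \<subseteq> complex_of_real ` D"

text \<open>\<open>f(A)\<close> for Hermitian \<open>A\<close>. The result is the same for all spectral decompositions
  \<open>A = U diag(l) U\<^sup>\<dagger>\<close>, so the description is uniquely satisfied.\<close>

definition mat_fun :: "(real \<Rightarrow> real) \<Rightarrow> complex mat \<Rightarrow> complex mat" where
  "mat_fun f A = (THE X. \<exists>U l. unitary (dim_row A) U \<and>
     A = U * mat_diag (dim_row A) (\<lambda>i. complex_of_real (l i)) * mat_adjoint U \<and>
     X = U * mat_diag (dim_row A) (\<lambda>i. complex_of_real (f (l i))) * mat_adjoint U)"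

definition operator_convex_on :: "real set \<Rightarrow> (real \<Rightarrow> real) \<Rightarrow> bool" where
  "operator_convex_on D f \<longleftrightarrow>
     (\<forall>n A B. \<forall>t::real. hermitian n A \<and> hermitian n B \<and> spectrum_in A D \<and> spectrum_in B D \<and>
        0 \<le> t \<and> t \<le> 1 \<longrightarrow>
        loewner_le n
          (mat_fun f (complex_of_real t \<cdot>\<^sub>m A + complex_of_real (1 - t) \<cdot>\<^sub>m B))
          (complex_of_real t \<cdot>\<^sub>m mat_fun f A + complex_of_real (1 - t) \<cdot>\<^sub>m mat_fun f B))"

section \<open>Tensor products and the relative entropy\<close>

text \<open>The basis vector \<open>|i\<rangle> \<otimes> |k\<rangle>\<close> has index \<open>i * dim_B + k\<close>, so that
  \<open>(X \<otimes> Y) vec(A) = vec(X A Y\<^sup>T)\<close> for the row-by-row \<open>vec\<close>.\<close>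

definition kron :: "complex mat \<Rightarrow> complex mat \<Rightarrow> complex mat" (infixl "\<otimes>\<^sub>k" 70) where
  "A \<otimes>\<^sub>k B = mat (dim_row A * dim_row B) (dim_col A * dim_col B)
     (\<lambda>(r, c). A $$ (r div dim_row B, c div dim_col B) * B $$ (r mod dim_row B, c mod dim_col B))"

definition vec_rows :: "complex mat \<Rightarrow> complex vec" where
  "vec_rows A = vec (dim_row A * dim_col A) (\<lambda>k. A $$ (k div dim_col A, k mod dim_col A))"

definition mat_tr :: "complex mat \<Rightarrow> complex" where
  "mat_tr A = (\<Sum>i<dim_row A. A $$ (i, i))"

text \<open>\<open>rel_modular \<rho> \<sigma>\<close> is \<open>\<sigma> \<otimes> (\<rho>\<^sup>-\<^sup>1)\<^sup>T\<close>; \<open>mat_inverse\<close> returns \<open>Some\<close> for every strictly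
  positive \<open>\<rho>\<close>.\<close>

definition rel_modular :: "complex mat \<Rightarrow> complex mat \<Rightarrow> complex mat" where
  "rel_modular \<rho> \<sigma> = \<sigma> \<otimes>\<^sub>k transpose_mat (the (mat_inverse \<rho>))"

definition f_rel_entropy :: "(real \<Rightarrow> real) \<Rightarrow> complex mat \<Rightarrow> complex mat \<Rightarrow> real" where
  "f_rel_entropy f \<rho> \<sigma> =
     Re ((mat_fun f (rel_modular \<rho> \<sigma>) *\<^sub>v vec_rows (mat_fun sqrt \<rho>)) \<bullet>c vec_rows (mat_fun sqrt \<rho>))"

text \<open>The conditions under which \<open>S\<^sub>f(\<rho>||\<sigma>)\<close> is defined when \<open>f\<close> has domain \<open>D\<close>.\<close>

definition f_rel_entropy_defined :: "real set \<Rightarrow> nat \<Rightarrow> complex mat \<Rightarrow> complex mat \<Rightarrow> bool" where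
  "f_rel_entropy_defined D n \<rho> \<sigma> \<longleftrightarrow>
     strictly_positive n \<rho> \<and> strictly_positive n \<sigma> \<and> spectrum_in (rel_modular \<rho> \<sigma>) D"

section \<open>Quantum operations\<close>

text \<open>Matrices on \<open>AB\<close> are \<open>(d * n) \<times> (d * n)\<close>, with \<open>d = dim A\<close> and \<open>n = dim B\<close>.
  \<open>block_B d n M k l\<close> is \<open>(I \<otimes> \<langle>k|) M (I \<otimes> |l\<rangle>)\<close>.\<close>

definition block_B :: "nat \<Rightarrow> nat \<Rightarrow> complex mat \<Rightarrow> nat \<Rightarrow> nat \<Rightarrow> complex mat" where
  "block_B d n M k l = mat d d (\<lambda>(i, j). M $$ (i * n + k, j * n + l))"

text \<open>\<open>\<E> \<otimes> \<I>\<^sub>B\<close>\<close>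

definition tensor_id :: "nat \<Rightarrow> nat \<Rightarrow> (complex mat \<Rightarrow> complex mat) \<Rightarrow> complex mat \<Rightarrow> complex mat" where
  "tensor_id d n E M = mat (d * n) (d * n)
     (\<lambda>(r, c). E (block_B d n M (r mod n) (c mod n)) $$ (r div n, c div n))"

definition ptrace_B :: "nat \<Rightarrow> nat \<Rightarrow> complex mat \<Rightarrow> complex mat" where
  "ptrace_B d n M = mat d d (\<lambda>(i, j). \<Sum>k<n. M $$ (i * n + k, j * n + k))"

definition ptrace_A :: "nat \<Rightarrow> nat \<Rightarrow> complex mat \<Rightarrow> complex mat" where
  "ptrace_A d n M = mat n n (\<lambda>(k, l). \<Sum>i<d. M $$ (i * n + k, i * n + l))"

definition cptp :: "nat \<Rightarrow> (complex mat \<Rightarrow> complex mat) \<Rightarrow> bool" where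
  "cptp d E \<longleftrightarrow>
     (\<forall>A \<in> carrier_mat d d. E A \<in> carrier_mat d d) \<and>
     (\<forall>A \<in> carrier_mat d d. \<forall>B \<in> carrier_mat d d. E (A + B) = E A + E B) \<and>
     (\<forall>c. \<forall>A \<in> carrier_mat d d. E (c \<cdot>\<^sub>m A) = c \<cdot>\<^sub>m E A) \<and>
     (\<forall>A \<in> carrier_mat d d. mat_tr (E A) = mat_tr A) \<and>
     (\<forall>m M. pos_semidef (d * m) M \<longrightarrow> pos_semidef (d * m) (tensor_id d m E M))"

section \<open>The Holevo quantity\<close>

text \<open>The weights are positive, not merely nonnegative, since \<open>\<rho>\<^sub>B = diag(p)\<close> has to be strictly
  positive.\<close>

definition ensemble :: "nat \<Rightarrow> nat \<Rightarrow> (nat \<Rightarrow> real) \<Rightarrow> (nat \<Rightarrow> complex mat) \<Rightarrow> bool" where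
  "ensemble d n p \<rho> \<longleftrightarrow> (\<forall>i<n. 0 < p i) \<and> (\<Sum>i<n. p i) = 1 \<and>
     (\<forall>i<n. strictly_positive d (\<rho> i) \<and> mat_tr (\<rho> i) = 1)"

text \<open>\<open>|i\<^sub>B\<rangle>\<langle>i\<^sub>B|\<close> for the standard basis of \<open>B\<close>. The Holevo quantity does not depend on the choice of
  the orthonormal basis.\<close>

definition basis_proj :: "nat \<Rightarrow> nat \<Rightarrow> complex mat" where
  "basis_proj n i = mat n n (\<lambda>(k, l). if k = i \<and> l = i then 1 else 0)"

definition cq_state :: "nat \<Rightarrow> nat \<Rightarrow> (nat \<Rightarrow> real) \<Rightarrow> (nat \<Rightarrow> complex mat) \<Rightarrow> complex mat" where
  "cq_state d n p \<rho> = mat (d * n) (d * n)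
     (\<lambda>rc. \<Sum>i<n. complex_of_real (p i) * (\<rho> i \<otimes>\<^sub>k basis_proj n i) $$ rc)"

text \<open>\<open>\<E>(\<rho>\<^sub>A) \<otimes> \<rho>\<^sub>B\<close> for \<open>R = \<rho>\<^sub>A\<^sub>B\<close>.\<close>

definition holevo_product :: "nat \<Rightarrow> nat \<Rightarrow> (complex mat \<Rightarrow> complex mat) \<Rightarrow> complex mat \<Rightarrow> complex mat" where
  "holevo_product d n E R = E (ptrace_B d n R) \<otimes>\<^sub>k ptrace_A d n R"

text \<open>The maximum is a supremum in the extended reals: the set of ensembles is not compact, so it
  need be neither attained nor finite.\<close>

definition f_holevo :: "(real \<Rightarrow> real) \<Rightarrow> nat \<Rightarrow> nat \<Rightarrow> (complex mat \<Rightarrow> complex mat) \<Rightarrow> ereal" where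
  "f_holevo f d n E = (SUP (p, \<rho>) \<in> {(p, \<rho>). ensemble d n p \<rho>}.
     ereal (f_rel_entropy f (tensor_id d n E (cq_state d n p \<rho>))
                            (holevo_product d n E (cq_state d n p \<rho>))))"

text \<open>The standing convention for \<open>\<chi>\<^sub>f(\<E>)\<close>: every argument of \<open>S\<^sub>f\<close> in the maximum is strictly
  positive, and every matrix to which \<open>f\<close> is applied has its spectrum in the domain \<open>D\<close> of \<open>f\<close>.
  For \<open>n \<ge> 2\<close> the ratios \<open>p i / p j\<close> take all positive values, so a domain contained in an interval
  \<open>(0,a)\<close> with \<open>a\<close> finite never satisfies this, while \<open>D = {0<..}\<close> does whenever \<open>\<E>\<close> preserves
  strict positivity.\<close>

definition f_holevo_defined :: "real set \<Rightarrow> nat \<Rightarrow> nat \<Rightarrow> (complex mat \<Rightarrow> complex mat) \<Rightarrow> bool" where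
  "f_holevo_defined D d n E \<longleftrightarrow> (\<forall>p \<rho>. ensemble d n p \<rho> \<longrightarrow>
     f_rel_entropy_defined D (d * n) (tensor_id d n E (cq_state d n p \<rho>))
                                     (holevo_product d n E (cq_state d n p \<rho>)))"

end

(* The bound by chi_f(E2) holds because applying E1 to the states of an ensemble gives an ensemble.
   The bound by chi_f(E1) is the monotonicity of S_f under the operation E2 (x) id_B.

   Monotonicity under a partial trace follows from the operator Jensen inequality
   f(V' A V) <= V' f(A) V for an isometry V with adjoint V', applied to the relative modular
   operator.  By Stinespring an operation is a partial trace of W rho W' with W an isometry, but
   W rho W' is singular, while f is only defined on positive numbers.  Therefore W rho W' is
   replaced by
     (1 - s) W rho W' + s c (1 - W W') + s (E(rho) - c T),   T the partial trace of 1 - W W',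
   with the last summand in an additional slot of the environment.  It is strictly positive for small
   c, its partial trace is exactly E(rho), and its entropy differs from that of W rho W' by a term
   linear in s, so that letting s tend to 0 requires no continuity of S_f.

   The inequality uses operator convexity on the whole half-line.  For n >= 2 the standing convention
   forces this domain; for n = 1 both entropies equal f(1). *)

theory Submission
  imports Defs
begin

section \<open>Spectral decompositions\<close>

text \<open>Two facts make the entropy of the dilated states linear in \<open>s\<close>. Inside each
  of the three blocks the scalar \<open>1 - s\<close>, \<open>s * c\<close> or \<open>s\<close>
  multiplies the eigenvalues of both states alike; as \<open>S_f\<close> is a sum of terms p f(q/p),
  the scalar cancels within f and comes out as a factor. The terms between different blocks vanish,
  because both states are dilated with the same isometry and hence the same complementary
  projection. The extra slot corrects the partial trace for every \<open>s\<close>, so the left side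
  of the inequality stays fixed while \<open>s\<close> tends to 0.

  An orthonormal basis of the complement of the range is never chosen: the columns of the projection
  themselves form a Parseval frame of that complement. This is why the partial trace inequality is
  proved for frames instead of bases.

  The Jensen inequality is applied in eigenbases of the two reduced states. Matrix functions thus
  occur only in its proof and in the spectral formula for \<open>S_f\<close>; the rest of the
  monotonicity argument concerns finite sums over eigenvalues.

  CPTP maps may produce singular states. Strict positivity of the images is drawn from the standing
  convention for \<open>E1\<close> and for \<open>E2 \<circ> E1\<close>.\<close>

lemma mat_adjoint_carrier [simp]:
  "A \<in> carrier_mat n m \<Longrightarrow> mat_adjoint A \<in> carrier_mat m n"
  by (auto simp: mat_adjoint_def mat_of_rows_def)

lemma mat_adjoint_dim [simp]:
  "dim_row (mat_adjoint A) = dim_col A" "dim_col (mat_adjoint A) = dim_row A"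
  by (auto simp: mat_adjoint_def mat_of_rows_def)

lemma mat_adjoint_index [simp]:
  fixes A :: "complex mat"
  assumes "i < dim_col A" "j < dim_row A"
  shows "mat_adjoint A $$ (i, j) = cnj (A $$ (j, i))"
  using assms by (auto simp: mat_adjoint_def mat_of_rows_def)

lemma mat_adjoint_adjoint [simp]:
  fixes A :: "complex mat"
  shows "mat_adjoint (mat_adjoint A) = A"
  by (rule eq_matI) auto

lemma index_mult_sum:
  assumes "A \<in> carrier_mat n m" "B \<in> carrier_mat m k" "i < n" "j < k"
  shows "(A * B) $$ (i, j) = (\<Sum>l<m. A $$ (i, l) * B $$ (l, j))"
  using assms by (auto simp: scalar_prod_def lessThan_atLeast0 intro!: sum.cong)

lemma index_mult_vec_sum:
  assumes "A \<in> carrier_mat n m" "v \<in> carrier_vec m" "i < n"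
  shows "(A *\<^sub>v v) $ i = (\<Sum>l<m. A $$ (i, l) * v $ l)"
  using assms by (auto simp: scalar_prod_def lessThan_atLeast0 intro!: sum.cong)

lemma mat_adjoint_mult:
  fixes A B :: "complex mat"
  assumes A: "A \<in> carrier_mat n m" and B: "B \<in> carrier_mat m k"
  shows "mat_adjoint (A * B) = mat_adjoint B * mat_adjoint A"
proof (rule eq_matI)
  fix i j assume "i < dim_row (mat_adjoint B * mat_adjoint A)" "j < dim_col (mat_adjoint B * mat_adjoint A)"
  then have ij: "i < k" "j < n" using A B by auto
  then have "mat_adjoint (A * B) $$ (i, j) = cnj ((A * B) $$ (j, i))"
    using A B by (subst mat_adjoint_index) auto
  also have "\<dots> = (\<Sum>l<m. mat_adjoint B $$ (i, l) * mat_adjoint A $$ (l, j))"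
    using A B ij by (subst index_mult_sum[OF A B]) (auto intro!: sum.cong simp: mult.commute)
  also have "\<dots> = (mat_adjoint B * mat_adjoint A) $$ (i, j)"
    using A B ij by (subst index_mult_sum[of _ k m _ n]) auto
  finally show "mat_adjoint (A * B) $$ (i, j) = (mat_adjoint B * mat_adjoint A) $$ (i, j)" .
qed (use A B in auto)

lemma mat_diag_index [simp]: "i < n \<Longrightarrow> j < n \<Longrightarrow> mat_diag n g $$ (i, j) = (if i = j then g j else 0)"
  by (simp add: mat_diag_def)

lemma mat_diag_dims [simp]: "dim_row (mat_diag n g) = n" "dim_col (mat_diag n g) = n"
  by (simp_all add: mat_diag_def)

lemma unitary_carrier: "unitary n U \<Longrightarrow> U \<in> carrier_mat n n"
  by (simp add: unitary_def)

lemma unitary_right_inverse: "unitary n U \<Longrightarrow> U * mat_adjoint U = 1\<^sub>m n"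
  unfolding unitary_def by (metis mat_adjoint_carrier mat_mult_left_right_inverse)

lemma unitary_adjoint: "unitary n U \<Longrightarrow> unitary n (mat_adjoint U)"
  using unitary_right_inverse by (auto simp: unitary_def)

lemma unitary_mult:
  assumes U: "unitary n U" and V: "unitary n V"
  shows "unitary n (U * V)"
proof -
  note c = unitary_carrier[OF U] unitary_carrier[OF V]
  have "mat_adjoint (U * V) * (U * V) = mat_adjoint V * mat_adjoint U * (U * V)"
    using c by (simp add: mat_adjoint_mult)
  also have "\<dots> = mat_adjoint V * ((mat_adjoint U * U) * V)"
    using c by (simp add: assoc_mult_mat[of _ n n _ n _ n])
  also have "\<dots> = 1\<^sub>m n" using U V by (auto simp: unitary_def)
  finally show ?thesis using c by (auto simp: unitary_def)
qed

lemma unitary_cols: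
  assumes "unitary n U" "a < n" "b < n"
  shows "(\<Sum>i<n. cnj (U $$ (i, a)) * U $$ (i, b)) = (if a = b then 1 else 0)"
proof -
  have "(mat_adjoint U * U) $$ (a, b) = (\<Sum>i<n. cnj (U $$ (i, a)) * U $$ (i, b))"
    using assms by (subst index_mult_sum[of _ n n _ n]) (auto simp: unitary_def)
  with assms show ?thesis by (auto simp: unitary_def)
qed

lemma unitary_rows:
  assumes "unitary n U" "i < n" "j < n"
  shows "(\<Sum>a<n. U $$ (i, a) * cnj (U $$ (j, a))) = (if i = j then 1 else 0)"
proof -
  have "(U * mat_adjoint U) $$ (i, j) = (\<Sum>a<n. U $$ (i, a) * cnj (U $$ (j, a)))"
    using assms by (subst index_mult_sum[of _ n n _ n]) (auto simp: unitary_def)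
  with assms unitary_right_inverse[of n U] show ?thesis by auto
qed

lemma unitaryI_cols:
  assumes "U \<in> carrier_mat n n"
    and "\<And>a b. a < n \<Longrightarrow> b < n \<Longrightarrow>
           (\<Sum>i<n. cnj (U $$ (i, a)) * U $$ (i, b)) = (if a = b then 1 else 0)"
  shows "unitary n U"
proof -
  have "mat_adjoint U * U = 1\<^sub>m n"
  proof (rule eq_matI)
    fix a b assume "a < dim_row (1\<^sub>m n)" "b < dim_col (1\<^sub>m n)"
    then show "(mat_adjoint U * U) $$ (a, b) = 1\<^sub>m n $$ (a, b)"
      using assms by (subst index_mult_sum[of _ n n _ n]) auto
  qed (use assms in auto)
  with assms show ?thesis by (simp add: unitary_def)
qed

section \<open>Spectral normal form and functional calculus\<close>

text \<open>The shape of the decompositions quantified over in \<open>mat_fun\<close>. Writing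
  matrices this way turns functions of a matrix into functions of \<open>l\<close>.\<close>

definition conj_diag :: "nat \<Rightarrow> complex mat \<Rightarrow> (nat \<Rightarrow> real) \<Rightarrow> complex mat" where
  "conj_diag n U l = U * mat_diag n (\<lambda>i. complex_of_real (l i)) * mat_adjoint U"

lemma conj_diag_carrier [simp]: "U \<in> carrier_mat n n \<Longrightarrow> conj_diag n U l \<in> carrier_mat n n"
  by (auto simp: conj_diag_def)

lemma conj_diag_index:
  assumes U: "U \<in> carrier_mat n n" and "i < n" "j < n"
  shows "conj_diag n U l $$ (i, j) = (\<Sum>a<n. U $$ (i, a) * of_real (l a) * cnj (U $$ (j, a)))"
proof -
  have "(U * mat_diag n (\<lambda>i. complex_of_real (l i))) * mat_adjoint U =
     mat n n (\<lambda>(i, j). U $$ (i, j) * of_real (l j)) * mat_adjoint U"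
    using U by (simp add: mat_diag_mult_right)
  with assms show ?thesis
    unfolding conj_diag_def by (simp only:, subst index_mult_sum[of _ n n _ n]) auto
qed

text \<open>The matrix \<open>X = V^dag U\<close> intertwines the two diagonal matrices, so
  \<open>X $$ (i, j) \<noteq> 0\<close> forces \<open>l j = k i\<close> and therefore
  \<open>f (l j) = f (k i)\<close>. Hence \<open>X\<close> also intertwines the images under
  \<open>f\<close>, for arbitrary \<open>f\<close>. This is the well-definedness of
  \<open>mat_fun\<close>.\<close>

lemma conj_diag_intertwine:
  assumes U: "unitary n U" and V: "unitary n V" and eq: "conj_diag n U l = conj_diag n V k"
  shows "conj_diag n U (\<lambda>i. f (l i)) = conj_diag n V (\<lambda>i. f (k i))"
proof -
  note cU [simp] = unitary_carrier[OF U] and cV [simp] = unitary_carrier[OF V]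
  let ?D = "\<lambda>l::nat \<Rightarrow> real. mat_diag n (\<lambda>i. complex_of_real (l i))"
  define X where "X = mat_adjoint V * U"
  have X [simp]: "X \<in> carrier_mat n n" unfolding X_def by (rule mult_carrier_mat[of _ n n]) auto
  note assoc = assoc_mult_mat[of _ n n _ n _ n]
  have one: "mat_adjoint U * U = 1\<^sub>m n" "mat_adjoint V * V = 1\<^sub>m n"
    "U * mat_adjoint U = 1\<^sub>m n" "V * mat_adjoint V = 1\<^sub>m n"
    using U V unitary_right_inverse by (auto simp: unitary_def)
  have "mat_adjoint V * conj_diag n U l * U = X * ?D l * (mat_adjoint U * U)"
    unfolding conj_diag_def X_def by (simp add: assoc mult_carrier_mat[of _ n n _ n])
  then have l: "mat_adjoint V * conj_diag n U l * U = X * ?D l"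
    by (simp add: one)
  have "mat_adjoint V * conj_diag n V k * U = (mat_adjoint V * V) * ?D k * X"
    unfolding conj_diag_def X_def by (simp add: assoc mult_carrier_mat[of _ n n _ n])
  then have r: "mat_adjoint V * conj_diag n V k * U = ?D k * X"
    by (simp add: one)
  have comm: "X * ?D l = ?D k * X" using l r eq by simp
  have "X * ?D (\<lambda>i. f (l i)) = ?D (\<lambda>i. f (k i)) * X"
  proof (rule eq_matI)
    fix i j assume "i < dim_row (?D (\<lambda>i. f (k i)) * X)" "j < dim_col (?D (\<lambda>i. f (k i)) * X)"
    then have ij: "i < n" "j < n" using carrier_matD[OF X] by auto
    have "X $$ (i, j) * of_real (l j) = of_real (k i) * X $$ (i, j)"
      using arg_cong[OF comm, of "\<lambda>M. M $$ (i, j)"] ij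
      by (simp add: mat_diag_mult_left[of _ n n] mat_diag_mult_right[of _ n n])
    then have "X $$ (i, j) * of_real (f (l j)) = of_real (f (k i)) * X $$ (i, j)"
      by (cases "X $$ (i, j) = 0") (auto simp: mult.commute)
    then show "(X * ?D (\<lambda>i. f (l i))) $$ (i, j) = (?D (\<lambda>i. f (k i)) * X) $$ (i, j)"
      using ij by (simp add: mat_diag_mult_left[of _ n n] mat_diag_mult_right[of _ n n])
  qed (use carrier_matD[OF X] in auto)
  then have "V * (X * ?D (\<lambda>i. f (l i))) * mat_adjoint U = V * (?D (\<lambda>i. f (k i)) * X) * mat_adjoint U"
    by simp
  moreover have "V * (X * ?D (\<lambda>i. f (l i))) * mat_adjoint U
      = (V * mat_adjoint V) * conj_diag n U (\<lambda>i. f (l i))"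
    unfolding conj_diag_def X_def by (simp add: assoc mult_carrier_mat[of _ n n _ n])
  moreover have "V * (?D (\<lambda>i. f (k i)) * X) * mat_adjoint U
      = conj_diag n V (\<lambda>i. f (k i)) * (U * mat_adjoint U)"
    unfolding conj_diag_def X_def by (simp add: assoc mult_carrier_mat[of _ n n _ n])
  ultimately have "1\<^sub>m n * conj_diag n U (\<lambda>i. f (l i)) = conj_diag n V (\<lambda>i. f (k i)) * 1\<^sub>m n"
    by (simp only: one)
  then show ?thesis
    using left_mult_one_mat[OF conj_diag_carrier[OF cU, of "\<lambda>i. f (l i)"]]
      right_mult_one_mat[OF conj_diag_carrier[OF cV, of "\<lambda>i. f (k i)"]] by metis
qed

text \<open>Replaces the definite description by a computation; uniqueness is
  \<open>conj_diag_intertwine\<close>.\<close>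

lemma mat_fun_conj_diag:
  assumes U: "unitary n U"
  shows "mat_fun f (conj_diag n U l) = conj_diag n U (\<lambda>i. f (l i))"
proof -
  have dim: "dim_row (conj_diag n U l) = n"
    using conj_diag_carrier[OF unitary_carrier[OF U], of l] by auto
  show ?thesis
    unfolding mat_fun_def dim conj_diag_def[symmetric]
  proof (rule the_equality)
    show "\<exists>V k. unitary n V \<and> conj_diag n U l = conj_diag n V k \<and>
        conj_diag n U (\<lambda>i. f (l i)) = conj_diag n V (\<lambda>i. f (k i))"
      using U by blast
  next
    fix X assume "\<exists>V k. unitary n V \<and> conj_diag n U l = conj_diag n V k \<and>
        X = conj_diag n V (\<lambda>i. f (k i))"
    then obtain V k where "unitary n V" "conj_diag n U l = conj_diag n V k"
      "X = conj_diag n V (\<lambda>i. f (k i))" by blast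
    with conj_diag_intertwine[OF U, of V l k f] show "X = conj_diag n U (\<lambda>i. f (l i))" by metis
  qed
qed

text \<open>The weights are squared moduli of the coordinates of \<open>v\<close> in the eigenbasis.
  Positivity and relative entropies are both read off from this form.\<close>

lemma conj_diag_quadratic:
  assumes U: "U \<in> carrier_mat n n" and v: "v \<in> carrier_vec n"
  shows "(conj_diag n U l *\<^sub>v v) \<bullet>c v
    = of_real (\<Sum>a<n. l a * (cmod (\<Sum>i<n. cnj (U $$ (i, a)) * v $ i))\<^sup>2)"
proof -
  let ?s = "\<lambda>a. \<Sum>i<n. cnj (U $$ (i, a)) * v $ i"
  have C: "conj_diag n U l \<in> carrier_mat n n" using U by simp
  have "(conj_diag n U l *\<^sub>v v) \<bullet>c v = (\<Sum>i<n. (conj_diag n U l *\<^sub>v v) $ i * cnj (v $ i))"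
    using C v by (auto simp: scalar_prod_def lessThan_atLeast0)
  also have "\<dots> = (\<Sum>i<n. \<Sum>j<n. \<Sum>a<n. U $$ (i, a) * of_real (l a) * cnj (U $$ (j, a)) * v $ j * cnj (v $ i))"
    by (rule sum.cong)
       (auto simp: index_mult_vec_sum[OF C v] conj_diag_index[OF U] sum_distrib_right)
  also have "\<dots> = (\<Sum>i<n. \<Sum>a<n. \<Sum>j<n. U $$ (i, a) * of_real (l a) * cnj (U $$ (j, a)) * v $ j * cnj (v $ i))"
    by (rule sum.cong[OF refl], rule sum.swap)
  also have "\<dots> = (\<Sum>a<n. \<Sum>i<n. \<Sum>j<n. U $$ (i, a) * of_real (l a) * cnj (U $$ (j, a)) * v $ j * cnj (v $ i))"
    by (rule sum.swap)
  also have "\<dots> = (\<Sum>a<n. of_real (l a) * (?s a * cnj (?s a)))"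
  proof (rule sum.cong[OF refl])
    fix a
    have "?s a * cnj (?s a) = (\<Sum>j<n. \<Sum>i<n. cnj (U $$ (j, a)) * v $ j * cnj (cnj (U $$ (i, a)) * v $ i))"
      by (simp add: sum_product)
    also have "\<dots> = (\<Sum>i<n. \<Sum>j<n. cnj (U $$ (j, a)) * v $ j * cnj (cnj (U $$ (i, a)) * v $ i))"
      by (rule sum.swap)
    finally show "(\<Sum>i<n. \<Sum>j<n. U $$ (i, a) * of_real (l a) * cnj (U $$ (j, a)) * v $ j * cnj (v $ i))
        = of_real (l a) * (?s a * cnj (?s a))"
      by (simp add: sum_distrib_left mult_ac)
  qed
  also have "\<dots> = of_real (\<Sum>a<n. l a * (cmod (?s a))\<^sup>2)"
    by (simp only: of_real_sum of_real_mult complex_norm_square)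
  finally show ?thesis .
qed

lemma conj_diag_mult_col:
  assumes U: "unitary n U" and a: "a < n"
  shows "conj_diag n U l *\<^sub>v col U a = of_real (l a) \<cdot>\<^sub>v col U a"
proof (rule eq_vecI)
  note c = unitary_carrier[OF U]
  fix i assume "i < dim_vec (of_real (l a) \<cdot>\<^sub>v col U a)"
  then have i: "i < n" using c by auto
  have "(conj_diag n U l *\<^sub>v col U a) $ i
      = (\<Sum>j<n. (\<Sum>b<n. U $$ (i, b) * of_real (l b) * cnj (U $$ (j, b))) * U $$ (j, a))"
    using c a i by (subst index_mult_vec_sum[of _ n n]) (auto simp: conj_diag_index[OF c])
  also have "\<dots> = (\<Sum>b<n. U $$ (i, b) * of_real (l b) * (\<Sum>j<n. cnj (U $$ (j, b)) * U $$ (j, a)))"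
    unfolding sum_distrib_right sum_distrib_left
    by (subst sum.swap) (simp add: mult.assoc)
  also have "\<dots> = (\<Sum>b<n. if b = a then U $$ (i, b) * of_real (l b) else 0)"
    by (rule sum.cong) (auto simp: unitary_cols[OF U _ a])
  also have "\<dots> = (of_real (l a) \<cdot>\<^sub>v col U a) $ i"
    using a i c by (simp add: mult.commute)
  finally show "(conj_diag n U l *\<^sub>v col U a) $ i = (of_real (l a) \<cdot>\<^sub>v col U a) $ i" .
qed (use unitary_carrier[OF U] in \<open>auto simp: conj_diag_def\<close>)

text \<open>Pairing the eigenvector equation with column \<open>a\<close> of \<open>U\<close>
  multiplies the coordinate of \<open>v\<close> by \<open>e\<close> on one side and by
  \<open>l a\<close> on the other.\<close>

lemma conj_diag_eigenvalue:
  assumes U: "unitary n U" and A: "conj_diag n U l *\<^sub>v v = e \<cdot>\<^sub>v v"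
    and v: "v \<in> carrier_vec n" and a: "a < n" "e \<noteq> of_real (l a)"
  shows "(\<Sum>i<n. cnj (U $$ (i, a)) * v $ i) = 0"
proof -
  note c = unitary_carrier[OF U]
  let ?s = "\<lambda>a. \<Sum>i<n. cnj (U $$ (i, a)) * v $ i"
  have "e * ?s a = (\<Sum>i<n. cnj (U $$ (i, a)) * (conj_diag n U l *\<^sub>v v) $ i)"
    unfolding A using v by (simp add: sum_distrib_left mult_ac)
  also have "\<dots> = (\<Sum>i<n. \<Sum>j<n. \<Sum>b<n. cnj (U $$ (i, a)) * (U $$ (i, b) * of_real (l b) * cnj (U $$ (j, b)) * v $ j))"
    using c v by (intro sum.cong[OF refl], subst index_mult_vec_sum[of _ n n])
      (auto simp: conj_diag_index[OF c] sum_distrib_left sum_distrib_right)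
  also have "\<dots> = (\<Sum>i<n. \<Sum>b<n. \<Sum>j<n. cnj (U $$ (i, a)) * (U $$ (i, b) * of_real (l b) * cnj (U $$ (j, b)) * v $ j))"
    by (rule sum.cong[OF refl], rule sum.swap)
  also have "\<dots> = (\<Sum>b<n. \<Sum>i<n. \<Sum>j<n. cnj (U $$ (i, a)) * (U $$ (i, b) * of_real (l b) * cnj (U $$ (j, b)) * v $ j))"
    by (rule sum.swap)
  also have "\<dots> = (\<Sum>b<n. (\<Sum>i<n. cnj (U $$ (i, a)) * U $$ (i, b)) * (of_real (l b) * ?s b))"
    by (simp only: sum_distrib_left[of "of_real _"] sum_product) (simp add: mult_ac)
  also have "\<dots> = (\<Sum>b<n. if a = b then of_real (l b) * ?s b else 0)"
    by (rule sum.cong) (auto simp: unitary_cols[OF U a(1)])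
  also have "\<dots> = of_real (l a) * ?s a" using a by simp
  finally show ?thesis using a(2) by simp
qed

text \<open>Otherwise every coordinate of \<open>v\<close> in the eigenbasis vanishes, and
  \<open>v = U (U^dag v) = 0\<close>.\<close>

lemma conj_diag_eigenvalue_ex:
  assumes U: "unitary n U" and A: "conj_diag n U l *\<^sub>v v = e \<cdot>\<^sub>v v"
    and v: "v \<in> carrier_vec n" and nz: "v \<noteq> 0\<^sub>v n"
  obtains a where "a < n" "e = of_real (l a)"
proof (rule ccontr)
  note c = unitary_carrier[OF U]
  assume "\<not> thesis"
  then have z: "(\<Sum>i<n. cnj (U $$ (i, a)) * v $ i) = 0" if "a < n" for a
    using conj_diag_eigenvalue[OF U A v that] that \<open>\<And>a. a < n \<Longrightarrow> e = complex_of_real (l a) \<Longrightarrow> thesis\<close> by blast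
  have z': "mat_adjoint U *\<^sub>v v = 0\<^sub>v n"
    by (rule eq_vecI) (use c v z in \<open>auto simp: index_mult_vec_sum[of _ n n] simp del: index_mult_mat_vec\<close>)
  have "v = (U * mat_adjoint U) *\<^sub>v v" using unitary_right_inverse[OF U] v by simp
  also have "\<dots> = U *\<^sub>v (mat_adjoint U *\<^sub>v v)"
    using c v by (intro assoc_mult_mat_vec[of _ n n _ n]) auto
  also have "\<dots> = 0\<^sub>v n"
    unfolding z' using c by (intro eq_vecI) (auto simp: scalar_prod_def)
  finally show False using nz by simp
qed

lemma spectrum_conj_diag:
  assumes U: "unitary n U"
  shows "spectrum (conj_diag n U l) = (\<lambda>a. of_real (l a)) ` {..<n}"
proof -
  note c = unitary_carrier[OF U]
  have dim: "dim_row (conj_diag n U l) = n" using c by (auto simp: conj_diag_def)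
  show ?thesis
  proof (intro equalityI subsetI)
    fix e assume "e \<in> spectrum (conj_diag n U l)"
    then obtain v where "v \<in> carrier_vec n" "v \<noteq> 0\<^sub>v n" "conj_diag n U l *\<^sub>v v = e \<cdot>\<^sub>v v"
      by (auto simp: spectrum_def eigenvalue_def eigenvector_def dim)
    with conj_diag_eigenvalue_ex[OF U] show "e \<in> (\<lambda>a. of_real (l a)) ` {..<n}" by blast
  next
    fix e :: complex assume "e \<in> (\<lambda>a. of_real (l a)) ` {..<n}"
    then obtain a where a: "a < n" "e = of_real (l a)" by auto
    have "col U a \<noteq> 0\<^sub>v n"
    proof
      assume *: "col U a = 0\<^sub>v n"
      have "U $$ (i, a) = 0" if "i < n" for i
        using arg_cong[OF *, of "\<lambda>v. v $ i"] that a c by simp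
      with unitary_cols[OF U a(1) a(1)] show False by simp
    qed
    with conj_diag_mult_col[OF U a(1), of l] a c
    show "e \<in> spectrum (conj_diag n U l)"
      by (auto simp: spectrum_def eigenvalue_def eigenvector_def dim intro!: exI[of _ "col U a"])
  qed
qed

lemma hermitian_conj_diag:
  assumes U: "U \<in> carrier_mat n n"
  shows "hermitian n (conj_diag n U l)"
proof -
  have "mat_adjoint (conj_diag n U l) = conj_diag n U l"
    by (rule eq_matI)
       (use conj_diag_carrier[OF U, of l] in \<open>auto simp: conj_diag_index[OF U] mult_ac intro!: sum.cong\<close>)
  with U show ?thesis by (simp add: hermitian_def)
qed

lemma hermitian_index:
  "hermitian n A \<Longrightarrow> i < n \<Longrightarrow> j < n \<Longrightarrow> A $$ (i, j) = cnj (A $$ (j, i))"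
  using mat_adjoint_index[of i A j] by (auto simp: hermitian_def)

lemma hermitianI:
  assumes "A \<in> carrier_mat n n" "\<And>i j. i < n \<Longrightarrow> j < n \<Longrightarrow> A $$ (i, j) = cnj (A $$ (j, i))"
  shows "hermitian n A"
proof -
  have "mat_adjoint A = A"
    by (rule eq_matI) (use assms(1) assms(2)[symmetric] in auto)
  with assms show ?thesis by (simp add: hermitian_def)
qed

section \<open>Spectral theorem for Hermitian matrices\<close>

lemma conj_diag_mult:
  assumes W: "W \<in> carrier_mat n n" and U: "U \<in> carrier_mat n n"
  shows "W * conj_diag n U l * mat_adjoint W = conj_diag n (W * U) l"
  using assms unfolding conj_diag_def
  by (simp add: mat_adjoint_mult[OF W U] assoc_mult_mat[of _ n n _ n _ n] mult_carrier_mat[of _ n n _ n])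

text \<open>Gram-Schmidt here delivers orthogonal vectors that are not normalised. Dividing by the
  norms makes the matrix unitary, at the price that the first column is only a multiple of
  \<open>v\<close>.\<close>

lemma unitary_first_column:
  fixes v :: "complex vec"
  assumes v: "v \<in> carrier_vec n" and v0: "v \<noteq> 0\<^sub>v n" and n: "0 < n"
  obtains W c where "unitary n W" "col W 0 = c \<cdot>\<^sub>v v"
proof -
  interpret cof_vec_space n "TYPE(complex)" .
  define b where "b = basis_completion v"
  define ws where "ws = gram_schmidt n b"
  from basis_completion[OF v v0, folded b_def]
  have dist_b: "distinct b" and indep: "\<not> lin_dep (set b)" and b: "set b \<subseteq> carrier_vec n"
    and hdb: "hd b = v" and len_b: "length b = n" by auto
  from hdb len_b n obtain vs where bv: "b = v # vs" by (cases b, auto)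
  from gram_schmidt_result[OF b dist_b indep refl, folded ws_def]
  have ws: "set ws \<subseteq> carrier_vec n" "corthogonal ws" "length ws = n" by (auto simp: len_b)
  have "hd ws = v" using gram_schmidt_hd[OF v, of vs, folded bv] unfolding ws_def .
  then have ws0: "ws ! 0 = v" using ws(3) n by (cases ws) auto
  have wsc: "ws ! a \<in> carrier_vec n" if "a < n" for a using ws that by auto
  define N where "N a = (\<Sum>i<n. (cmod (ws ! a $ i))\<^sup>2)" for a
  have dot: "(\<Sum>i<n. cnj (ws ! a $ i) * ws ! b $ i) = ws ! b \<bullet>c ws ! a" if "a < n" "b < n" for a b
    using wsc[OF that(1)] wsc[OF that(2)]
    by (auto simp: scalar_prod_def lessThan_atLeast0 mult.commute)
  have N: "(\<Sum>i<n. cnj (ws ! a $ i) * ws ! a $ i) = of_real (N a)" for a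
    unfolding N_def of_real_sum complex_norm_square by (simp add: mult.commute)
  have Npos: "0 < N a" if "a < n" for a
  proof -
    have "ws ! a \<bullet>c ws ! a \<noteq> 0" using ws that unfolding corthogonal_def by auto
    then have "N a \<noteq> 0" using dot[OF that that] N[of a] by auto
    moreover have "0 \<le> N a" unfolding N_def by (simp add: sum_nonneg)
    ultimately show ?thesis by simp
  qed
  define W where "W = mat n n (\<lambda>(i, a). ws ! a $ i / of_real (sqrt (N a)))"
  have "unitary n W"
  proof (rule unitaryI_cols)
    fix a b assume ab: "a < n" "b < n"
    have "(\<Sum>i<n. cnj (W $$ (i, a)) * W $$ (i, b))
        = (\<Sum>i<n. cnj (ws ! a $ i) * ws ! b $ i) / of_real (sqrt (N a) * sqrt (N b))"
      using ab by (simp add: W_def sum_divide_distrib)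
    also have "\<dots> = (if a = b then 1 else 0)"
    proof (cases "a = b")
      case True
      then show ?thesis using N[of a] Npos[OF ab(1)] by simp
    next
      case False
      then have "ws ! b \<bullet>c ws ! a = 0" using ws ab unfolding corthogonal_def by auto
      with False dot[OF ab] show ?thesis by simp
    qed
    finally show "(\<Sum>i<n. cnj (W $$ (i, a)) * W $$ (i, b)) = (if a = b then 1 else 0)" .
  qed (simp add: W_def)
  moreover have "col W 0 = (1 / of_real (sqrt (N 0))) \<cdot>\<^sub>v v"
    using n v by (intro eq_vecI) (auto simp: W_def ws0)
  ultimately show thesis by (rule that)
qed

lemma hermitian_congruence:
  assumes A: "hermitian n A" and W: "W \<in> carrier_mat n n"
  shows "hermitian n (mat_adjoint W * A * W)"
proof -
  have "mat_adjoint (mat_adjoint W * A * W) = mat_adjoint W * A * W"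
    using A W unfolding hermitian_def
    by (simp add: mat_adjoint_mult[of _ n n _ n] assoc_mult_mat[of _ n n _ n _ n] mult_carrier_mat[of _ n n _ n])
  with A W show ?thesis
    unfolding hermitian_def by (auto intro!: mult_carrier_mat[of _ n n _ n])
qed

text \<open>Deflation by induction on the dimension: in a unitary basis starting with an
  eigenvector, the matrix splits into a 1 by 1 corner and a smaller Hermitian block.\<close>

theorem hermitian_spectral:
  "hermitian n A \<Longrightarrow> \<exists>U l. unitary n U \<and> A = conj_diag n U l"
proof (induction n arbitrary: A)
  case 0
  have "unitary 0 (1\<^sub>m 0)" by (rule unitaryI_cols) auto
  moreover have "A = conj_diag 0 (1\<^sub>m 0) (\<lambda>_. 0)"
    using 0 by (intro eq_matI) (auto simp: hermitian_def conj_diag_def)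
  ultimately show ?case by blast
next
  case (Suc m)
  let ?n = "Suc m"
  have A [simp]: "A \<in> carrier_mat ?n ?n" using Suc.prems by (simp add: hermitian_def)
  obtain e where "e \<in> spectrum A" using spectrum_non_empty[OF A] by auto
  then obtain v where v: "v \<in> carrier_vec ?n" "v \<noteq> 0\<^sub>v ?n" and Av: "A *\<^sub>v v = e \<cdot>\<^sub>v v"
    using A by (auto simp: spectrum_def eigenvalue_def eigenvector_def)
  obtain W c where W: "unitary ?n W" and col: "col W 0 = c \<cdot>\<^sub>v v"
    using unitary_first_column[OF v] by auto
  note cW [simp] = unitary_carrier[OF W]
  define B where "B = mat_adjoint W * A * W"
  have B: "hermitian ?n B" unfolding B_def by (rule hermitian_congruence[OF Suc.prems cW])
  then have cB [simp]: "B \<in> carrier_mat ?n ?n" by (simp add: hermitian_def)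
  have AW: "A *\<^sub>v col W 0 = e \<cdot>\<^sub>v col W 0"
    unfolding col using v A Av
    by (subst mult_mat_vec[of _ ?n ?n]) (auto simp: smult_smult_assoc mult.commute)
  \<comment> \<open>Column 0 of \<open>W\<close> is an eigenvector of \<open>A\<close>, so column 0
    of \<open>W^dag A W\<close> is \<open>e\<close> times the first unit vector by
    orthonormality.\<close>
  have B0: "B $$ (i, 0) = (if i = 0 then e else 0)" if "i < ?n" for i
  proof -
    have "B = mat_adjoint W * (A * W)"
      unfolding B_def by (rule assoc_mult_mat[of _ ?n ?n _ ?n _ ?n]) auto
    then have "B $$ (i, 0) = (\<Sum>k<?n. cnj (W $$ (k, i)) * (A * W) $$ (k, 0))"
      using that carrier_matD[OF cW] by (simp only:, subst index_mult_sum[of _ ?n ?n _ ?n])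
        (auto intro!: mult_carrier_mat[of _ ?n ?n _ ?n] simp del: sum.lessThan_Suc index_mult_mat(1))
    also have "\<dots> = (\<Sum>k<?n. cnj (W $$ (k, i)) * (e * W $$ (k, 0)))"
    proof (rule sum.cong[OF refl])
      fix k assume "k \<in> {..<?n}"
      then have "(A * W) $$ (k, 0) = (A *\<^sub>v col W 0) $ k"
        using carrier_matD[OF cW] carrier_matD[OF A] by simp
      also have "\<dots> = e * W $$ (k, 0)"
        unfolding AW using \<open>k \<in> {..<?n}\<close> carrier_matD[OF cW] by simp
      finally show "cnj (W $$ (k, i)) * (A * W) $$ (k, 0) = cnj (W $$ (k, i)) * (e * W $$ (k, 0))"
        by simp
    qed
    also have "\<dots> = e * (\<Sum>k<?n. cnj (W $$ (k, i)) * W $$ (k, 0))"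
      unfolding sum_distrib_left by (simp only: mult_ac)
    also have "\<dots> = (if i = 0 then e else 0)"
      using unitary_cols[OF W that, of 0] by (simp del: sum.lessThan_Suc)
    finally show ?thesis .
  qed
  \<comment> \<open>The corner entry of a Hermitian matrix equals its own conjugate.\<close>
  have ereal: "e = of_real (Re e)"
    using hermitian_index[OF B, of 0 0] B0[of 0] by (simp add: complex_eq_iff)
  have B0': "B $$ (0, j) = (if j = 0 then e else 0)" if "j < ?n" for j
    using hermitian_index[OF B, of 0 j] that B0[OF that] ereal by (auto simp: complex_eq_iff)
  define B3 where "B3 = mat m m (\<lambda>(i, j). B $$ (Suc i, Suc j))"
  have "hermitian m B3"
    by (rule hermitianI) (auto simp: B3_def intro!: hermitian_index[OF B])
  then obtain U3 l3 where U3: "unitary m U3" and B3: "B3 = conj_diag m U3 l3"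
    using Suc.IH by blast
  \<comment> \<open>The direct sum of the 1 by 1 identity and \<open>U3\<close>.\<close>
  define P where "P = mat ?n ?n (\<lambda>(i, j). case i of 0 \<Rightarrow> if j = 0 then 1 else 0
      | Suc i' \<Rightarrow> (case j of 0 \<Rightarrow> 0 | Suc j' \<Rightarrow> U3 $$ (i', j')))"
  define l where "l = case_nat (Re e) l3"
  have P: "unitary ?n P"
  proof (rule unitaryI_cols)
    fix a b assume ab: "a < ?n" "b < ?n"
    show "(\<Sum>i<?n. cnj (P $$ (i, a)) * P $$ (i, b)) = (if a = b then 1 else 0)"
      unfolding sum.lessThan_Suc_shift
      using ab unitary_cols[OF U3] by (cases a; cases b) (auto simp: P_def)
  qed (simp add: P_def)
  note cP [simp] = unitary_carrier[OF P]
  have "B = conj_diag ?n P l"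
  proof (rule eq_matI)
    fix i j assume "i < dim_row (conj_diag ?n P l)" "j < dim_col (conj_diag ?n P l)"
    then have ij: "i < ?n" "j < ?n" using carrier_matD[OF conj_diag_carrier[OF cP]] by metis+
    have "conj_diag ?n P l $$ (i, j) = (\<Sum>a<?n. P $$ (i, a) * of_real (l a) * cnj (P $$ (j, a)))"
      by (rule conj_diag_index[OF cP ij])
    also have "\<dots> = B $$ (i, j)"
    proof (cases "i = 0 \<or> j = 0")
      case True
      then show ?thesis unfolding sum.lessThan_Suc_shift
        using ij B0 B0' ereal by (cases i; cases j) (auto simp: P_def l_def)
    next
      case False
      then obtain i' j' where ij': "i = Suc i'" "j = Suc j'" "i' < m" "j' < m"
        using ij by (cases i; cases j) auto
      then have "B $$ (i, j) = conj_diag m U3 l3 $$ (i', j')"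
        unfolding B3[symmetric] by (simp add: B3_def)
      with ij' show ?thesis unfolding sum.lessThan_Suc_shift
        by (simp add: P_def l_def conj_diag_index[OF unitary_carrier[OF U3]])
    qed
    finally show "B $$ (i, j) = conj_diag ?n P l $$ (i, j)" ..
  qed (use carrier_matD[OF conj_diag_carrier[OF cP]] carrier_matD[OF cB] in metis)+
  moreover have "A = W * B * mat_adjoint W"
  proof -
    have "W * B * mat_adjoint W = (W * mat_adjoint W) * A * (W * mat_adjoint W)"
      unfolding B_def
      by (simp add: assoc_mult_mat[of _ ?n ?n _ ?n _ ?n] mult_carrier_mat[of _ ?n ?n _ ?n])
    then show ?thesis
      by (simp only: unitary_right_inverse[OF W] left_mult_one_mat[OF A] right_mult_one_mat[OF A])
  qed
  ultimately have "A = conj_diag ?n (W * P) l" by (simp only: conj_diag_mult[OF cW cP])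
  with unitary_mult[OF W P] show ?case by blast
qed

section \<open>The operator Jensen inequality\<close>

lemma quadratic_form_sum:
  assumes "A \<in> carrier_mat n n" "v \<in> carrier_vec n"
  shows "(A *\<^sub>v v) \<bullet>c v = (\<Sum>i<n. \<Sum>j<n. A $$ (i, j) * v $ j * cnj (v $ i))"
proof -
  have "(A *\<^sub>v v) \<bullet>c v = (\<Sum>i<n. (A *\<^sub>v v) $ i * cnj (v $ i))"
    using assms by (auto simp: scalar_prod_def lessThan_atLeast0)
  also have "\<dots> = (\<Sum>i<n. \<Sum>j<n. A $$ (i, j) * v $ j * cnj (v $ i))"
    by (rule sum.cong) (auto simp: index_mult_vec_sum[OF assms] sum_distrib_right)
  finally show ?thesis .
qed

lemma loewner_le_quadratic:
  assumes le: "loewner_le n X (of_real t \<cdot>\<^sub>m Y + of_real s \<cdot>\<^sub>m W)"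
    and Y: "Y \<in> carrier_mat n n" and W: "W \<in> carrier_mat n n" and v: "v \<in> carrier_vec n"
  shows "Re ((X *\<^sub>v v) \<bullet>c v) \<le> t * Re ((Y *\<^sub>v v) \<bullet>c v) + s * Re ((W *\<^sub>v v) \<bullet>c v)"
proof -
  let ?Q = "\<lambda>A. \<Sum>i<n. \<Sum>j<n. A $$ (i, j) * v $ j * cnj (v $ i)"
  let ?D = "of_real t \<cdot>\<^sub>m Y + of_real s \<cdot>\<^sub>m W - X"
  have X: "X \<in> carrier_mat n n" using le by (simp add: loewner_le_def)
  have D: "?D \<in> carrier_mat n n" using X Y W by auto
  have "?Q ?D = (\<Sum>i<n. \<Sum>j<n. of_real t * (Y $$ (i, j) * v $ j * cnj (v $ i))
      + of_real s * (W $$ (i, j) * v $ j * cnj (v $ i)) - X $$ (i, j) * v $ j * cnj (v $ i))"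
    using X Y W by (intro sum.cong refl) (auto simp: algebra_simps)
  also have "\<dots> = of_real t * ?Q Y + of_real s * ?Q W - ?Q X"
    by (simp add: sum.distrib sum_subtractf sum_distrib_left)
  finally have "(?D *\<^sub>v v) \<bullet>c v = of_real t * ?Q Y + of_real s * ?Q W - ?Q X"
    by (simp only: quadratic_form_sum[OF D v])
  moreover have "0 \<le> Re ((?D *\<^sub>v v) \<bullet>c v)"
    using le v by (simp add: loewner_le_def pos_semidef_def)
  ultimately show ?thesis
    using X Y W v by (simp add: quadratic_form_sum)
qed

text \<open>A coordinate of \<open>v\<close> vanishes unless its eigenvalue is \<open>e\<close>, so
  \<open>f (l a)\<close> may be replaced by \<open>f e\<close> coordinate by coordinate. It serves
  for a matrix of which only some eigenvectors are known explicitly.\<close>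

lemma mat_fun_eigenvector:
  assumes A: "hermitian n A" and v: "v \<in> carrier_vec n" and ev: "A *\<^sub>v v = of_real e \<cdot>\<^sub>v v"
  shows "mat_fun f A *\<^sub>v v = of_real (f e) \<cdot>\<^sub>v v"
proof -
  obtain U l where U: "unitary n U" and AU: "A = conj_diag n U l"
    using hermitian_spectral[OF A] by blast
  note cU [simp] = unitary_carrier[OF U]
  let ?s = "\<lambda>a. \<Sum>j<n. cnj (U $$ (j, a)) * v $ j"
  have s: "of_real (f (l a)) * ?s a = of_real (f e) * ?s a" if "a < n" for a
    using conj_diag_eigenvalue[OF U ev[unfolded AU] v that] by (cases "l a = e") auto
  have F: "mat_fun f A = conj_diag n U (\<lambda>a. f (l a))"
    unfolding AU by (rule mat_fun_conj_diag[OF U])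
  have "(conj_diag n U (\<lambda>a. f (l a)) *\<^sub>v v) $ i = of_real (f e) * v $ i" if i: "i < n" for i
  proof -
    have "(conj_diag n U (\<lambda>a. f (l a)) *\<^sub>v v) $ i
        = (\<Sum>j<n. \<Sum>a<n. U $$ (i, a) * of_real (f (l a)) * cnj (U $$ (j, a)) * v $ j)"
      using i by (subst index_mult_vec_sum[OF _ v i])
        (auto simp: conj_diag_index[OF cU] sum_distrib_right)
    also have "\<dots> = (\<Sum>a<n. U $$ (i, a) * (of_real (f (l a)) * ?s a))"
      by (subst sum.swap) (simp add: sum_distrib_left mult_ac)
    also have "\<dots> = (\<Sum>a<n. U $$ (i, a) * (of_real (f e) * ?s a))"
      by (intro sum.cong) (auto simp: s)
    also have "\<dots> = (\<Sum>j<n. of_real (f e) * v $ j * (\<Sum>a<n. U $$ (i, a) * cnj (U $$ (j, a))))"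
      unfolding sum_distrib_left by (subst sum.swap) (simp add: mult_ac)
    also have "\<dots> = (\<Sum>j<n. if i = j then of_real (f e) * v $ j else 0)"
      by (intro sum.cong) (auto simp: unitary_rows[OF U i])
    also have "\<dots> = of_real (f e) * v $ i" using i by simp
    finally show ?thesis .
  qed
  with v show ?thesis
    unfolding F using carrier_matD[OF conj_diag_carrier[OF cU]] by (intro eq_vecI) auto
qed

lemma mat_adjoint_four_block:
  fixes A :: "complex mat"
  assumes "A \<in> carrier_mat n1 m1" "B \<in> carrier_mat n1 m2" "C \<in> carrier_mat n2 m1" "D \<in> carrier_mat n2 m2"
  shows "mat_adjoint (four_block_mat A B C D)
    = four_block_mat (mat_adjoint A) (mat_adjoint C) (mat_adjoint B) (mat_adjoint D)"
  by (rule eq_matI) (use assms in \<open>auto simp: not_less\<close>)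

text \<open>The Halmos unitary dilation of an isometry.\<close>

lemma isometry_dilation_unitary:
  fixes C :: "complex mat"
  assumes C: "C \<in> carrier_mat M m" and iso: "mat_adjoint C * C = 1\<^sub>m m"
  shows "unitary (M + m) (four_block_mat C (1\<^sub>m M - C * mat_adjoint C) (0\<^sub>m m m) (mat_adjoint C))"
    (is "unitary _ ?U")
proof -
  let ?P = "1\<^sub>m M - C * mat_adjoint C"
  note Ca = mat_adjoint_carrier[OF C]
  have CC: "C * mat_adjoint C \<in> carrier_mat M M" using C Ca by (rule mult_carrier_mat)
  then have P: "?P \<in> carrier_mat M M" by (rule minus_carrier_mat)
  have aCC: "mat_adjoint (C * mat_adjoint C) = C * mat_adjoint C"
    by (simp add: mat_adjoint_mult[OF C Ca])
  have aP: "mat_adjoint ?P = ?P"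
  proof (rule eq_matI)
    fix i j assume "i < dim_row ?P" "j < dim_col ?P"
    then have ij: "i < M" "j < M" using carrier_matD[OF P] by auto
    have "cnj ((C * mat_adjoint C) $$ (j, i)) = (C * mat_adjoint C) $$ (i, j)"
      using ij arg_cong[OF aCC, of "\<lambda>X. X $$ (i, j)"] carrier_matD[OF CC] by (metis mat_adjoint_index)
    with ij carrier_matD[OF P] carrier_matD[OF CC] show "mat_adjoint ?P $$ (i, j) = ?P $$ (i, j)"
      by (simp del: index_mult_mat(1))
  qed (use carrier_matD[OF P] in simp_all)
  \<comment> \<open>Hence the projection \<open>?P\<close> vanishes on the range of
    \<open>C\<close>, and taking adjoints gives the other off-diagonal block.\<close>
  have C3: "C * mat_adjoint C * C = C"
    using iso C by (subst assoc_mult_mat[OF C Ca C]) simp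
  have PC: "?P * C = 0\<^sub>m M m"
    using C CC by (subst minus_mult_distrib_mat[of _ M M _ _ m]) (auto simp: C3)
  have "mat_adjoint (?P * C) = 0\<^sub>m m M"
    unfolding PC by (rule eq_matI) auto
  then have CP: "mat_adjoint C * ?P = 0\<^sub>m m M"
    unfolding mat_adjoint_mult[OF P C] aP .
  have "?P * ?P = ?P - ?P * (C * mat_adjoint C)"
    using P CC by (subst mult_minus_distrib_mat[of _ M M]) auto
  also have "?P * (C * mat_adjoint C) = ?P * C * mat_adjoint C"
    by (rule assoc_mult_mat[OF P C Ca, symmetric])
  also have "\<dots> = 0\<^sub>m M M" unfolding PC by (rule left_mult_zero_mat[OF Ca])
  finally have PP: "?P * ?P = ?P - 0\<^sub>m M M" .
  \<comment> \<open>The row blocks have sizes \<open>M\<close> and \<open>m\<close>, the column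
    blocks \<open>m\<close> and \<open>M\<close>; the first \<open>m\<close> columns of the square
    matrix are those of \<open>C\<close> padded with zeros.\<close>
  have U: "?U \<in> carrier_mat (M + m) (m + M)"
    using C Ca P by (intro four_block_carrier_mat) auto
  have aU: "mat_adjoint ?U = four_block_mat (mat_adjoint C) (0\<^sub>m m m) ?P C"
  proof -
    have "mat_adjoint (0\<^sub>m m m) = (0\<^sub>m m m :: complex mat)" by (rule eq_matI) auto
    then show ?thesis by (simp add: mat_adjoint_four_block[OF C P zero_carrier_mat Ca] aP)
  qed
  have "mat_adjoint ?U * ?U = four_block_mat (1\<^sub>m m) (0\<^sub>m m M) (0\<^sub>m M m) (1\<^sub>m M)"
    unfolding aU
  proof (subst mult_four_block_mat[OF Ca _ P C C P _ Ca])
    show "four_block_mat (mat_adjoint C * C + 0\<^sub>m m m * 0\<^sub>m m m) (mat_adjoint C * ?P + 0\<^sub>m m m * mat_adjoint C)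
       (?P * C + C * 0\<^sub>m m m) (?P * ?P + C * mat_adjoint C)
      = four_block_mat (1\<^sub>m m) (0\<^sub>m m M) (0\<^sub>m M m) (1\<^sub>m M)"
    proof (rule cong_four_block_mat)
      show "mat_adjoint C * C + 0\<^sub>m m m * 0\<^sub>m m m = 1\<^sub>m m" using iso by simp
      show "mat_adjoint C * ?P + 0\<^sub>m m m * mat_adjoint C = 0\<^sub>m m M" unfolding CP left_mult_zero_mat[OF Ca] by simp
      show "?P * C + C * 0\<^sub>m m m = 0\<^sub>m M m" unfolding PC right_mult_zero_mat[OF C] by simp
      show "?P * ?P + C * mat_adjoint C = 1\<^sub>m M"
        unfolding PP using CC by (intro eq_matI) auto
    qed
  qed auto
  also have "\<dots> = 1\<^sub>m (M + m)" by (subst add.commute) (rule four_block_one_mat)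
  finally show ?thesis using U by (simp add: unitary_def add.commute)
qed

text \<open>The Jensen operator inequality \<open>f(c\<^sup>\<dagger> A c) \<le> c\<^sup>\<dagger> f(A) c\<close> for an isometry \<open>c\<close>, written in bases
  in which \<open>A\<close> and \<open>c\<^sup>\<dagger> A c\<close> are diagonal. Dilating \<open>c\<close> to a unitary \<open>U\<close> makes \<open>c\<^sup>\<dagger> A c\<close> a diagonal
  block of \<open>B = U\<^sup>\<dagger> (A \<oplus> 1) U\<close>, and pinching \<open>B\<close> to that block is the average of \<open>B\<close> and
  \<open>Z B Z\<close> with \<open>Z = diag(1, -1)\<close>.\<close>

lemma diagonal_operator_jensen:
  fixes f :: "real \<Rightarrow> real" and c :: "nat \<Rightarrow> nat \<Rightarrow> complex" and x :: "nat \<Rightarrow> complex"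
  assumes conv: "operator_convex_on {0<..} f"
    and iso: "\<And>i i'. i < m \<Longrightarrow> i' < m \<Longrightarrow>
      (\<Sum>j<M. cnj (c j i) * c j i') = (if i = i' then 1 else 0)"
    and diag: "\<And>i i'. i < m \<Longrightarrow> i' < m \<Longrightarrow>
      (\<Sum>j<M. cnj (c j i) * of_real (mu j) * c j i') = (if i = i' then of_real (lam i) else 0)"
    and pos: "\<And>j. j < M \<Longrightarrow> 0 < mu j"
  shows "(\<Sum>i<m. f (lam i) * (cmod (x i))\<^sup>2) \<le> (\<Sum>j<M. f (mu j) * (cmod (\<Sum>i<m. c j i * x i))\<^sup>2)"
proof -
  define n where "n = M + m"
  define C where "C = mat M m (\<lambda>(j, i). c j i)"
  have C: "C \<in> carrier_mat M m" by (simp add: C_def)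
  have "mat_adjoint C * C = 1\<^sub>m m"
  proof (rule eq_matI)
    fix i j assume "i < dim_row (1\<^sub>m m)" "j < dim_col (1\<^sub>m m)"
    then show "(mat_adjoint C * C) $$ (i, j) = 1\<^sub>m m $$ (i, j)"
      using C by (subst index_mult_sum[of _ m M _ m]) (auto simp: C_def iso)
  qed (use C in auto)
  define U where "U = four_block_mat C (1\<^sub>m M - C * mat_adjoint C) (0\<^sub>m m m) (mat_adjoint C)"
  have U: "unitary n U"
    unfolding U_def n_def by (rule isometry_dilation_unitary) fact+
  note cU [simp] = unitary_carrier[OF U]
  have U1: "U $$ (a, i) = (if a < M then c a i else 0)" if "a < n" "i < m" for a i
    using that C by (auto simp: U_def C_def n_def)
  define z where "z i = (if i < m then 1 else -1 :: complex)" for i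
  \<comment> \<open>\<open>V = Z U^dag\<close>, so that \<open>Z B Z\<close> is again a conjugated
    diagonal matrix with the eigenvalues of \<open>B\<close>.\<close>
  define V where "V = mat n n (\<lambda>(i, a). z i * cnj (U $$ (a, i)))"
  have zz: "cnj (z i) * z i = 1" for i by (simp add: z_def)
  have V: "unitary n V"
  proof (rule unitaryI_cols)
    fix a b assume ab: "a < n" "b < n"
    have "(\<Sum>i<n. cnj (V $$ (i, a)) * V $$ (i, b)) = (\<Sum>i<n. (cnj (z i) * z i) * (U $$ (a, i) * cnj (U $$ (b, i))))"
      using ab by (intro sum.cong) (auto simp: V_def)
    then show "(\<Sum>i<n. cnj (V $$ (i, a)) * V $$ (i, b)) = (if a = b then 1 else 0)"
      by (simp add: zz unitary_rows[OF U ab])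
  qed (simp add: V_def)
  note cV [simp] = unitary_carrier[OF V]
  have U': "unitary n (mat_adjoint U)" by (rule unitary_adjoint[OF U])
  note cU' [simp] = unitary_carrier[OF U']
  \<comment> \<open>The eigenvalue 1 on the added dimensions keeps the spectrum positive. It drops
    out below, since the first \<open>m\<close> columns of \<open>U\<close> vanish in the added
    rows.\<close>
  define mu' where "mu' j = (if j < M then mu j else 1)" for j
  define \<xi> where "\<xi> = vec n (\<lambda>i. if i < m then x i else 0)"
  have \<xi>: "\<xi> \<in> carrier_vec n" by (simp add: \<xi>_def)
  define B where "B = conj_diag n (mat_adjoint U) mu'"
  define B' where "B' = conj_diag n V mu'"
  have [simp]: "B \<in> carrier_mat n n" "B' \<in> carrier_mat n n"
    unfolding B_def B'_def by simp_all
  have spec: "spectrum_in B {0<..}" "spectrum_in B' {0<..}"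
    using pos unfolding spectrum_in_def B_def B'_def spectrum_conj_diag[OF U'] spectrum_conj_diag[OF V]
    by (auto simp: mu'_def)
  have herm: "hermitian n B" "hermitian n B'"
    unfolding B_def B'_def by (rule hermitian_conj_diag; simp)+
  have Bij: "B $$ (i, j) = (\<Sum>a<n. cnj (U $$ (a, i)) * of_real (mu' a) * U $$ (a, j))"
    if "i < n" "j < n" for i j
    unfolding B_def using that carrier_matD[OF cU]
    by (subst conj_diag_index[OF cU']) (auto intro!: sum.cong)
  have B'ij: "B' $$ (i, j) = z i * cnj (z j) * B $$ (i, j)" if "i < n" "j < n" for i j
    unfolding B'_def Bij[OF that] using that
    by (subst conj_diag_index[OF cV]) (auto simp: V_def sum_distrib_left mult_ac intro!: sum.cong)
  have nM: "{..<M} \<subseteq> {..<n}" by (auto simp: n_def)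
  have nm: "{..<m} \<subseteq> {..<n}" by (auto simp: n_def)
  have B11: "B $$ (i, j) = (if i = j then of_real (lam i) else 0)" if "i < m" "j < m" for i j
  proof -
    have "B $$ (i, j) = (\<Sum>a<n. cnj (U $$ (a, i)) * of_real (mu' a) * U $$ (a, j))"
      using that by (intro Bij) (auto simp: n_def)
    also have "\<dots> = (\<Sum>a<M. cnj (c a i) * of_real (mu a) * c a j)"
      using nM that by (intro sum.mono_neutral_cong_right) (auto simp: U1 mu'_def n_def)
    finally show ?thesis using diag that by simp
  qed
  define S where "S = of_real (1/2) \<cdot>\<^sub>m B + of_real (1 - 1/2) \<cdot>\<^sub>m B'"
  have S: "S \<in> carrier_mat n n" by (auto simp: S_def)
  \<comment> \<open>Across the two blocks \<open>z i * cnj (z j) = -1\<close>, so the average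
    cancels; within a block the factor is 1.\<close>
  have Sij: "S $$ (i, j) = (if i < m \<longleftrightarrow> j < m then B $$ (i, j) else 0)" if "i < n" "j < n" for i j
    using that carrier_matD[of B n n] carrier_matD[of B' n n] by (auto simp: S_def B'ij z_def)
  have hS: "hermitian n S"
  proof (rule hermitianI[OF S])
    fix i j assume ij: "i < n" "j < n"
    show "S $$ (i, j) = cnj (S $$ (j, i))"
      unfolding Sij[OF ij] Sij[OF ij(2,1)] using hermitian_index[OF herm(1) ij] by auto
  qed
  have le: "loewner_le n (mat_fun f S)
      (of_real (1/2) \<cdot>\<^sub>m mat_fun f B + of_real (1 - 1/2) \<cdot>\<^sub>m mat_fun f B')"
    using conv spec herm unfolding operator_convex_on_def S_def by (elim allE[of _ n] allE[of _ B] allE[of _ B'] allE[of _ "1/2"]) simp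
  have fB: "mat_fun f B = conj_diag n (mat_adjoint U) (\<lambda>a. f (mu' a))"
    "mat_fun f B' = conj_diag n V (\<lambda>a. f (mu' a))"
    unfolding B_def B'_def by (rule mat_fun_conj_diag; fact)+
  have fS: "mat_fun f S \<in> carrier_mat n n" using le by (simp add: loewner_le_def)
  \<comment> \<open>The first \<open>m\<close> unit vectors are eigenvectors of \<open>S\<close>,
    because its upper block is diagonal. This determines the first \<open>m\<close> columns of
    \<open>f(S)\<close> without diagonalising the lower block.\<close>
  have fS1: "mat_fun f S $$ (i, j) = (if i = j then of_real (f (lam j)) else 0)" if "i < n" "j < m" for i j
  proof -
    have j: "j < n" using that by (simp add: n_def)
    have "S *\<^sub>v unit_vec n j = of_real (lam j) \<cdot>\<^sub>v unit_vec n j"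
    proof (rule eq_vecI)
      fix k assume "k < dim_vec (of_real (lam j) \<cdot>\<^sub>v unit_vec n j :: complex vec)"
      then have k: "k < n" by simp
      have "(S *\<^sub>v unit_vec n j) $ k = (\<Sum>l<n. S $$ (k, l) * unit_vec n j $ l)"
        by (rule index_mult_vec_sum[OF S _ k]) simp
      also have "\<dots> = (\<Sum>l<n. if l = j then S $$ (k, l) else 0)"
        using j by (intro sum.cong) auto
      also have "\<dots> = S $$ (k, j)" using j by simp
      finally show "(S *\<^sub>v unit_vec n j) $ k = (of_real (lam j) \<cdot>\<^sub>v unit_vec n j) $ k"
        using k j that by (simp only: Sij) (auto simp: B11)
    qed (use carrier_matD[OF S] in \<open>simp only: dim_mult_mat_vec index_smult_vec(2) index_unit_vec(3)\<close>)
    from mat_fun_eigenvector[OF hS _ this, of f]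
    have "mat_fun f S *\<^sub>v unit_vec n j = of_real (f (lam j)) \<cdot>\<^sub>v unit_vec n j" by simp
    then have "(mat_fun f S *\<^sub>v unit_vec n j) $ i = (of_real (f (lam j)) \<cdot>\<^sub>v unit_vec n j) $ i" by simp
    moreover have "(mat_fun f S *\<^sub>v unit_vec n j) $ i = (\<Sum>l<n. mat_fun f S $$ (i, l) * unit_vec n j $ l)"
      by (rule index_mult_vec_sum[OF fS _ that(1)]) simp
    moreover have "\<dots> = (\<Sum>l<n. if l = j then mat_fun f S $$ (i, l) else 0)"
      using j by (intro sum.cong) auto
    ultimately show ?thesis using j that by (auto split: if_splits)
  qed
  have lhs: "(mat_fun f S *\<^sub>v \<xi>) \<bullet>c \<xi> = of_real (\<Sum>i<m. f (lam i) * (cmod (x i))\<^sup>2)"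
  proof -
    have "(mat_fun f S *\<^sub>v \<xi>) \<bullet>c \<xi> = (\<Sum>i<n. \<Sum>j<n. mat_fun f S $$ (i, j) * \<xi> $ j * cnj (\<xi> $ i))"
      by (rule quadratic_form_sum[OF fS \<xi>])
    also have "\<dots> = (\<Sum>i<m. \<Sum>j<n. mat_fun f S $$ (i, j) * \<xi> $ j * cnj (\<xi> $ i))"
      using nm by (intro sum.mono_neutral_right) (auto simp: \<xi>_def)
    also have "\<dots> = (\<Sum>i<m. \<Sum>j<m. if j = i then of_real (f (lam j)) * (x j * cnj (x j)) else 0)"
      using nm by (intro sum.cong[OF refl] sum.mono_neutral_cong_right) (auto simp: \<xi>_def fS1)
    also have "\<dots> = of_real (\<Sum>i<m. f (lam i) * (cmod (x i))\<^sup>2)"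
      by (simp only: of_real_sum of_real_mult complex_norm_square) simp
    finally show ?thesis .
  qed
  have sU: "(\<Sum>i<n. U $$ (a, i) * \<xi> $ i) = (if a < M then \<Sum>i<m. c a i * x i else 0)" if "a < n" for a
  proof -
    have "(\<Sum>i<n. U $$ (a, i) * \<xi> $ i) = (\<Sum>i<m. (if a < M then c a i else 0) * x i)"
      using nm that by (intro sum.mono_neutral_cong_right) (auto simp: \<xi>_def U1)
    then show ?thesis by simp
  qed
  have tail: "(\<Sum>a<n. f (mu' a) * (cmod (if a < M then \<Sum>i<m. c a i * x i else 0))\<^sup>2)
      = (\<Sum>j<M. f (mu j) * (cmod (\<Sum>i<m. c j i * x i))\<^sup>2)"
    using nM by (intro sum.mono_neutral_cong_right) (auto simp: mu'_def)
  have r1: "(mat_fun f B *\<^sub>v \<xi>) \<bullet>c \<xi> = of_real (\<Sum>j<M. f (mu j) * (cmod (\<Sum>i<m. c j i * x i))\<^sup>2)"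
  proof -
    have eq: "(\<Sum>i<n. cnj (mat_adjoint U $$ (i, a)) * \<xi> $ i) = (\<Sum>i<n. U $$ (a, i) * \<xi> $ i)" if "a < n" for a
      using that carrier_matD[OF cU] by (intro sum.cong) auto
    show ?thesis
      unfolding fB conj_diag_quadratic[OF cU' \<xi>] tail[symmetric] 
      by (intro arg_cong[of _ _ of_real] sum.cong refl) (simp only: eq sU lessThan_iff)
  qed
  \<comment> \<open>The vector is supported where \<open>z\<close> is 1, so \<open>B'\<close> gives
    the same value as \<open>B\<close>.\<close>
  have r2: "(mat_fun f B' *\<^sub>v \<xi>) \<bullet>c \<xi> = of_real (\<Sum>j<M. f (mu j) * (cmod (\<Sum>i<m. c j i * x i))\<^sup>2)"
  proof -
    have eq: "(\<Sum>i<n. cnj (V $$ (i, a)) * \<xi> $ i) = (\<Sum>i<n. U $$ (a, i) * \<xi> $ i)" if "a < n" for a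
      using that by (intro sum.cong) (auto simp: V_def z_def \<xi>_def)
    show ?thesis
      unfolding fB conj_diag_quadratic[OF cV \<xi>] tail[symmetric] 
      by (intro arg_cong[of _ _ of_real] sum.cong refl) (simp only: eq sU lessThan_iff)
  qed
  have "mat_fun f B \<in> carrier_mat n n" "mat_fun f B' \<in> carrier_mat n n"
    unfolding fB by simp_all
  from loewner_le_quadratic[OF le this \<xi>] show ?thesis
    unfolding lhs r1 r2 by simp
qed

text \<open>Enumerating the index sets allows products and disjoint sums as indices, which is how
  eigenvalue pairs and the blocks of a frame are labelled below.\<close>

lemma operator_jensen:
  fixes f :: "real \<Rightarrow> real" and c :: "'a \<Rightarrow> 'b \<Rightarrow> complex" and x :: "'b \<Rightarrow> complex"
  assumes conv: "operator_convex_on {0<..} f" and fin: "finite S" "finite T"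
    and iso: "\<And>i i'. i \<in> T \<Longrightarrow> i' \<in> T \<Longrightarrow>
      (\<Sum>j\<in>S. cnj (c j i) * c j i') = (if i = i' then 1 else 0)"
    and diag: "\<And>i i'. i \<in> T \<Longrightarrow> i' \<in> T \<Longrightarrow>
      (\<Sum>j\<in>S. cnj (c j i) * of_real (mu j) * c j i') = (if i = i' then of_real (lam i) else 0)"
    and pos: "\<And>j. j \<in> S \<Longrightarrow> 0 < mu j"
  shows "(\<Sum>i\<in>T. f (lam i) * (cmod (x i))\<^sup>2) \<le> (\<Sum>j\<in>S. f (mu j) * (cmod (\<Sum>i\<in>T. c j i * x i))\<^sup>2)"
proof -
  from fin obtain g h where g: "bij_betw g {..<card S} S" and h: "bij_betw h {..<card T} T"
    using ex_bij_betw_nat_finite unfolding lessThan_atLeast0 by meson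
  note reg = sum.reindex_bij_betw[OF g] and reh = sum.reindex_bij_betw[OF h]
  have gS: "g j \<in> S" if "j < card S" for j using g that by (auto simp: bij_betw_def)
  have hT: "h i \<in> T" if "i < card T" for i using h that by (auto simp: bij_betw_def)
  have hinj: "h i = h i' \<longleftrightarrow> i = i'" if "i < card T" "i' < card T" for i i'
    using h that by (auto simp: bij_betw_def inj_on_def)
  have "(\<Sum>i<card T. f (lam (h i)) * (cmod (x (h i)))\<^sup>2)
      \<le> (\<Sum>j<card S. f (mu (g j)) * (cmod (\<Sum>i<card T. c (g j) (h i) * x (h i)))\<^sup>2)"
  proof (rule diagonal_operator_jensen[OF conv])
    fix i i' assume *: "i < card T" "i' < card T"
    show "(\<Sum>j<card S. cnj (c (g j) (h i)) * c (g j) (h i')) = (if i = i' then 1 else 0)"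
      using iso[OF hT[OF *(1)] hT[OF *(2)]] hinj[OF *]
        reg[of "\<lambda>j. cnj (c j (h i)) * c j (h i')"] by simp
    show "(\<Sum>j<card S. cnj (c (g j) (h i)) * of_real (mu (g j)) * c (g j) (h i'))
        = (if i = i' then of_real (lam (h i)) else 0)"
      using diag[OF hT[OF *(1)] hT[OF *(2)]] hinj[OF *]
        reg[of "\<lambda>j. cnj (c j (h i)) * of_real (mu j) * c j (h i')"] by simp
  qed (use pos gS in auto)
  then show ?thesis
    using reh[of "\<lambda>i. f (lam i) * (cmod (x i))\<^sup>2"] reh[of "\<lambda>i. c _ i * x i"]
      reg[of "\<lambda>j. f (mu j) * (cmod (\<Sum>i\<in>T. c j i * x i))\<^sup>2"] by simp
qed

section \<open>The relative entropy as a sum over eigenvalues\<close>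

lemma mult_add_less_mult:
  fixes i k n m :: nat
  assumes "i < n" "k < m"
  shows "i * m + k < n * m"
proof -
  have "i * m + k < Suc i * m" using assms by simp
  also have "\<dots> \<le> n * m" using assms by (intro mult_le_mono) auto
  finally show ?thesis .
qed

lemma sum_div_mod:
  fixes n m :: nat
  shows "(\<Sum>r<n * m. g (r div m) (r mod m)) = (\<Sum>i<n. \<Sum>k<m. g i k)"
proof (cases "m = 0")
  case False
  then have "(\<Sum>(i, k)\<in>{..<n} \<times> {..<m}. g i k) = (\<Sum>r<n * m. g (r div m) (r mod m))"
    by (intro sum.reindex_bij_witness[of _ "\<lambda>r. (r div m, r mod m)" "\<lambda>(i, k). i * m + k"])
      (auto simp: less_mult_imp_div_less mult_add_less_mult)
  then show ?thesis by (simp add: sum.cartesian_product)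
qed simp

lemma mod_less_of_mult: "r < n * m \<Longrightarrow> r mod m < (m :: nat)"
  by (cases "m = 0") auto

section \<open>Eigenbasis of the relative modular operator\<close>

lemma conj_diag_times:
  assumes U: "unitary n U"
  shows "conj_diag n U l * conj_diag n U k = conj_diag n U (\<lambda>i. l i * k i)"
proof -
  note c [simp] = unitary_carrier[OF U]
  let ?D = "\<lambda>l::nat \<Rightarrow> real. mat_diag n (\<lambda>i. complex_of_real (l i))"
  have "conj_diag n U l * conj_diag n U k = U * (?D l * (mat_adjoint U * U) * ?D k) * mat_adjoint U"
    unfolding conj_diag_def
    by (simp add: assoc_mult_mat[of _ n n _ n _ n] mult_carrier_mat[of _ n n _ n] del: mat_diag_diag)
  also have "mat_adjoint U * U = 1\<^sub>m n" using U by (simp add: unitary_def)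
  also have "?D l * 1\<^sub>m n * ?D k = ?D (\<lambda>i. l i * k i)"
    by (simp add: right_mult_one_mat[OF mat_diag_dim])
  finally show ?thesis by (simp add: conj_diag_def)
qed

lemma conj_diag_one:
  assumes U: "unitary n U"
  shows "conj_diag n U (\<lambda>_. 1) = 1\<^sub>m n"
  using unitary_right_inverse[OF U] right_mult_one_mat[OF unitary_carrier[OF U]]
  by (simp add: conj_diag_def)

lemma conj_diag_cong: "(\<And>i. i < n \<Longrightarrow> l i = k i) \<Longrightarrow> conj_diag n U l = conj_diag n U k"
  unfolding conj_diag_def by (rule arg_cong[of _ _ "\<lambda>D. U * D * mat_adjoint U"]) (auto simp: mat_diag_def)

text \<open>Exhibiting an inverse makes \<open>mat_inverse\<close> return some \<open>C\<close>; as
  a left inverse, \<open>C\<close> coincides with the exhibited right inverse.\<close>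

lemma mat_inverse_conj_diag:
  assumes U: "unitary n U" and p: "\<And>i. i < n \<Longrightarrow> p i \<noteq> 0"
  shows "mat_inverse (conj_diag n U p) = Some (conj_diag n U (\<lambda>i. 1 / p i))"
proof -
  note c [simp] = unitary_carrier[OF U]
  let ?A = "conj_diag n U p" and ?B = "conj_diag n U (\<lambda>i. 1 / p i)"
  have A: "?A \<in> carrier_mat n n" and B: "?B \<in> carrier_mat n n" by simp_all
  have AB: "?A * ?B = 1\<^sub>m n" "?B * ?A = 1\<^sub>m n"
    unfolding conj_diag_times[OF U] conj_diag_one[OF U, symmetric]
    by (rule conj_diag_cong, simp add: p)+
  have "?A \<in> Units (ring_mat TYPE(complex) n ())"
    unfolding Units_def ring_mat_def using A B AB by auto
  then obtain C where C: "mat_inverse ?A = Some C"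
    using mat_inverse(1)[OF A, where b = "()"] by (cases "mat_inverse ?A") auto
  from mat_inverse(2)[OF A this] have CA: "C * ?A = 1\<^sub>m n" "C \<in> carrier_mat n n" by auto
  have "C * (?A * ?B) = C * ?A * ?B" by (rule assoc_mult_mat[OF CA(2) A B, symmetric])
  then have "C = ?B" using CA AB left_mult_one_mat[OF B] by simp
  with C show ?thesis by simp
qed

text \<open>Transposing the inverse of \<open>\<rho>\<close> conjugates its eigenvectors, so
  \<open>Q\<close> is W tensor the entrywise conjugate of U. In a column index \<open>c\<close>, the
  quotient labels an eigenvector of \<open>\<sigma>\<close> and the remainder one of
  \<open>\<rho>\<close>.\<close>

lemma rel_modular_conj_diag:
  assumes U: "unitary n U" and W: "unitary n W" and p: "\<And>i. i < n \<Longrightarrow> 0 < p i"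
  defines "Q \<equiv> mat (n * n) (n * n) (\<lambda>(r, c). W $$ (r div n, c div n) * cnj (U $$ (r mod n, c mod n)))"
  shows "unitary (n * n) Q"
    and "rel_modular (conj_diag n U p) (conj_diag n W q)
      = conj_diag (n * n) Q (\<lambda>c. q (c div n) / p (c mod n))"
proof -
  note cU [simp] = unitary_carrier[OF U] and cW [simp] = unitary_carrier[OF W]
  have Q: "Q \<in> carrier_mat (n * n) (n * n)" by (simp add: Q_def)
  note dm = less_mult_imp_div_less mod_less_of_mult
  show "unitary (n * n) Q"
  proof (rule unitaryI_cols[OF Q])
    fix a b assume ab: "a < n * n" "b < n * n"
    let ?W = "\<lambda>r. cnj (W $$ (r, a div n)) * W $$ (r, b div n)"
    let ?U = "\<lambda>r. U $$ (r, a mod n) * cnj (U $$ (r, b mod n))"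
    have "(\<Sum>i<n * n. cnj (Q $$ (i, a)) * Q $$ (i, b)) = (\<Sum>i<n * n. ?W (i div n) * ?U (i mod n))"
      using ab by (intro sum.cong) (auto simp: Q_def)
    also have "\<dots> = (\<Sum>i<n. ?W i) * (\<Sum>k<n. ?U k)"
      unfolding sum_div_mod[of "\<lambda>i k. ?W i * ?U k"] sum_product ..
    also have "(\<Sum>k<n. ?U k) = cnj (\<Sum>k<n. cnj (U $$ (k, a mod n)) * U $$ (k, b mod n))"
      by simp
    also have "(\<Sum>i<n. ?W i) * \<dots> = (if a = b then 1 else 0)"
      using ab by (auto simp: unitary_cols[OF W] unitary_cols[OF U] dm) (metis div_mult_mod_eq)
    finally show "(\<Sum>i<n * n. cnj (Q $$ (i, a)) * Q $$ (i, b)) = (if a = b then 1 else 0)" .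
  qed
  have inv: "the (mat_inverse (conj_diag n U p)) = conj_diag n U (\<lambda>i. 1 / p i)"
    by (subst mat_inverse_conj_diag[OF U]) (use p in force)+
  have dW: "dim_row (conj_diag n W q) = n" "dim_col (conj_diag n W q) = n"
    and dU: "dim_row (conj_diag n U l) = n" "dim_col (conj_diag n U l) = n" for l
    using carrier_matD[OF conj_diag_carrier[OF cW]] carrier_matD[OF conj_diag_carrier[OF cU]] by auto
  show "rel_modular (conj_diag n U p) (conj_diag n W q)
      = conj_diag (n * n) Q (\<lambda>c. q (c div n) / p (c mod n))"
  proof (rule eq_matI)
    fix r s assume "r < dim_row (conj_diag (n * n) Q (\<lambda>c. q (c div n) / p (c mod n)))"
      "s < dim_col (conj_diag (n * n) Q (\<lambda>c. q (c div n) / p (c mod n)))"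
    then have rs: "r < n * n" "s < n * n" using carrier_matD[OF conj_diag_carrier[OF Q]] by auto
    let ?w = "\<lambda>j. W $$ (r div n, j) * of_real (q j) * cnj (W $$ (s div n, j))"
    let ?u = "\<lambda>i. U $$ (s mod n, i) * of_real (1 / p i) * cnj (U $$ (r mod n, i))"
    have "rel_modular (conj_diag n U p) (conj_diag n W q) $$ (r, s)
        = conj_diag n W q $$ (r div n, s div n) * conj_diag n U (\<lambda>i. 1 / p i) $$ (s mod n, r mod n)"
      unfolding rel_modular_def kron_def inv using rs by (simp add: dW dU dm)
    also have "\<dots> = (\<Sum>j<n. ?w j) * (\<Sum>i<n. ?u i)"
      using rs by (simp add: conj_diag_index[OF cW] conj_diag_index[OF cU] dm)
    also have "\<dots> = (\<Sum>a<n * n. ?w (a div n) * ?u (a mod n))"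
      unfolding sum_div_mod[of "\<lambda>j i. ?w j * ?u i"] sum_product ..
    also have "\<dots> = (\<Sum>a<n * n. Q $$ (r, a) * of_real (q (a div n) / p (a mod n)) * cnj (Q $$ (s, a)))"
      using rs by (intro sum.cong) (auto simp: Q_def)
    finally show "rel_modular (conj_diag n U p) (conj_diag n W q) $$ (r, s)
        = conj_diag (n * n) Q (\<lambda>c. q (c div n) / p (c mod n)) $$ (r, s)"
      by (simp only: conj_diag_index[OF Q rs])
  qed (use carrier_matD[OF conj_diag_carrier[OF Q]] in \<open>auto simp: rel_modular_def kron_def inv dW dU\<close>)
qed

text \<open>The quadratic form of \<open>mat_fun f (rel_modular \<rho> \<sigma>)\<close> is expanded
  in the product eigenbasis. All later estimates of \<open>S_f\<close> start from this sum.\<close>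

theorem f_rel_entropy_spectral:
  assumes U: "unitary n U" and W: "unitary n W" and p: "\<And>i. i < n \<Longrightarrow> 0 < p i"
  shows "f_rel_entropy f (conj_diag n U p) (conj_diag n W q)
    = (\<Sum>i<n. \<Sum>j<n. p i * f (q j / p i) * (cmod (\<Sum>k<n. cnj (W $$ (k, j)) * U $$ (k, i)))\<^sup>2)"
proof -
  note cU [simp] = unitary_carrier[OF U] and cW [simp] = unitary_carrier[OF W]
  note dm = less_mult_imp_div_less mod_less_of_mult
  define Q where "Q = mat (n * n) (n * n) (\<lambda>(r, c). W $$ (r div n, c div n) * cnj (U $$ (r mod n, c mod n)))"
  have Q: "unitary (n * n) Q" and R: "rel_modular (conj_diag n U p) (conj_diag n W q)
      = conj_diag (n * n) Q (\<lambda>c. q (c div n) / p (c mod n))"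
    unfolding Q_def using rel_modular_conj_diag[OF U W p] by auto
  note cQ = unitary_carrier[OF Q]
  have dU: "dim_row (conj_diag n U l) = n" "dim_col (conj_diag n U l) = n" for l
    using carrier_matD[OF conj_diag_carrier[OF cU]] by auto
  define v where "v = vec_rows (mat_fun sqrt (conj_diag n U p))"
  have v: "v \<in> carrier_vec (n * n)"
    unfolding v_def mat_fun_conj_diag[OF U] by (simp add: vec_rows_def dU)
  let ?o = "\<lambda>j i. \<Sum>k<n. cnj (W $$ (k, j)) * U $$ (k, i)"
  \<comment> \<open>The square root of \<open>\<rho>\<close> vectorises to the sum of sqrt(p_i) u_i
    tensor conj(u_i). Pairing it with w_j tensor conj(u_i) leaves sqrt(p_i) times the overlap of w_j
    and u_i.\<close>
  have s: "(\<Sum>r<n * n. cnj (Q $$ (r, a)) * v $ r) = of_real (sqrt (p (a mod n))) * ?o (a div n) (a mod n)"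
    if a: "a < n * n" for a
  proof -
    let ?w = "\<lambda>k. cnj (W $$ (k, a div n))" and ?u = "\<lambda>l. U $$ (l, a mod n)"
    have am: "a mod n < n" using a by (rule mod_less_of_mult)
    have "(\<Sum>r<n * n. cnj (Q $$ (r, a)) * v $ r)
        = (\<Sum>r<n * n. ?w (r div n) * ?u (r mod n) * conj_diag n U (\<lambda>i. sqrt (p i)) $$ (r div n, r mod n))"
      using a by (intro sum.cong) (auto simp: Q_def v_def mat_fun_conj_diag[OF U] vec_rows_def dU)
    also have "\<dots> = (\<Sum>k<n. \<Sum>l<n. ?w k * ?u l * conj_diag n U (\<lambda>i. sqrt (p i)) $$ (k, l))"
      by (rule sum_div_mod)
    also have "\<dots> = (\<Sum>k<n. \<Sum>l<n. \<Sum>i<n. ?w k * U $$ (k, i) * of_real (sqrt (p i)) * (cnj (U $$ (l, i)) * ?u l))"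
      by (intro sum.cong refl) (simp add: conj_diag_index[OF cU] sum_distrib_left mult_ac)
    also have "\<dots> = (\<Sum>k<n. \<Sum>i<n. ?w k * U $$ (k, i) * of_real (sqrt (p i)) * (\<Sum>l<n. cnj (U $$ (l, i)) * ?u l))"
      unfolding sum_distrib_left by (intro sum.cong refl sum.swap)
    also have "\<dots> = (\<Sum>k<n. \<Sum>i<n. if i = a mod n then ?w k * U $$ (k, i) * of_real (sqrt (p i)) else 0)"
      by (intro sum.cong refl) (auto simp: unitary_cols[OF U _ am])
    also have "\<dots> = of_real (sqrt (p (a mod n))) * ?o (a div n) (a mod n)"
      using am by (simp add: sum_distrib_left mult_ac)
    finally show ?thesis .
  qed
  have "f_rel_entropy f (conj_diag n U p) (conj_diag n W q)
      = (\<Sum>a<n * n. f (q (a div n) / p (a mod n)) * (cmod (\<Sum>r<n * n. cnj (Q $$ (r, a)) * v $ r))\<^sup>2)"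
    unfolding f_rel_entropy_def R mat_fun_conj_diag[OF Q] v_def[symmetric] conj_diag_quadratic[OF cQ v]
    by simp
  also have "\<dots> = (\<Sum>a<n * n. p (a mod n) * f (q (a div n) / p (a mod n)) * (cmod (?o (a div n) (a mod n)))\<^sup>2)"
  proof (rule sum.cong[OF refl])
    fix a assume "a \<in> {..<n * n}"
    then have "0 < p (a mod n)" using p mod_less_of_mult by simp
    with \<open>a \<in> {..<n * n}\<close> show "f (q (a div n) / p (a mod n)) * (cmod (\<Sum>r<n * n. cnj (Q $$ (r, a)) * v $ r))\<^sup>2
        = p (a mod n) * f (q (a div n) / p (a mod n)) * (cmod (?o (a div n) (a mod n)))\<^sup>2"
      by (simp add: s norm_mult power_mult_distrib)
  qed
  also have "\<dots> = (\<Sum>j<n. \<Sum>i<n. p i * f (q j / p i) * (cmod (?o j i))\<^sup>2)"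
    by (rule sum_div_mod)
  also have "\<dots> = (\<Sum>i<n. \<Sum>j<n. p i * f (q j / p i) * (cmod (?o j i))\<^sup>2)"
    by (rule sum.swap)
  finally show ?thesis .
qed

section \<open>Monotonicity under completely positive trace-preserving maps\<close>

lemma sum_swap_pairs:
  "(\<Sum>a\<in>A. \<Sum>b\<in>B. \<Sum>k\<in>K. \<Sum>l\<in>L. T a b k l) = (\<Sum>k\<in>K. \<Sum>l\<in>L. \<Sum>a\<in>A. \<Sum>b\<in>B. T a b k l)"
proof -
  have "(\<Sum>a\<in>A. \<Sum>b\<in>B. \<Sum>k\<in>K. \<Sum>l\<in>L. T a b k l)
      = (\<Sum>a\<in>A. \<Sum>k\<in>K. \<Sum>b\<in>B. \<Sum>l\<in>L. T a b k l)"
    by (intro sum.cong refl sum.swap)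
  also have "\<dots> = (\<Sum>k\<in>K. \<Sum>a\<in>A. \<Sum>b\<in>B. \<Sum>l\<in>L. T a b k l)"
    by (rule sum.swap)
  also have "\<dots> = (\<Sum>k\<in>K. \<Sum>a\<in>A. \<Sum>l\<in>L. \<Sum>b\<in>B. T a b k l)"
    by (intro sum.cong refl sum.swap)
  also have "\<dots> = (\<Sum>k\<in>K. \<Sum>l\<in>L. \<Sum>a\<in>A. \<Sum>b\<in>B. T a b k l)"
    by (intro sum.cong refl sum.swap)
  finally show ?thesis .
qed

lemma sum_Times: "(\<Sum>ab\<in>A \<times> B. h ab) = (\<Sum>a\<in>A. \<Sum>b\<in>B. h (a, b))"
  by (simp add: sum.cartesian_product split_def)

lemma sum_delta_mult:
  fixes g :: "'a \<Rightarrow> 'b::semiring_1"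
  assumes "finite S" "a \<in> S"
  shows "(\<Sum>i\<in>S. (if a = i then 1 else 0) * g i) = g a" "(\<Sum>i\<in>S. g i * (if a = i then 1 else 0)) = g a"
    "(\<Sum>i\<in>S. (if i = a then 1 else 0) * g i) = g a" "(\<Sum>i\<in>S. g i * (if i = a then 1 else 0)) = g a"
proof -
  have "(if a = i then 1 else 0) * g i = (if i = a then g i else 0)"
    "g i * (if a = i then 1 else 0) = (if i = a then g i else 0)"
    "(if i = a then 1 else 0) * g i = (if i = a then g i else 0)"
    "g i * (if i = a then 1 else 0) = (if i = a then g i else 0)" for i by auto
  with assms show "(\<Sum>i\<in>S. (if a = i then 1 else 0) * g i) = g a" "(\<Sum>i\<in>S. g i * (if a = i then 1 else 0)) = g a"
    "(\<Sum>i\<in>S. (if i = a then 1 else 0) * g i) = g a" "(\<Sum>i\<in>S. g i * (if i = a then 1 else 0)) = g a"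
    by simp_all
qed

text \<open>Once the two overlaps are expanded, the indices \<open>a\<close> and \<open>b\<close>
  separate. This reduces the Gram matrix of the Jensen isometry to frame sums for each state
  alone.\<close>

lemma sum_overlap_product:
  fixes y y' :: "'k \<Rightarrow> 'a \<Rightarrow> complex" and z z' :: "'k \<Rightarrow> 'b \<Rightarrow> complex"
  shows "(\<Sum>a\<in>A. \<Sum>b\<in>B. g a * h b * (cnj (\<Sum>k\<in>K. cnj (z k b) * y k a) * (\<Sum>k\<in>K. cnj (z' k b) * y' k a)))
    = (\<Sum>k\<in>K. \<Sum>l\<in>K. (\<Sum>a\<in>A. g a * (y' l a * cnj (y k a))) * (\<Sum>b\<in>B. h b * (z k b * cnj (z' l b))))"
proof -
  have "(\<Sum>a\<in>A. \<Sum>b\<in>B. g a * h b * (cnj (\<Sum>k\<in>K. cnj (z k b) * y k a) * (\<Sum>k\<in>K. cnj (z' k b) * y' k a)))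
      = (\<Sum>a\<in>A. \<Sum>b\<in>B. \<Sum>k\<in>K. \<Sum>l\<in>K. g a * (y' l a * cnj (y k a)) * (h b * (z k b * cnj (z' l b))))"
    unfolding cnj_sum sum_product unfolding sum_distrib_left
    by (intro sum.cong refl) (simp add: mult_ac)
  also have "\<dots> = (\<Sum>k\<in>K. \<Sum>l\<in>K. \<Sum>a\<in>A. \<Sum>b\<in>B. g a * (y' l a * cnj (y k a)) * (h b * (z k b * cnj (z' l b))))"
    by (rule sum_swap_pairs)
  finally show ?thesis by (simp only: sum_product)
qed

text \<open>The matrix \<open>c\<close> below is the Jensen isometry in coordinates. For its Gram
  matrix, the frame \<open>z\<close> collapses the sum over \<open>b\<close> and the reduced state
  of \<open>y\<close> supplies \<open>p' i\<close>. With the weight \<open>q b / p a\<close>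
  inserted the roles are exchanged: \<open>y\<close> collapses the sum over \<open>a\<close> and
  \<open>z\<close> supplies \<open>q' j\<close>. So the compressed operator is diagonal with entries
  \<open>q' j / p' i\<close>.\<close>

lemma reduced_frame_jensen:
  fixes f :: "real \<Rightarrow> real" and y :: "nat \<Rightarrow> 'a \<Rightarrow> nat \<Rightarrow> complex" and z :: "nat \<Rightarrow> 'b \<Rightarrow> nat \<Rightarrow> complex"
  assumes conv: "operator_convex_on {0<..} f" and fin: "finite A" "finite B"
    and pos: "\<And>a. a \<in> A \<Longrightarrow> 0 < p a" "\<And>b. b \<in> B \<Longrightarrow> 0 < q b" "\<And>i. i < N \<Longrightarrow> 0 < p' i"
    and yframe: "\<And>i i' k k'. i < N \<Longrightarrow> i' < N \<Longrightarrow> k < R \<Longrightarrow> k' < R \<Longrightarrow>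
      (\<Sum>a\<in>A. y i a k * cnj (y i' a k')) = (if i = i' \<and> k = k' then 1 else 0)"
    and zframe: "\<And>i i' k k'. i < N \<Longrightarrow> i' < N \<Longrightarrow> k < R \<Longrightarrow> k' < R \<Longrightarrow>
      (\<Sum>b\<in>B. z i b k * cnj (z i' b k')) = (if i = i' \<and> k = k' then 1 else 0)"
    and yred: "\<And>i i'. i < N \<Longrightarrow> i' < N \<Longrightarrow>
      (\<Sum>k<R. \<Sum>a\<in>A. of_real (p a) * (y i a k * cnj (y i' a k))) = (if i = i' then of_real (p' i) else 0)"
    and zred: "\<And>i i'. i < N \<Longrightarrow> i' < N \<Longrightarrow>
      (\<Sum>k<R. \<Sum>b\<in>B. of_real (q b) * (z i b k * cnj (z i' b k))) = (if i = i' then of_real (q' i) else 0)"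
  shows "(\<Sum>i<N. \<Sum>j<N. f (q' j / p' i) * (cmod (x i j))\<^sup>2)
    \<le> (\<Sum>a\<in>A. \<Sum>b\<in>B. f (q b / p a) *
         (cmod (\<Sum>i<N. \<Sum>j<N. of_real (sqrt (p a / p' i)) * (\<Sum>k<R. cnj (z j b k) * y i a k) * x i j))\<^sup>2)"
proof -
  define o' where "o' = (\<lambda>a b i j. \<Sum>k<R. cnj (z j b k) * y i a k)"
  define c where "c = (\<lambda>(a, b) (i, j). complex_of_real (sqrt (p a / p' i)) * o' a b i j)"
  have iso: "(\<Sum>ab\<in>A \<times> B. cnj (c ab ij) * c ab ij') = (if ij = ij' then 1 else 0)"
    and diag: "(\<Sum>ab\<in>A \<times> B. cnj (c ab ij) * of_real ((\<lambda>(a, b). q b / p a) ab) * c ab ij')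
        = (if ij = ij' then of_real ((\<lambda>(i, j). q' j / p' i) ij) else 0)"
    if mem: "ij \<in> {..<N} \<times> {..<N}" "ij' \<in> {..<N} \<times> {..<N}" for ij ij'
  proof -
    obtain i j i' j' where ij: "ij = (i, j)" "ij' = (i', j')" by (cases ij, cases ij') blast
    have l: "i < N" "j < N" "i' < N" "j' < N" using mem ij by auto
    let ?s = "complex_of_real (1 / (sqrt (p' i) * sqrt (p' i')))"
    have "(\<Sum>ab\<in>A \<times> B. cnj (c ab ij) * c ab ij')
        = (\<Sum>a\<in>A. \<Sum>b\<in>B. ?s * of_real (p a) * 1 * (cnj (o' a b i j) * o' a b i' j'))"
      unfolding sum_Times ij
    proof (intro sum.cong refl)
      fix a b assume "a \<in> A"
      have "sqrt (p a / p' i) * sqrt (p a / p' i') = 1 / (sqrt (p' i) * sqrt (p' i')) * p a"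
        using pos(1)[OF \<open>a \<in> A\<close>] by (simp add: real_sqrt_divide)
      then have "of_real (sqrt (p a / p' i)) * of_real (sqrt (p a / p' i')) = ?s * of_real (p a)"
        by (simp only: of_real_mult[symmetric])
      then show "cnj (c (a, b) (i, j)) * c (a, b) (i', j')
          = ?s * of_real (p a) * 1 * (cnj (o' a b i j) * o' a b i' j')"
        unfolding c_def by (simp only: split complex_cnj_mult complex_cnj_complex_of_real) (simp only: mult_ac mult_1_left mult_1_right)
    qed
    also have "\<dots> = (\<Sum>k<R. \<Sum>l<R. (\<Sum>a\<in>A. ?s * of_real (p a) * (y i' a l * cnj (y i a k)))
        * (\<Sum>b\<in>B. 1 * (z j b k * cnj (z j' b l))))"
      unfolding o'_def by (rule sum_overlap_product)
    \<comment> \<open>Only \<open>k = l\<close> survives, which turns the remaining sum into a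
      partial trace over the discarded factor.\<close>
    also have "\<dots> = (\<Sum>k<R. \<Sum>l<R. if k = l then ?s * (\<Sum>a\<in>A. of_real (p a) * (y i' a l * cnj (y i a k)))
        * (if j = j' then 1 else 0) else 0)"
      using l by (intro sum.cong refl) (auto simp: zframe sum_distrib_left mult.assoc)
    also have "\<dots> = ?s * (\<Sum>k<R. \<Sum>a\<in>A. of_real (p a) * (y i' a k * cnj (y i a k))) * (if j = j' then 1 else 0)"
      by (simp add: sum_distrib_left sum_distrib_right)
    also have "\<dots> = (if ij = ij' then 1 else 0)"
      using l pos(3)[of i] ij by (auto simp: yred simp flip: of_real_mult)
    finally show "(\<Sum>ab\<in>A \<times> B. cnj (c ab ij) * c ab ij') = (if ij = ij' then 1 else 0)" .
    have "(\<Sum>ab\<in>A \<times> B. cnj (c ab ij) * of_real ((\<lambda>(a, b). q b / p a) ab) * c ab ij')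
        = (\<Sum>a\<in>A. \<Sum>b\<in>B. ?s * of_real (q b) * (cnj (o' a b i j) * o' a b i' j'))"
      unfolding sum_Times ij
    proof (intro sum.cong refl)
      fix a b assume "a \<in> A"
      \<comment> \<open>The two square roots contribute one factor \<open>p a\<close>, which cancels
        the denominator of the eigenvalue ratio.\<close>
      have "sqrt (p a / p' i) * sqrt (p a / p' i') * (q b / p a) = 1 / (sqrt (p' i) * sqrt (p' i')) * q b"
        using pos(1)[OF \<open>a \<in> A\<close>] by (simp add: real_sqrt_divide)
      then have "of_real (sqrt (p a / p' i)) * of_real (sqrt (p a / p' i')) * of_real (q b / p a) = ?s * of_real (q b)"
        by (simp only: of_real_mult[symmetric])
      then show "cnj (c (a, b) (i, j)) * of_real ((\<lambda>(a, b). q b / p a) (a, b)) * c (a, b) (i', j')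
          = ?s * of_real (q b) * (cnj (o' a b i j) * o' a b i' j')"
        unfolding c_def by (simp only: split complex_cnj_mult complex_cnj_complex_of_real) (simp only: mult_ac mult_1_left mult_1_right)
    qed
    also have "\<dots> = (\<Sum>k<R. \<Sum>l<R. (\<Sum>a\<in>A. ?s * (y i' a l * cnj (y i a k)))
        * (\<Sum>b\<in>B. of_real (q b) * (z j b k * cnj (z j' b l))))"
      unfolding o'_def by (rule sum_overlap_product)
    also have "\<dots> = (\<Sum>k<R. \<Sum>l<R. if k = l then ?s * (if i = i' then 1 else 0) * (\<Sum>b\<in>B. of_real (q b) * (z j b k * cnj (z j' b l))) else 0)"
    proof (intro sum.cong refl)
      fix k l assume "k \<in> {..<R}" "l \<in> {..<R}"
      then have "(\<Sum>a\<in>A. ?s * (y i' a l * cnj (y i a k))) = ?s * (if i' = i \<and> l = k then 1 else 0)"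
        using l by (simp only: sum_distrib_left[symmetric] yframe lessThan_iff)
      then show "(\<Sum>a\<in>A. ?s * (y i' a l * cnj (y i a k))) * (\<Sum>b\<in>B. of_real (q b) * (z j b k * cnj (z j' b l)))
          = (if k = l then ?s * (if i = i' then 1 else 0) * (\<Sum>b\<in>B. of_real (q b) * (z j b k * cnj (z j' b l))) else 0)"
        by (simp only:) auto
    qed
    also have "\<dots> = ?s * (if i = i' then 1 else 0) * (\<Sum>k<R. \<Sum>b\<in>B. of_real (q b) * (z j b k * cnj (z j' b k)))"
      by (simp add: sum_distrib_left)
    also have "\<dots> = (if ij = ij' then of_real ((\<lambda>(i, j). q' j / p' i) ij) else 0)"
      using l pos(3)[of i] ij by (auto simp: zred simp flip: of_real_mult)
    finally show "(\<Sum>ab\<in>A \<times> B. cnj (c ab ij) * of_real ((\<lambda>(a, b). q b / p a) ab) * c ab ij')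
        = (if ij = ij' then of_real ((\<lambda>(i, j). q' j / p' i) ij) else 0)" .
  qed
  have "(\<Sum>ij\<in>{..<N} \<times> {..<N}. f ((\<lambda>(i, j). q' j / p' i) ij) * (cmod ((\<lambda>(i, j). x i j) ij))\<^sup>2)
     \<le> (\<Sum>ab\<in>A \<times> B. f ((\<lambda>(a, b). q b / p a) ab) *
          (cmod (\<Sum>ij\<in>{..<N} \<times> {..<N}. c ab ij * (\<lambda>(i, j). x i j) ij))\<^sup>2)"
    by (rule operator_jensen[OF conv _ _ iso diag]) (use fin pos in auto)
  then show ?thesis
    unfolding c_def o'_def by (simp add: sum.cartesian_product split_def)
qed

lemma conj_diag_rotate:
  assumes U: "unitary n U" and i: "i < n" "i' < n"
  shows "(\<Sum>t<n. \<Sum>t'<n. cnj (U $$ (t, i)) * U $$ (t', i') * conj_diag n U p $$ (t, t'))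
    = (if i = i' then of_real (p i) else 0)"
proof -
  note cU = unitary_carrier[OF U]
  have "(\<Sum>t<n. \<Sum>t'<n. cnj (U $$ (t, i)) * U $$ (t', i') * conj_diag n U p $$ (t, t'))
      = (\<Sum>t<n. \<Sum>t'<n. \<Sum>a<n. of_real (p a) * (cnj (U $$ (t, i)) * U $$ (t, a)) * (cnj (U $$ (t', a)) * U $$ (t', i')))"
    by (intro sum.cong refl) (simp add: conj_diag_index[OF cU] sum_distrib_left mult_ac)
  also have "\<dots> = (\<Sum>t<n. \<Sum>a<n. \<Sum>t'<n. of_real (p a) * (cnj (U $$ (t, i)) * U $$ (t, a)) * (cnj (U $$ (t', a)) * U $$ (t', i')))"
    by (intro sum.cong refl sum.swap)
  also have "\<dots> = (\<Sum>a<n. \<Sum>t<n. \<Sum>t'<n. of_real (p a) * (cnj (U $$ (t, i)) * U $$ (t, a)) * (cnj (U $$ (t', a)) * U $$ (t', i')))"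
    by (rule sum.swap)
  also have "\<dots> = (\<Sum>a<n. of_real (p a) * (\<Sum>t<n. cnj (U $$ (t, i)) * U $$ (t, a)) * (\<Sum>t'<n. cnj (U $$ (t', a)) * U $$ (t', i')))"
    unfolding mult.assoc unfolding sum_product unfolding sum_distrib_left by (simp only: mult.assoc)
  also have "\<dots> = (\<Sum>a<n. (if a = i then of_real (p a) * (if a = i' then 1 else 0) else 0))"
    using i by (intro sum.cong refl) (auto simp: unitary_cols[OF U])
  also have "\<dots> = (if i = i' then of_real (p i) else 0)" using i by simp
  finally show ?thesis .
qed

lemma sum_rotate:
  fixes u :: "nat \<Rightarrow> 'a \<Rightarrow> nat \<Rightarrow> complex" and V :: "nat \<Rightarrow> nat \<Rightarrow> complex"
  shows "(\<Sum>a\<in>A. g a * ((\<Sum>t<n. cnj (V t i) * u t a k) * cnj (\<Sum>t<n. cnj (V t i') * u t a k')))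
    = (\<Sum>t<n. \<Sum>t'<n. cnj (V t i) * V t' i' * (\<Sum>a\<in>A. g a * (u t a k * cnj (u t' a k'))))"
proof -
  have "(\<Sum>a\<in>A. g a * ((\<Sum>t<n. cnj (V t i) * u t a k) * cnj (\<Sum>t<n. cnj (V t i') * u t a k')))
      = (\<Sum>a\<in>A. \<Sum>t<n. \<Sum>t'<n. cnj (V t i) * V t' i' * (g a * (u t a k * cnj (u t' a k'))))"
    unfolding cnj_sum sum_product unfolding sum_distrib_left
    by (intro sum.cong refl) (simp add: mult_ac)
  also have "\<dots> = (\<Sum>t<n. \<Sum>a\<in>A. \<Sum>t'<n. cnj (V t i) * V t' i' * (g a * (u t a k * cnj (u t' a k'))))"
    by (rule sum.swap)
  also have "\<dots> = (\<Sum>t<n. \<Sum>t'<n. \<Sum>a\<in>A. cnj (V t i) * V t' i' * (g a * (u t a k * cnj (u t' a k'))))"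
    by (intro sum.cong refl sum.swap)
  finally show ?thesis by (simp only: sum_distrib_left)
qed

text \<open>A unitary on the retained factor preserves the Parseval property, so a frame can be
  expressed in the eigenbasis of its reduced state.\<close>

lemma rotated_frame:
  fixes u :: "nat \<Rightarrow> 'a \<Rightarrow> nat \<Rightarrow> complex"
  assumes U: "unitary n U" and i: "i < n" "i' < n"
    and frame: "\<And>t t'. t < n \<Longrightarrow> t' < n \<Longrightarrow>
      (\<Sum>a\<in>A. u t a k * cnj (u t' a k')) = (if t = t' \<and> k = k' then 1 else 0)"
  shows "(\<Sum>a\<in>A. (\<Sum>t<n. cnj (U $$ (t, i)) * u t a k) * cnj (\<Sum>t<n. cnj (U $$ (t, i')) * u t a k'))
    = (if i = i' \<and> k = k' then 1 else 0)"
proof -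
  have "(\<Sum>a\<in>A. 1 * ((\<Sum>t<n. cnj (U $$ (t, i)) * u t a k) * cnj (\<Sum>t<n. cnj (U $$ (t, i')) * u t a k')))
      = (\<Sum>t<n. \<Sum>t'<n. cnj (U $$ (t, i)) * U $$ (t', i') * (\<Sum>a\<in>A. 1 * (u t a k * cnj (u t' a k'))))"
    by (rule sum_rotate[where V = "\<lambda>t i. U $$ (t, i)"])
  also have "\<dots> = (\<Sum>t<n. \<Sum>t'<n. if t' = t then cnj (U $$ (t, i)) * U $$ (t', i') * (if k = k' then 1 else 0) else 0)"
    by (intro sum.cong refl) (auto simp: frame)
  also have "\<dots> = (\<Sum>t<n. cnj (U $$ (t, i)) * U $$ (t, i')) * (if k = k' then 1 else 0)"
    by (simp add: sum_distrib_right)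
  finally show ?thesis using i by (simp add: unitary_cols[OF U])
qed

text \<open>The partial trace commutes with a rotation of the retained factor, and in its eigenbasis
  the reduced state is diagonal.\<close>

lemma rotated_reduced:
  assumes U: "unitary n U" and i: "i < n" "i' < n"
    and red: "\<And>t t'. t < n \<Longrightarrow> t' < n \<Longrightarrow>
      (\<Sum>k<R. \<Sum>a\<in>A. of_real (p a) * (u t a k * cnj (u t' a k))) = conj_diag n U p' $$ (t, t')"
  shows "(\<Sum>k<R. \<Sum>a\<in>A. of_real (p a) * ((\<Sum>t<n. cnj (U $$ (t, i)) * u t a k) * cnj (\<Sum>t<n. cnj (U $$ (t, i')) * u t a k)))
    = (if i = i' then of_real (p' i) else 0)"
proof -
  have "(\<Sum>k<R. \<Sum>a\<in>A. of_real (p a) * ((\<Sum>t<n. cnj (U $$ (t, i)) * u t a k) * cnj (\<Sum>t<n. cnj (U $$ (t, i')) * u t a k)))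
      = (\<Sum>k<R. \<Sum>t<n. \<Sum>t'<n. cnj (U $$ (t, i)) * U $$ (t', i') * (\<Sum>a\<in>A. of_real (p a) * (u t a k * cnj (u t' a k))))"
    by (intro sum.cong refl sum_rotate[where V = "\<lambda>t i. U $$ (t, i)"])
  also have "\<dots> = (\<Sum>t<n. \<Sum>k<R. \<Sum>t'<n. cnj (U $$ (t, i)) * U $$ (t', i') * (\<Sum>a\<in>A. of_real (p a) * (u t a k * cnj (u t' a k))))"
    by (rule sum.swap)
  also have "\<dots> = (\<Sum>t<n. \<Sum>t'<n. \<Sum>k<R. cnj (U $$ (t, i)) * U $$ (t', i') * (\<Sum>a\<in>A. of_real (p a) * (u t a k * cnj (u t' a k))))"
    by (intro sum.cong refl sum.swap)
  also have "\<dots> = (\<Sum>t<n. \<Sum>t'<n. cnj (U $$ (t, i)) * U $$ (t', i') * conj_diag n U p' $$ (t, t'))"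
    by (intro sum.cong refl) (simp add: red flip: sum_distrib_left)
  also have "\<dots> = (if i = i' then of_real (p' i) else 0)" by (rule conj_diag_rotate[OF U i])
  finally show ?thesis .
qed

lemma unrotate:
  assumes U: "unitary n U" and t: "t < n"
  shows "(\<Sum>i<n. U $$ (t, i) * (\<Sum>s<n. cnj (U $$ (s, i)) * v s)) = v t"
proof -
  have "(\<Sum>i<n. U $$ (t, i) * (\<Sum>s<n. cnj (U $$ (s, i)) * v s)) = (\<Sum>s<n. (\<Sum>i<n. U $$ (t, i) * cnj (U $$ (s, i))) * v s)"
    unfolding sum_distrib_left sum_distrib_right by (subst sum.swap) (simp add: mult_ac)
  also have "\<dots> = (\<Sum>s<n. (if t = s then 1 else 0) * v s)"
    by (intro sum.cong refl) (simp add: unitary_rows[OF U t])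
  also have "\<dots> = v t" by (rule sum_delta_mult) (use t in auto)
  finally show ?thesis .
qed

text \<open>Monotonicity of \<open>S\<^sub>f\<close> under the partial trace over \<open>\<complex>\<^sup>R\<close>. The states on \<open>\<complex>\<^sup>N \<otimes> \<complex>\<^sup>R\<close> are
  \<open>\<Sum>\<^sub>a p\<^sub>a |u\<^sub>a\<rangle>\<langle>u\<^sub>a|\<close> and \<open>\<Sum>\<^sub>b q\<^sub>b |w\<^sub>b\<rangle>\<langle>w\<^sub>b|\<close> for Parseval frames \<open>u, w\<close>, which need not be
  orthonormal bases. The Jensen inequality is applied to the isometry
  \<open>X \<mapsto> (X \<rho>\<^sup>-\<^sup>1\<^sup>/\<^sup>2 \<otimes> 1) \<rho>'\<^sup>1\<^sup>/\<^sup>2\<close> with \<open>\<rho>\<close> the partial trace of \<open>\<rho>'\<close>.\<close>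

theorem frame_data_processing:
  fixes f :: "real \<Rightarrow> real" and u :: "nat \<Rightarrow> 'a \<Rightarrow> nat \<Rightarrow> complex" and w :: "nat \<Rightarrow> 'b \<Rightarrow> nat \<Rightarrow> complex"
  assumes conv: "operator_convex_on {0<..} f" and fin: "finite A" "finite B"
    and U: "unitary n U" and W: "unitary n W"
    and pos: "\<And>a. a \<in> A \<Longrightarrow> 0 < p a" "\<And>b. b \<in> B \<Longrightarrow> 0 < q b" "\<And>i. i < n \<Longrightarrow> 0 < p' i"
    and uframe: "\<And>t t' k k'. t < n \<Longrightarrow> t' < n \<Longrightarrow> k < R \<Longrightarrow> k' < R \<Longrightarrow>
      (\<Sum>a\<in>A. u t a k * cnj (u t' a k')) = (if t = t' \<and> k = k' then 1 else 0)"
    and wframe: "\<And>t t' k k'. t < n \<Longrightarrow> t' < n \<Longrightarrow> k < R \<Longrightarrow> k' < R \<Longrightarrow>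
      (\<Sum>b\<in>B. w t b k * cnj (w t' b k')) = (if t = t' \<and> k = k' then 1 else 0)"
    and ured: "\<And>t t'. t < n \<Longrightarrow> t' < n \<Longrightarrow>
      (\<Sum>k<R. \<Sum>a\<in>A. of_real (p a) * (u t a k * cnj (u t' a k))) = conj_diag n U p' $$ (t, t')"
    and wred: "\<And>t t'. t < n \<Longrightarrow> t' < n \<Longrightarrow>
      (\<Sum>k<R. \<Sum>b\<in>B. of_real (q b) * (w t b k * cnj (w t' b k))) = conj_diag n W q' $$ (t, t')"
  shows "f_rel_entropy f (conj_diag n U p') (conj_diag n W q')
    \<le> (\<Sum>a\<in>A. \<Sum>b\<in>B. p a * f (q b / p a) * (cmod (\<Sum>k<R. \<Sum>t<n. cnj (w t b k) * u t a k))\<^sup>2)"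
proof -
  define y where "y = (\<lambda>i a k. \<Sum>t<n. cnj (U $$ (t, i)) * u t a k)"
  define z where "z = (\<lambda>j b k. \<Sum>t<n. cnj (W $$ (t, j)) * w t b k)"
  define v where "v = (\<lambda>i j. \<Sum>k<n. cnj (W $$ (k, j)) * U $$ (k, i))"
  \<comment> \<open>The coordinates of the vectorised square root of the reduced state, so that the
    left side of the Jensen inequality is the spectral formula for its entropy.\<close>
  define x where "x = (\<lambda>i j. complex_of_real (sqrt (p' i)) * v i j)"
  have main: "(\<Sum>i<n. \<Sum>j<n. f (q' j / p' i) * (cmod (x i j))\<^sup>2)
    \<le> (\<Sum>a\<in>A. \<Sum>b\<in>B. f (q b / p a) *
         (cmod (\<Sum>i<n. \<Sum>j<n. of_real (sqrt (p a / p' i)) * (\<Sum>k<R. cnj (z j b k) * y i a k) * x i j))\<^sup>2)"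
  proof (rule reduced_frame_jensen[OF conv fin])
    fix i i' k k' assume i: "i < n" "i' < n" and k: "k < R" "k' < R"
    show "(\<Sum>a\<in>A. y i a k * cnj (y i' a k')) = (if i = i' \<and> k = k' then 1 else 0)"
      unfolding y_def by (rule rotated_frame[OF U i]) (use uframe k in auto)
    show "(\<Sum>b\<in>B. z i b k * cnj (z i' b k')) = (if i = i' \<and> k = k' then 1 else 0)"
      unfolding z_def by (rule rotated_frame[OF W i]) (use wframe k in auto)
  next
    fix i i' assume i: "i < n" "i' < n"
    show "(\<Sum>k<R. \<Sum>a\<in>A. of_real (p a) * (y i a k * cnj (y i' a k))) = (if i = i' then of_real (p' i) else 0)"
      unfolding y_def by (rule rotated_reduced[OF U i ured])
    show "(\<Sum>k<R. \<Sum>b\<in>B. of_real (q b) * (z i b k * cnj (z i' b k))) = (if i = i' then of_real (q' i) else 0)"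
      unfolding z_def by (rule rotated_reduced[OF W i wred])
  qed (use pos in auto)
  have lhs: "f (q' j / p' i) * (cmod (x i j))\<^sup>2 = p' i * f (q' j / p' i) * (cmod (v i j))\<^sup>2" if "i < n" for i j
    using pos(3)[OF that] by (simp add: x_def norm_mult power_mult_distrib)
  \<comment> \<open>The isometry sends this vector to the vectorised square root of the large state:
    the factors \<open>sqrt (p' i)\<close> cancel, and summing over \<open>i\<close> and
    \<open>j\<close> undoes the rotations by \<open>U\<close> and \<open>W\<close>.\<close>
  have sum: "(\<Sum>i<n. \<Sum>j<n. of_real (sqrt (p a / p' i)) * (\<Sum>k<R. cnj (z j b k) * y i a k) * x i j)
      = of_real (sqrt (p a)) * (\<Sum>k<R. \<Sum>t<n. cnj (w t b k) * u t a k)" for a b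
  proof -
    have "(\<Sum>i<n. \<Sum>j<n. of_real (sqrt (p a / p' i)) * (\<Sum>k<R. cnj (z j b k) * y i a k) * x i j)
        = (\<Sum>i<n. \<Sum>j<n. \<Sum>k<R. \<Sum>t<n. of_real (sqrt (p a)) *
            ((U $$ (t, i) * y i a k) * cnj (W $$ (t, j) * z j b k)))"
    proof (intro sum.cong refl)
      fix i j assume "i \<in> {..<n}"
      then have "sqrt (p a / p' i) * sqrt (p' i) = sqrt (p a)"
        using pos(3)[of i] by (simp add: real_sqrt_divide)
      then have *: "of_real (sqrt (p a / p' i)) * complex_of_real (sqrt (p' i)) = of_real (sqrt (p a))"
        by (simp only: of_real_mult[symmetric])
      have "of_real (sqrt (p a / p' i)) * (\<Sum>k<R. cnj (z j b k) * y i a k) * x i j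
          = of_real (sqrt (p a)) * ((\<Sum>k<R. cnj (z j b k) * y i a k) * v i j)"
        unfolding x_def *[symmetric] by (simp only: mult_ac)
      also have "\<dots> = (\<Sum>k<R. \<Sum>t<n. of_real (sqrt (p a)) *
            ((U $$ (t, i) * y i a k) * cnj (W $$ (t, j) * z j b k)))"
        unfolding v_def sum_product unfolding sum_distrib_left
        by (intro sum.cong refl) (simp add: mult_ac)
      finally show "of_real (sqrt (p a / p' i)) * (\<Sum>k<R. cnj (z j b k) * y i a k) * x i j
          = (\<Sum>k<R. \<Sum>t<n. of_real (sqrt (p a)) * ((U $$ (t, i) * y i a k) * cnj (W $$ (t, j) * z j b k)))" .
    qed
    also have "\<dots> = (\<Sum>k<R. \<Sum>t<n. \<Sum>i<n. \<Sum>j<n. of_real (sqrt (p a)) *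
            ((U $$ (t, i) * y i a k) * cnj (W $$ (t, j) * z j b k)))"
      by (rule sum_swap_pairs)
    also have "\<dots> = (\<Sum>k<R. \<Sum>t<n. of_real (sqrt (p a)) *
            ((\<Sum>i<n. U $$ (t, i) * y i a k) * cnj (\<Sum>j<n. W $$ (t, j) * z j b k)))"
      unfolding cnj_sum sum_product unfolding sum_distrib_left ..
    also have "\<dots> = (\<Sum>k<R. \<Sum>t<n. of_real (sqrt (p a)) * (u t a k * cnj (w t b k)))"
      unfolding y_def z_def by (intro sum.cong refl) (simp only: unrotate[OF U] unrotate[OF W] lessThan_iff)
    finally show ?thesis by (simp only: sum_distrib_left mult_ac)
  qed
  have rhs: "f (q b / p a) * (cmod (of_real (sqrt (p a)) * s))\<^sup>2 = p a * f (q b / p a) * (cmod s)\<^sup>2"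
    if "a \<in> A" for a b s
    using pos(1)[OF that] by (simp add: norm_mult power_mult_distrib)
  have "f_rel_entropy f (conj_diag n U p') (conj_diag n W q')
      = (\<Sum>i<n. \<Sum>j<n. p' i * f (q' j / p' i) * (cmod (v i j))\<^sup>2)"
    unfolding v_def by (rule f_rel_entropy_spectral[OF U W pos(3)])
  also have "\<dots> = (\<Sum>i<n. \<Sum>j<n. f (q' j / p' i) * (cmod (x i j))\<^sup>2)"
    by (intro sum.cong refl) (simp only: lhs lessThan_iff)
  also note main
  also have "(\<Sum>a\<in>A. \<Sum>b\<in>B. f (q b / p a) *
         (cmod (\<Sum>i<n. \<Sum>j<n. of_real (sqrt (p a / p' i)) * (\<Sum>k<R. cnj (z j b k) * y i a k) * x i j))\<^sup>2)
      = (\<Sum>a\<in>A. \<Sum>b\<in>B. p a * f (q b / p a) * (cmod (\<Sum>k<R. \<Sum>t<n. cnj (w t b k) * u t a k))\<^sup>2)"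
    unfolding sum by (intro sum.cong refl rhs)
  finally show ?thesis .
qed

section \<open>Kraus representation\<close>

definition elem_mat :: "nat \<Rightarrow> nat \<Rightarrow> nat \<Rightarrow> complex mat" where
  "elem_mat n a b = mat n n (\<lambda>(i, j). if i = a \<and> j = b then 1 else 0)"

text \<open>\<open>cptp\<close> provides additivity for two summands and homogeneity, both only on
  the carrier. The expansion in matrix units is therefore built up one position at a time.\<close>

lemma cptp_elem_expansion:
  assumes E: "cptp n E" and X: "X \<in> carrier_mat n n" and ij: "i < n" "j < n"
  shows "E X $$ (i, j) = (\<Sum>a<n. \<Sum>b<n. X $$ (a, b) * E (elem_mat n a b) $$ (i, j))"
proof -
  have car: "E A \<in> carrier_mat n n" if "A \<in> carrier_mat n n" for A
    using E that by (simp add: cptp_def)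
  \<comment> \<open>The restriction of \<open>X\<close> to the positions in \<open>S\<close>, zero
    elsewhere; the induction is on \<open>S\<close>.\<close>
  define part where "part S = mat n n (\<lambda>(a, b). if (a, b) \<in> S then X $$ (a, b) else 0)" for S
  have part: "part S \<in> carrier_mat n n" for S by (simp add: part_def)
  have el: "elem_mat n a b \<in> carrier_mat n n" for a b by (simp add: elem_mat_def)
  have "E (part S) $$ (i, j) = (\<Sum>(a, b)\<in>S. X $$ (a, b) * E (elem_mat n a b) $$ (i, j))"
    if "S \<subseteq> {..<n} \<times> {..<n}" for S
  proof -
    have "finite S" using finite_subset[OF that] by simp
    then show ?thesis using that
    proof (induction S rule: finite_induct)
      case empty
      \<comment> \<open>Homogeneity with scalar 0 gives that the zero matrix is mapped to
        zero.\<close>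
      have "part {} = 0 \<cdot>\<^sub>m part {}" by (rule eq_matI) (auto simp: part_def)
      then have "E (part {}) = E (0 \<cdot>\<^sub>m part {})" by (rule arg_cong)
      also have "\<dots> = 0 \<cdot>\<^sub>m E (part {})" using E part unfolding cptp_def by blast
      finally have "E (part {}) $$ (i, j) = (0 \<cdot>\<^sub>m E (part {})) $$ (i, j)" by (rule arg_cong)
      also have "\<dots> = 0" using car[OF part, of "{}"] ij by auto
      finally show ?case by simp
    next
      case (insert ab S)
      obtain a b where ab: "ab = (a, b)" by (cases ab)
      have "part (insert ab S) = part S + X $$ (a, b) \<cdot>\<^sub>m elem_mat n a b"
        using insert by (intro eq_matI) (auto simp: part_def elem_mat_def ab)
      then have "E (part (insert ab S)) = E (part S + X $$ (a, b) \<cdot>\<^sub>m elem_mat n a b)" by simp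
      also have "\<dots> = E (part S) + E (X $$ (a, b) \<cdot>\<^sub>m elem_mat n a b)"
        using E part smult_carrier_mat[OF el] unfolding cptp_def by blast
      also have "E (X $$ (a, b) \<cdot>\<^sub>m elem_mat n a b) = X $$ (a, b) \<cdot>\<^sub>m E (elem_mat n a b)"
        using E el unfolding cptp_def by blast
      finally have "E (part (insert ab S)) $$ (i, j) = E (part S) $$ (i, j) + X $$ (a, b) * E (elem_mat n a b) $$ (i, j)"
        using car[OF el, of a b] car[OF part, of S] ij by auto
      with insert ab show ?case by simp
    qed
  qed
  from this[of "{..<n} \<times> {..<n}"]
  have "E (part ({..<n} \<times> {..<n})) $$ (i, j) = (\<Sum>a<n. \<Sum>b<n. X $$ (a, b) * E (elem_mat n a b) $$ (i, j))"
    by (simp add: sum.cartesian_product)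
  moreover have "part ({..<n} \<times> {..<n}) = X"
    using X by (intro eq_matI) (auto simp: part_def)
  ultimately show ?thesis by simp
qed

lemma pos_semidef_eigenvalue_nonneg:
  assumes U: "unitary n U" and psd: "pos_semidef n (conj_diag n U l)" and a: "a < n"
  shows "0 \<le> l a"
proof -
  note cU = unitary_carrier[OF U]
  have c: "col U a \<in> carrier_vec n" using cU by auto
  have "(\<Sum>i<n. cnj (U $$ (i, b)) * col U a $ i) = (if b = a then 1 else 0)" if "b < n" for b
    unfolding unitary_cols[OF U that a, symmetric] using cU a by (intro sum.cong) auto
  then have "(\<Sum>b<n. l b * (cmod (\<Sum>i<n. cnj (U $$ (i, b)) * col U a $ i))\<^sup>2) = (\<Sum>b<n. if b = a then l b else 0)"
    by (intro sum.cong refl) auto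
  then have "Re ((conj_diag n U l *\<^sub>v col U a) \<bullet>c col U a) = l a"
    using a unfolding conj_diag_quadratic[OF cU c] by simp
  moreover have "0 \<le> Re ((conj_diag n U l *\<^sub>v col U a) \<bullet>c col U a)"
    using psd c unfolding pos_semidef_def by blast
  ultimately show ?thesis by simp
qed

text \<open>The quadratic form is the squared modulus of a single inner product. It will be applied
  to a maximally entangled vector.\<close>

lemma pos_semidef_rank_one:
  fixes e :: "nat \<Rightarrow> complex"
  shows "pos_semidef n (mat n n (\<lambda>(i, j). e i * cnj (e j)))"
proof -
  let ?M = "mat n n (\<lambda>(i, j). e i * cnj (e j))"
  have M: "?M \<in> carrier_mat n n" by simp
  have "0 \<le> Re ((?M *\<^sub>v v) \<bullet>c v)" if v: "v \<in> carrier_vec n" for v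
  proof -
    let ?s = "\<Sum>i<n. e i * cnj (v $ i)"
    have "(?M *\<^sub>v v) \<bullet>c v = ?s * cnj ?s"
      unfolding quadratic_form_sum[OF M v] cnj_sum sum_product
      by (intro sum.cong refl) (auto simp: mult_ac)
    also have "\<dots> = of_real ((cmod ?s)\<^sup>2)" by (rule complex_norm_square[symmetric])
    finally show ?thesis by simp
  qed
  then show ?thesis by (simp add: pos_semidef_def hermitianI)
qed

text \<open>The Kraus operators are the reshaped eigenvectors of the Choi matrix, scaled by the square
  roots of its eigenvalues.\<close>

lemma cptp_kraus:
  assumes E: "cptp n E"
  shows "\<exists>(r :: nat) K.
    (\<forall>X\<in>carrier_mat n n. \<forall>i<n. \<forall>j<n.
      E X $$ (i, j) = (\<Sum>k<r. \<Sum>a<n. \<Sum>b<n. K k i a * X $$ (a, b) * cnj (K k j b))) \<and>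
    (\<forall>a<n. \<forall>b<n. (\<Sum>k<r. \<Sum>i<n. cnj (K k i a) * K k i b) = (if a = b then 1 else 0))"
proof -
  \<comment> \<open>The unnormalised maximally entangled vector; the blocks of its rank one matrix
    \<open>M\<close> are the matrix units, so \<open>C\<close> is the Choi matrix of
    \<open>E\<close>.\<close>
  define e where "e r = (if r div n = r mod n then 1 else 0 :: complex)" for r
  define M where "M = mat (n * n) (n * n) (\<lambda>(r, c). e r * cnj (e c))"
  have block: "block_B n n M a b = elem_mat n a b" if "a < n" "b < n" for a b
    using that by (intro eq_matI) (auto simp: block_B_def M_def elem_mat_def e_def mult_add_less_mult)
  define C where "C = tensor_id n n E M"
  have "pos_semidef (n * n) M" unfolding M_def by (rule pos_semidef_rank_one)
  then have psd: "pos_semidef (n * n) C" using E unfolding C_def cptp_def by blast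
  then obtain Q l where Q: "unitary (n * n) Q" and C: "C = conj_diag (n * n) Q l"
    using hermitian_spectral unfolding pos_semidef_def by blast
  note cQ = unitary_carrier[OF Q]
  have l: "0 \<le> l k" if "k < n * n" for k
    using pos_semidef_eigenvalue_nonneg[OF Q _ that] psd C by simp
  define K where "K k i a = of_real (sqrt (l k)) * Q $$ (i * n + a, k)" for k i a
  have EK: "E (elem_mat n a b) $$ (i, j) = (\<Sum>k<n * n. K k i a * cnj (K k j b))"
    if "a < n" "b < n" "i < n" "j < n" for a b i j
  proof -
    have lt: "i * n + a < n * n" "j * n + b < n * n" using that by (auto intro: mult_add_less_mult)
    have "E (elem_mat n a b) $$ (i, j) = C $$ (i * n + a, j * n + b)"
      using that lt by (simp add: C_def tensor_id_def block)
    also have "\<dots> = (\<Sum>k<n * n. K k i a * cnj (K k j b))"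
      unfolding C conj_diag_index[OF cQ lt]
    proof (intro sum.cong refl)
      fix k assume "k \<in> {..<n * n}"
      then have "complex_of_real (l k) = of_real (sqrt (l k)) * of_real (sqrt (l k))"
        using l[of k] by (simp only: of_real_mult[symmetric]) simp
      then show "Q $$ (i * n + a, k) * of_real (l k) * cnj (Q $$ (j * n + b, k)) = K k i a * cnj (K k j b)"
        unfolding K_def by (simp only: complex_cnj_mult complex_cnj_complex_of_real mult_ac)
    qed
    finally show ?thesis .
  qed
  have "E X $$ (i, j) = (\<Sum>k<n * n. \<Sum>a<n. \<Sum>b<n. K k i a * X $$ (a, b) * cnj (K k j b))"
    if X: "X \<in> carrier_mat n n" and ij: "i < n" "j < n" for X i j
  proof -
    have "E X $$ (i, j) = (\<Sum>a<n. \<Sum>b<n. \<Sum>k<n * n. K k i a * X $$ (a, b) * cnj (K k j b))"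
      unfolding cptp_elem_expansion[OF E X ij]
      by (intro sum.cong refl) (simp add: EK ij sum_distrib_left mult_ac)
    also have "\<dots> = (\<Sum>a<n. \<Sum>k<n * n. \<Sum>b<n. K k i a * X $$ (a, b) * cnj (K k j b))"
      by (intro sum.cong refl sum.swap)
    also have "\<dots> = (\<Sum>k<n * n. \<Sum>a<n. \<Sum>b<n. K k i a * X $$ (a, b) * cnj (K k j b))"
      by (rule sum.swap)
    finally show ?thesis .
  qed
  moreover have "(\<Sum>k<n * n. \<Sum>i<n. cnj (K k i a) * K k i b) = (if a = b then 1 else 0)"
    if ab: "a < n" "b < n" for a b
  proof -
    have el: "elem_mat n b a \<in> carrier_mat n n" by (simp add: elem_mat_def)
    then have car: "dim_row (E (elem_mat n b a)) = n" using E unfolding cptp_def by blast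
    have "(\<Sum>k<n * n. \<Sum>i<n. cnj (K k i a) * K k i b) = (\<Sum>i<n. \<Sum>k<n * n. K k i b * cnj (K k i a))"
      by (subst sum.swap) (simp add: mult.commute)
    \<comment> \<open>Completeness of the Kraus operators is trace preservation tested on matrix
      units, with the two indices exchanged.\<close>
    also have "\<dots> = mat_tr (E (elem_mat n b a))"
      unfolding mat_tr_def car by (intro sum.cong refl) (simp add: EK ab)
    also have "\<dots> = mat_tr (elem_mat n b a)" using E el unfolding cptp_def by blast
    also have "\<dots> = (\<Sum>i<n. if i = a then (if a = b then 1 else 0) else 0)"
      unfolding mat_tr_def by (intro sum.cong) (auto simp: elem_mat_def)
    also have "\<dots> = (if a = b then 1 else 0)" using ab by simp
    finally show ?thesis .
  qed
  ultimately show ?thesis by (intro exI[of _ "n * n"] exI[of _ K]) blast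
qed

section \<open>Perturbation of strictly positive matrices\<close>

lemma unitary_parseval:
  assumes U: "unitary n U" and v: "v \<in> carrier_vec n"
  shows "(\<Sum>a<n. (cmod (\<Sum>i<n. cnj (U $$ (i, a)) * v $ i))\<^sup>2) = (\<Sum>i<n. (cmod (v $ i))\<^sup>2)"
proof -
  have "complex_of_real (\<Sum>a<n. (cmod (\<Sum>i<n. cnj (U $$ (i, a)) * v $ i))\<^sup>2) = (1\<^sub>m n *\<^sub>v v) \<bullet>c v"
    unfolding conj_diag_one[OF U, symmetric] conj_diag_quadratic[OF unitary_carrier[OF U] v] by simp
  also have "\<dots> = of_real (\<Sum>i<n. (cmod (v $ i))\<^sup>2)"
    using v unfolding of_real_sum complex_norm_square by (simp add: scalar_prod_def lessThan_atLeast0)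
  finally show ?thesis by (simp only: of_real_eq_iff)
qed

text \<open>Evaluating the quadratic form on column \<open>a\<close> of \<open>U\<close> isolates
  the eigenvalue \<open>p a\<close>.\<close>

lemma strictly_positive_spectral:
  assumes "strictly_positive n A"
  shows "\<exists>U p. unitary n U \<and> A = conj_diag n U p \<and> (\<forall>i<n. 0 < p i)"
proof -
  obtain U p where U: "unitary n U" and A: "A = conj_diag n U p"
    using hermitian_spectral assms unfolding strictly_positive_def by blast
  note cU = unitary_carrier[OF U]
  have "0 < p a" if a: "a < n" for a
  proof -
    have c: "col U a \<in> carrier_vec n" using cU by auto
    have s: "(\<Sum>i<n. cnj (U $$ (i, b)) * col U a $ i) = (if b = a then 1 else 0)" if "b < n" for b
      unfolding unitary_cols[OF U that a, symmetric] using cU a by (intro sum.cong) auto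
    have "col U a \<noteq> 0\<^sub>v n"
    proof
      assume *: "col U a = 0\<^sub>v n"
      have "(\<Sum>i<n. cnj (U $$ (i, a)) * col U a $ i) = 0" unfolding * by simp
      with s[OF a] show False by simp
    qed
    then have "0 < Re ((A *\<^sub>v col U a) \<bullet>c col U a)"
      using assms c unfolding strictly_positive_def by blast
    also have "\<dots> = (\<Sum>b<n. p b * (cmod (\<Sum>i<n. cnj (U $$ (i, b)) * col U a $ i))\<^sup>2)"
      unfolding A conj_diag_quadratic[OF cU c] by simp
    also have "\<dots> = (\<Sum>b<n. if b = a then p b else 0)"
      using s by (intro sum.cong refl) auto
    finally show ?thesis using a by simp
  qed
  with U A show ?thesis by blast
qed

lemma hermitian_minus_smult:
  assumes "hermitian n A" "hermitian n T"
  shows "hermitian n (A - of_real c \<cdot>\<^sub>m T)"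
proof (rule hermitianI)
  fix i j assume ij: "i < n" "j < n"
  have "A \<in> carrier_mat n n" "T \<in> carrier_mat n n" using assms by (auto simp: hermitian_def)
  with ij show "(A - of_real c \<cdot>\<^sub>m T) $$ (i, j) = cnj ((A - of_real c \<cdot>\<^sub>m T) $$ (j, i))"
    using hermitian_index[OF assms(1) ij] hermitian_index[OF assms(2) ij] by simp
qed (use assms in \<open>auto simp: hermitian_def\<close>)

text \<open>If the eigenvalues of \<open>A\<close> are at least m > 0 and those of \<open>T\<close>
  at most M > 0, then c = m/(2M) leaves the lower bound m/2. All smaller positive \<open>c\<close>
  are included because one \<open>c\<close> has to serve two states.\<close>

lemma strictly_positive_perturb:
  assumes A: "strictly_positive n A" and T: "hermitian n T"
  shows "\<exists>c0>0. \<forall>c. 0 < c \<and> c \<le> c0 \<longrightarrow> strictly_positive n (A - of_real c \<cdot>\<^sub>m T)"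
proof -
  obtain U p where U: "unitary n U" and AU: "A = conj_diag n U p" and p: "\<And>i. i < n \<Longrightarrow> 0 < p i"
    using strictly_positive_spectral[OF A] by blast
  obtain V t where V: "unitary n V" and TV: "T = conj_diag n V t"
    using hermitian_spectral[OF T] by blast
  note cU = unitary_carrier[OF U] and cV = unitary_carrier[OF V]
  \<comment> \<open>Inserting 1 keeps the minimum meaningful in dimension 0.\<close>
  define m where "m = Min (insert 1 (p ` {..<n}))"
  have m: "0 < m" "\<And>i. i < n \<Longrightarrow> m \<le> p i" using p by (auto simp: m_def)
  \<comment> \<open>The summand 1 makes the bound positive even when all eigenvalues of
    \<open>T\<close> vanish.\<close>
  define M where "M = 1 + (\<Sum>i<n. \<bar>t i\<bar>)"
  have M0: "0 < M" unfolding M_def by (intro add_pos_nonneg sum_nonneg) auto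
  have M: "t i \<le> M" if "i < n" for i
  proof -
    have "\<bar>t i\<bar> \<le> (\<Sum>i<n. \<bar>t i\<bar>)" using that by (intro member_le_sum) auto
    then show ?thesis unfolding M_def by linarith
  qed
  have "strictly_positive n (A - of_real c \<cdot>\<^sub>m T)" if c: "0 < c" "c \<le> m / (2 * M)" for c
    unfolding strictly_positive_def
  proof (intro conjI ballI impI)
    show "hermitian n (A - of_real c \<cdot>\<^sub>m T)"
      using A T by (intro hermitian_minus_smult) (auto simp: strictly_positive_def)
  next
    fix v :: "complex vec" assume v: "v \<in> carrier_vec n" and v0: "v \<noteq> 0\<^sub>v n"
    define q where "q = (\<Sum>i<n. (cmod (v $ i))\<^sup>2)"
    have "\<exists>i<n. v $ i \<noteq> 0" using v v0 by (metis carrier_vecD eq_vecI index_zero_vec)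
    then have q: "0 < q" unfolding q_def
      by (auto intro!: sum_pos2[of _ i for i])
    have cA: "A \<in> carrier_mat n n" and cT: "T \<in> carrier_mat n n" using AU TV cU cV by auto
    have cD: "A - of_real c \<cdot>\<^sub>m T \<in> carrier_mat n n" using cT by (intro minus_carrier_mat) auto
    have "((A - of_real c \<cdot>\<^sub>m T) *\<^sub>v v) \<bullet>c v = (A *\<^sub>v v) \<bullet>c v - of_real c * ((T *\<^sub>v v) \<bullet>c v)"
      unfolding quadratic_form_sum[OF cD v] quadratic_form_sum[OF cA v] quadratic_form_sum[OF cT v]
        sum_distrib_left sum_subtractf[symmetric]
      using cA cT by (intro sum.cong refl) (simp add: algebra_simps)
    also have "Re \<dots> = (\<Sum>a<n. p a * (cmod (\<Sum>i<n. cnj (U $$ (i, a)) * v $ i))\<^sup>2)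
        - c * (\<Sum>a<n. t a * (cmod (\<Sum>i<n. cnj (V $$ (i, a)) * v $ i))\<^sup>2)"
      unfolding AU TV conj_diag_quadratic[OF cU v] conj_diag_quadratic[OF cV v] by simp
    also have "\<dots> \<ge> (\<Sum>a<n. m * (cmod (\<Sum>i<n. cnj (U $$ (i, a)) * v $ i))\<^sup>2)
        - c * (\<Sum>a<n. M * (cmod (\<Sum>i<n. cnj (V $$ (i, a)) * v $ i))\<^sup>2)"
      using c m M by (intro diff_mono mult_left_mono sum_mono mult_right_mono) auto
    also have "(\<Sum>a<n. m * (cmod (\<Sum>i<n. cnj (U $$ (i, a)) * v $ i))\<^sup>2)
        - c * (\<Sum>a<n. M * (cmod (\<Sum>i<n. cnj (V $$ (i, a)) * v $ i))\<^sup>2) = (m - c * M) * q"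
      unfolding sum_distrib_left[symmetric] unitary_parseval[OF U v] unitary_parseval[OF V v] q_def
      by (simp add: algebra_simps)
    finally have "(m - c * M) * q \<le> Re (((A - of_real c \<cdot>\<^sub>m T) *\<^sub>v v) \<bullet>c v)" .
    moreover have "c * M \<le> m / 2" using c M0 by (simp add: field_simps)
    then have "0 < (m - c * M) * q" using m q by (intro mult_pos_pos) auto
    ultimately show "0 < Re (((A - of_real c \<cdot>\<^sub>m T) *\<^sub>v v) \<bullet>c v)" by linarith
  qed
  moreover have "0 < m / (2 * M)" using m M0 by simp
  ultimately show ?thesis by blast
qed

section \<open>Regularised Stinespring dilation\<close>

text \<open>The assumption says that the sum of \<open>K^dag K\<close> over all Kraus operators is
  the identity: trace preservation of \<open>chan\<close>, or equally that stacking the operators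
  gives an isometry.\<close>

locale kraus_family =
  fixes n r :: nat and K :: "nat \<Rightarrow> nat \<Rightarrow> nat \<Rightarrow> complex"
  assumes complete: "\<And>a b. a < n \<Longrightarrow> b < n \<Longrightarrow>
    (\<Sum>k<r. \<Sum>i<n. cnj (K k i a) * K k i b) = (if a = b then 1 else 0)"
begin

definition chan :: "complex mat \<Rightarrow> complex mat" where
  "chan X = mat n n (\<lambda>(i, j). \<Sum>k<r. \<Sum>a<n. \<Sum>b<n. K k i a * X $$ (a, b) * cnj (K k j b))"

text \<open>\<open>stine\<close> is the isometry \<open>\<complex>\<^sup>n \<rightarrow> \<complex>\<^sup>n \<otimes> \<complex>\<^sup>r\<close> of the Stinespring representation and \<open>defect\<close>
  the projection onto the orthogonal complement of its range.\<close>

definition stine :: "nat \<times> nat \<Rightarrow> nat \<Rightarrow> complex" where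
  "stine x c = K (snd x) (fst x) c"

definition defect :: "nat \<times> nat \<Rightarrow> nat \<times> nat \<Rightarrow> complex" where
  "defect x y = (if x = y then 1 else 0) - (\<Sum>c<n. stine x c * cnj (stine y c))"

abbreviation "I \<equiv> {..<n} \<times> {..<r}"

lemma stine_isometry:
  assumes "a < n" "b < n"
  shows "(\<Sum>x\<in>I. cnj (stine x a) * stine x b) = (if a = b then 1 else 0)"
  unfolding sum_Times stine_def by (subst sum.swap) (simp add: complete[OF assms])

lemma defect_stine:
  assumes x: "x \<in> I" and c: "c < n"
  shows "(\<Sum>y\<in>I. defect x y * stine y c) = 0"
proof -
  have "(\<Sum>y\<in>I. defect x y * stine y c)
      = (\<Sum>y\<in>I. (if x = y then 1 else 0) * stine y c) - (\<Sum>y\<in>I. \<Sum>d<n. stine x d * (cnj (stine y d) * stine y c))"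
    unfolding defect_def by (simp only: left_diff_distrib sum_subtractf sum_distrib_right mult.assoc)
  also have "(\<Sum>y\<in>I. (if x = y then 1 else 0) * stine y c) = stine x c"
    by (rule sum_delta_mult) (use x in auto)
  also have "(\<Sum>y\<in>I. \<Sum>d<n. stine x d * (cnj (stine y d) * stine y c))
      = (\<Sum>d<n. stine x d * (\<Sum>y\<in>I. cnj (stine y d) * stine y c))"
    unfolding sum_distrib_left by (rule sum.swap)
  also have "\<dots> = (\<Sum>d<n. stine x d * (if d = c then 1 else 0))"
    using c by (intro sum.cong refl) (simp only: stine_isometry lessThan_iff)
  also have "\<dots> = stine x c" by (rule sum_delta_mult) (use c in auto)
  finally show ?thesis by simp
qed

lemma defect_hermitian: "cnj (defect x y) = defect y x"
  unfolding defect_def by (auto simp: mult.commute)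

text \<open>P P = P for the Hermitian projection P, written with a conjugate in the form of a frame
  condition: the columns of a projection are a Parseval frame of its range.\<close>

lemma defect_idempotent:
  assumes x: "x \<in> I" and z: "z \<in> I"
  shows "(\<Sum>y\<in>I. defect x y * cnj (defect z y)) = defect x z"
proof -
  have "(\<Sum>y\<in>I. defect x y * cnj (defect z y)) = (\<Sum>y\<in>I. defect x y * defect y z)"
    by (simp only: defect_hermitian)
  also have "\<dots> = (\<Sum>y\<in>I. defect x y * (if y = z then 1 else 0)) -
      (\<Sum>y\<in>I. \<Sum>c<n. defect x y * stine y c * cnj (stine z c))"
    unfolding defect_def[of _ z] by (simp only: right_diff_distrib sum_subtractf sum_distrib_left mult.assoc)
  also have "(\<Sum>y\<in>I. defect x y * (if y = z then 1 else 0)) = defect x z"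
    by (rule sum_delta_mult) (use z in auto)
  also have "(\<Sum>y\<in>I. \<Sum>c<n. defect x y * stine y c * cnj (stine z c))
      = (\<Sum>c<n. (\<Sum>y\<in>I. defect x y * stine y c) * cnj (stine z c))"
    unfolding sum_distrib_right by (rule sum.swap)
  also have "\<dots> = 0" using defect_stine[OF x] by simp
  finally show ?thesis by simp
qed

definition defect_trace :: "complex mat" where
  "defect_trace = mat n n (\<lambda>(s, t). \<Sum>k<r. defect (s, k) (t, k))"

lemma hermitian_defect_trace: "hermitian n defect_trace"
  by (rule hermitianI) (auto simp: defect_trace_def defect_hermitian)

text \<open>The Parseval frame of \<open>\<complex>\<^sup>n \<otimes> \<complex>\<^sup>r\<^sup>+\<^sup>1\<close> consisting of the image of the basis \<open>U\<close> under \<open>stine\<close>, the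
  columns of \<open>defect\<close> and the basis \<open>V\<close> in the last slot.\<close>

fun frame :: "complex mat \<Rightarrow> complex mat \<Rightarrow> nat \<Rightarrow> nat + (nat \<times> nat) + nat \<Rightarrow> nat \<Rightarrow> complex" where
  "frame U V t (Inl a) k = (if k < r then \<Sum>c<n. stine (t, k) c * U $$ (c, a) else 0)"
| "frame U V t (Inr (Inl y)) k = (if k < r then defect (t, k) y else 0)"
| "frame U V t (Inr (Inr a)) k = (if k = r then V $$ (t, a) else 0)"

abbreviation "J \<equiv> {..<n} <+> (I <+> {..<n})"

lemma sum_J: "(\<Sum>x\<in>J. g x) = (\<Sum>a<n. g (Inl a)) + ((\<Sum>y\<in>I. g (Inr (Inl y))) + (\<Sum>a<n. g (Inr (Inr a))))"
  by (simp add: sum.Plus)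

text \<open>The dilated state, computed from the images of the eigenvectors. With all weights 1 it
  becomes the range projection of the isometry.\<close>

lemma stine_conj_diag:
  assumes U: "U \<in> carrier_mat n n"
  shows "(\<Sum>a<n. of_real (p a) * ((\<Sum>c<n. stine x c * U $$ (c, a)) * cnj (\<Sum>c<n. stine y c * U $$ (c, a))))
    = (\<Sum>c<n. \<Sum>d<n. stine x c * conj_diag n U p $$ (c, d) * cnj (stine y d))"
proof -
  have "(\<Sum>a<n. of_real (p a) * ((\<Sum>c<n. stine x c * U $$ (c, a)) * cnj (\<Sum>c<n. stine y c * U $$ (c, a))))
      = (\<Sum>a<n. \<Sum>c<n. \<Sum>d<n. stine x c * (U $$ (c, a) * of_real (p a) * cnj (U $$ (d, a))) * cnj (stine y d))"
    unfolding cnj_sum sum_product unfolding sum_distrib_left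
    by (intro sum.cong refl) (simp add: mult_ac)
  also have "\<dots> = (\<Sum>c<n. \<Sum>a<n. \<Sum>d<n. stine x c * (U $$ (c, a) * of_real (p a) * cnj (U $$ (d, a))) * cnj (stine y d))"
    by (rule sum.swap)
  also have "\<dots> = (\<Sum>c<n. \<Sum>d<n. \<Sum>a<n. stine x c * (U $$ (c, a) * of_real (p a) * cnj (U $$ (d, a))) * cnj (stine y d))"
    by (intro sum.cong refl sum.swap)
  also have "\<dots> = (\<Sum>c<n. \<Sum>d<n. stine x c * conj_diag n U p $$ (c, d) * cnj (stine y d))"
    by (intro sum.cong refl) (simp add: conj_diag_index[OF U] sum_distrib_left sum_distrib_right)
  finally show ?thesis .
qed

text \<open>In the slots below \<open>r\<close> the range projection and \<open>defect\<close> add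
  up to the identity; slot \<open>r\<close> holds a complete basis; and no frame vector has
  components in both kinds of slots.\<close>

lemma frame_parseval:
  assumes U: "unitary n U" and V: "unitary n V" and t: "t < n" "t' < n" and k: "k < Suc r" "k' < Suc r"
  shows "(\<Sum>x\<in>J. frame U V t x k * cnj (frame U V t' x k')) = (if t = t' \<and> k = k' then 1 else 0)"
proof -
  consider "k < r" "k' < r" | "k < r" "k' = r" | "k = r" "k' < r" | "k = r" "k' = r"
    using k by linarith
  then show ?thesis
  proof cases
    case 1
    let ?x = "(t, k)" and ?y = "(t', k')"
    have mem: "?x \<in> I" "?y \<in> I" using 1 t by auto
    have "(\<Sum>a<n. (\<Sum>c<n. stine ?x c * U $$ (c, a)) * cnj (\<Sum>c<n. stine ?y c * U $$ (c, a)))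
        = (\<Sum>c<n. \<Sum>d<n. stine ?x c * 1\<^sub>m n $$ (c, d) * cnj (stine ?y d))"
      using stine_conj_diag[OF unitary_carrier[OF U], of "\<lambda>_. 1" ?x ?y]
      unfolding conj_diag_one[OF U] by simp
    also have "\<dots> = (\<Sum>c<n. stine ?x c * cnj (stine ?y c))"
      by (intro sum.cong refl) (simp add: if_distrib if_distribR cong: if_cong)
    finally have "(\<Sum>a<n. (\<Sum>c<n. stine ?x c * U $$ (c, a)) * cnj (\<Sum>c<n. stine ?y c * U $$ (c, a)))
        = (if ?x = ?y then 1 else 0) - defect ?x ?y" by (simp add: defect_def)
    then show ?thesis
      using 1 defect_idempotent[OF mem] unfolding sum_J by simp
  qed (use unitary_rows[OF V t] in \<open>simp_all add: sum_J\<close>)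
qed

end

context kraus_family
begin

text \<open>Here \<open>a\<close> is the spectrum of \<open>chan \<rho> - c T\<close> with \<open>T = defect_trace\<close>, so that the partial trace of the
  weighted frame is \<open>(1 - s) chan \<rho> + s c T + s (chan \<rho> - c T) = chan \<rho>\<close>.\<close>

fun weight :: "real \<Rightarrow> real \<Rightarrow> (nat \<Rightarrow> real) \<Rightarrow> (nat \<Rightarrow> real) \<Rightarrow> nat + (nat \<times> nat) + nat \<Rightarrow> real" where
  "weight s c p a (Inl i) = (1 - s) * p i"
| "weight s c p a (Inr (Inl y)) = s * c"
| "weight s c p a (Inr (Inr i)) = s * a i"

lemma weight_pos:
  assumes "0 < s" "s < 1" "0 < c" and p: "\<And>i. i < n \<Longrightarrow> 0 < p i" and a: "\<And>i. i < n \<Longrightarrow> 0 < a i"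
    and x: "x \<in> J"
  shows "0 < weight s c p a x"
  using x
proof (elim PlusE)
  fix i assume "x = Inl i" "i \<in> {..<n}"
  with assms(2) p show ?thesis by simp
next
  fix z y assume "x = Inr z" "z = Inl y"
  with assms(1,3) show ?thesis by simp
next
  fix z i assume "x = Inr z" "z = Inr i" "i \<in> {..<n}"
  with assms(1) a show ?thesis by simp
qed

lemma frame_reduced:
  assumes U: "unitary n U" and V: "unitary n V" and t: "t < n" "t' < n"
    and a: "chan (conj_diag n U p) - of_real c \<cdot>\<^sub>m defect_trace = conj_diag n V a"
  shows "(\<Sum>k<Suc r. \<Sum>x\<in>J. of_real (weight s c p a x) * (frame U V t x k * cnj (frame U V t' x k)))
    = chan (conj_diag n U p) $$ (t, t')"
proof -
  note cU = unitary_carrier[OF U] and cV = unitary_carrier[OF V]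
  let ?R = "conj_diag n U p"
  have k: "(\<Sum>x\<in>J. of_real (weight s c p a x) * (frame U V t x k * cnj (frame U V t' x k)))
      = of_real (1 - s) * (\<Sum>c<n. \<Sum>d<n. stine (t, k) c * ?R $$ (c, d) * cnj (stine (t', k) d))
        + of_real (s * c) * defect (t, k) (t', k)" if k: "k < r" for k
  proof -
    have di: "(\<Sum>y\<in>I. defect (t, k) y * cnj (defect (t', k) y)) = defect (t, k) (t', k)"
      by (rule defect_idempotent) (use k t in auto)
    have "(\<Sum>x\<in>J. of_real (weight s c p a x) * (frame U V t x k * cnj (frame U V t' x k)))
      = of_real (1 - s) * (\<Sum>a<n. of_real (p a) * ((\<Sum>c<n. stine (t, k) c * U $$ (c, a)) * cnj (\<Sum>c<n. stine (t', k) c * U $$ (c, a))))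
        + of_real (s * c) * (\<Sum>y\<in>I. defect (t, k) y * cnj (defect (t', k) y))"
      unfolding sum_J using k by (simp add: sum_distrib_left mult.assoc)
    then show ?thesis by (simp only: stine_conj_diag[OF cU] di)
  qed
  \<comment> \<open>Slot \<open>r\<close> sees only the basis \<open>V\<close>, whose weights carry
    the correction of the partial trace.\<close>
  have r: "(\<Sum>x\<in>J. of_real (weight s c p a x) * (frame U V t x r * cnj (frame U V t' x r)))
      = of_real s * conj_diag n V a $$ (t, t')"
    unfolding sum_J by (simp add: conj_diag_index[OF cV t] sum_distrib_left mult_ac)
  have ch: "(\<Sum>k<r. \<Sum>c<n. \<Sum>d<n. stine (t, k) c * ?R $$ (c, d) * cnj (stine (t', k) d)) = chan ?R $$ (t, t')"
    using t by (simp add: chan_def stine_def)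
  have V': "conj_diag n V a $$ (t, t') = chan ?R $$ (t, t') - of_real c * defect_trace $$ (t, t')"
    unfolding a[symmetric] using t by (simp add: chan_def defect_trace_def)
  have "(\<Sum>k<r. \<Sum>x\<in>J. of_real (weight s c p a x) * (frame U V t x k * cnj (frame U V t' x k)))
      = (\<Sum>k<r. of_real (1 - s) * (\<Sum>c<n. \<Sum>d<n. stine (t, k) c * ?R $$ (c, d) * cnj (stine (t', k) d))
        + of_real (s * c) * defect (t, k) (t', k))"
    by (rule sum.cong[OF refl]) (rule k, simp)
  also have "\<dots> = of_real (1 - s) * chan ?R $$ (t, t') + of_real (s * c) * (\<Sum>k<r. defect (t, k) (t', k))"
    unfolding sum.distrib sum_distrib_left[symmetric] ch ..
  also have "(\<Sum>k<r. defect (t, k) (t', k)) = defect_trace $$ (t, t')"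
    using t by (simp add: defect_trace_def)
  finally have "(\<Sum>k<Suc r. \<Sum>x\<in>J. of_real (weight s c p a x) * (frame U V t x k * cnj (frame U V t' x k)))
      = of_real (1 - s) * chan ?R $$ (t, t') + of_real (s * c) * defect_trace $$ (t, t')
        + of_real s * conj_diag n V a $$ (t, t')"
    by (simp only: sum.lessThan_Suc r)
  then show ?thesis unfolding V' by (simp add: algebra_simps)
qed

text \<open>Inner product of frame vectors of the two dilated states: \<open>U\<close>,
  \<open>V\<close> belong to the first state and \<open>W\<close>, \<open>Y\<close> to the second,
  while \<open>stine\<close> and \<open>defect\<close> are common to both.\<close>

definition overlap where
  "overlap U V W Y x y = (\<Sum>k<Suc r. \<Sum>t<n. cnj (frame W Y t y k) * frame U V t x k)"

lemma sum_slots: "(\<Sum>k<r. \<Sum>t<n. g (t, k)) = (\<Sum>x\<in>I. g x)"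
  unfolding sum_Times by (rule sum.swap)

text \<open>An isometry preserves inner products. The first block therefore reproduces the overlaps
  of the original eigenvectors, and with them the entropy before the operation.\<close>

lemma overlap_stine_stine:
  "overlap U V W Y (Inl a) (Inl b) = (\<Sum>c<n. cnj (W $$ (c, b)) * U $$ (c, a))"
proof -
  have "overlap U V W Y (Inl a) (Inl b)
      = (\<Sum>k<r. \<Sum>t<n. (\<lambda>x. cnj (\<Sum>c<n. stine x c * W $$ (c, b)) * (\<Sum>d<n. stine x d * U $$ (d, a))) (t, k))"
    by (simp add: overlap_def)
  also have "\<dots> = (\<Sum>x\<in>I. cnj (\<Sum>c<n. stine x c * W $$ (c, b)) * (\<Sum>d<n. stine x d * U $$ (d, a)))"
    by (rule sum_slots)
  also have "\<dots> = (\<Sum>x\<in>I. \<Sum>c<n. \<Sum>d<n. (cnj (stine x c) * stine x d) * (cnj (W $$ (c, b)) * U $$ (d, a)))"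
    unfolding cnj_sum sum_product by (intro sum.cong refl) (simp add: mult_ac)
  also have "\<dots> = (\<Sum>c<n. \<Sum>x\<in>I. \<Sum>d<n. (cnj (stine x c) * stine x d) * (cnj (W $$ (c, b)) * U $$ (d, a)))"
    by (rule sum.swap)
  also have "\<dots> = (\<Sum>c<n. \<Sum>d<n. \<Sum>x\<in>I. (cnj (stine x c) * stine x d) * (cnj (W $$ (c, b)) * U $$ (d, a)))"
    by (intro sum.cong refl sum.swap)
  also have "\<dots> = (\<Sum>c<n. \<Sum>d<n. (if c = d then 1 else 0) * (cnj (W $$ (c, b)) * U $$ (d, a)))"
    unfolding sum_distrib_right[symmetric]
    by (intro sum.cong refl) (simp only: stine_isometry lessThan_iff)
  also have "\<dots> = (\<Sum>c<n. cnj (W $$ (c, b)) * U $$ (c, a))"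
    by (intro sum.cong refl sum_delta_mult) auto
  finally show ?thesis .
qed

lemma overlap_cnj: "overlap U V W Y x y = cnj (overlap W Y U V y x)"
  by (simp add: overlap_def mult.commute)

text \<open>The projection \<open>defect\<close> annihilates the range of the isometry, the same one
  in both frames.\<close>

lemma overlap_stine_defect:
  assumes y: "y \<in> I"
  shows "overlap U V W Y (Inl a) (Inr (Inl y)) = 0"
proof -
  have "overlap U V W Y (Inl a) (Inr (Inl y))
      = (\<Sum>k<r. \<Sum>t<n. (\<lambda>x. defect y x * (\<Sum>c<n. stine x c * U $$ (c, a))) (t, k))"
    by (simp add: overlap_def defect_hermitian)
  also have "\<dots> = (\<Sum>x\<in>I. defect y x * (\<Sum>c<n. stine x c * U $$ (c, a)))"
    by (rule sum_slots)
  also have "\<dots> = (\<Sum>c<n. (\<Sum>x\<in>I. defect y x * stine x c) * U $$ (c, a))"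
    unfolding sum_distrib_left sum_distrib_right by (subst sum.swap) (simp add: mult.assoc)
  also have "\<dots> = 0" using defect_stine[OF y] by simp
  finally show ?thesis .
qed

lemma overlap_defect_stine:
  assumes "y \<in> I"
  shows "overlap U V W Y (Inr (Inl y)) (Inl a) = 0"
  by (subst overlap_cnj) (simp add: overlap_stine_defect[OF assms])

lemma overlap_last:
  "overlap U V W Y (Inl a) (Inr (Inr b)) = 0" "overlap U V W Y (Inr (Inl y)) (Inr (Inr b)) = 0"
  "overlap U V W Y (Inr (Inr b)) (Inl a) = 0" "overlap U V W Y (Inr (Inr b)) (Inr (Inl y)) = 0"
  by (simp_all add: overlap_def)

text \<open>The entropy of the dilated states splits along the three blocks of the frame; only the first
  block survives in the limit \<open>s \<rightarrow> 0\<close>.\<close>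

theorem chan_monotone:
  assumes conv: "operator_convex_on {0<..} f"
    and U: "unitary n U" and W: "unitary n W"
    and p: "\<And>i. i < n \<Longrightarrow> 0 < p i" and q: "\<And>i. i < n \<Longrightarrow> 0 < q i"
    and pos: "strictly_positive n (chan (conj_diag n U p))" "strictly_positive n (chan (conj_diag n W q))"
  shows "f_rel_entropy f (chan (conj_diag n U p)) (chan (conj_diag n W q))
    \<le> f_rel_entropy f (conj_diag n U p) (conj_diag n W q)"
proof -
  let ?\<rho> = "conj_diag n U p" and ?\<sigma> = "conj_diag n W q"
  obtain c1 where c1: "0 < c1" "\<forall>c. 0 < c \<and> c \<le> c1 \<longrightarrow> strictly_positive n (chan ?\<rho> - of_real c \<cdot>\<^sub>m defect_trace)"
    using strictly_positive_perturb[OF pos(1) hermitian_defect_trace] by auto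
  obtain c2 where c2: "0 < c2" "\<forall>c. 0 < c \<and> c \<le> c2 \<longrightarrow> strictly_positive n (chan ?\<sigma> - of_real c \<cdot>\<^sub>m defect_trace)"
    using strictly_positive_perturb[OF pos(2) hermitian_defect_trace] by auto
  \<comment> \<open>A common constant gives the \<open>defect\<close> blocks of both states the same
    weight, so their eigenvalue ratio is 1.\<close>
  define c where "c = min c1 c2"
  have c: "0 < c" using c1(1) c2(1) by (simp add: c_def)
  have cpos: "strictly_positive n (chan ?\<rho> - of_real c \<cdot>\<^sub>m defect_trace)"
    "strictly_positive n (chan ?\<sigma> - of_real c \<cdot>\<^sub>m defect_trace)"
    using c1(2) c2(2) c by (simp_all add: c_def)
  obtain V a where V: "unitary n V" and a: "chan ?\<rho> - of_real c \<cdot>\<^sub>m defect_trace = conj_diag n V a"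
    "\<And>i. i < n \<Longrightarrow> 0 < a i"
    using strictly_positive_spectral[OF cpos(1)] by blast
  obtain Y b where Y: "unitary n Y" and b: "chan ?\<sigma> - of_real c \<cdot>\<^sub>m defect_trace = conj_diag n Y b"
    "\<And>i. i < n \<Longrightarrow> 0 < b i"
    using strictly_positive_spectral[OF cpos(2)] by blast
  obtain U' p' where U': "unitary n U'" and p': "chan ?\<rho> = conj_diag n U' p'" "\<And>i. i < n \<Longrightarrow> 0 < p' i"
    using strictly_positive_spectral[OF pos(1)] by blast
  obtain W' q' where W': "unitary n W'" and q': "chan ?\<sigma> = conj_diag n W' q'" "\<And>i. i < n \<Longrightarrow> 0 < q' i"
    using strictly_positive_spectral[OF pos(2)] by blast
  let ?o = "overlap U V W Y"
  define S where "S = f_rel_entropy f ?\<rho> ?\<sigma>"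
  have S: "S = (\<Sum>i<n. \<Sum>j<n. p i * f (q j / p i) * (cmod (\<Sum>k<n. cnj (W $$ (k, j)) * U $$ (k, i)))\<^sup>2)"
    unfolding S_def by (rule f_rel_entropy_spectral[OF U W p])
  \<comment> \<open>The contribution of the second and third block with the factor \<open>s\<close>
    taken out; it does not depend on \<open>s\<close>.\<close>
  define C where "C = (\<Sum>x\<in>I. \<Sum>y\<in>I. c * f 1 * (cmod (?o (Inr (Inl x)) (Inr (Inl y))))\<^sup>2)
    + (\<Sum>i<n. \<Sum>j<n. a i * f (b j / a i) * (cmod (?o (Inr (Inr i)) (Inr (Inr j))))\<^sup>2)"
  have le: "f_rel_entropy f (chan ?\<rho>) (chan ?\<sigma>) \<le> (1 - s) * S + s * C" if s: "0 < s" "s < 1" for s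
  proof -
    let ?p = "weight s c p a" and ?q = "weight s c q b"
    let ?T = "\<lambda>x y. ?p x * f (?q y / ?p x) * (cmod (?o x y))\<^sup>2"
    have pp: "0 < ?p x" if "x \<in> J" for x by (rule weight_pos[OF s c p a(2) that])
    have qq: "0 < ?q x" if "x \<in> J" for x by (rule weight_pos[OF s c q b(2) that])
    have dp: "f_rel_entropy f (conj_diag n U' p') (conj_diag n W' q') \<le> (\<Sum>x\<in>J. \<Sum>y\<in>J. ?T x y)"
      unfolding overlap_def
    proof (rule frame_data_processing[OF conv _ _ U' W'])
      fix t t' assume t: "t < n" "t' < n"
      show "(\<Sum>k<Suc r. \<Sum>x\<in>J. of_real (?p x) * (frame U V t x k * cnj (frame U V t' x k))) = conj_diag n U' p' $$ (t, t')"
        unfolding p'(1)[symmetric] by (rule frame_reduced[OF U V t a(1)])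
      show "(\<Sum>k<Suc r. \<Sum>x\<in>J. of_real (?q x) * (frame W Y t x k * cnj (frame W Y t' x k))) = conj_diag n W' q' $$ (t, t')"
        unfolding q'(1)[symmetric] by (rule frame_reduced[OF W Y t b(1)])
    next
      fix t t' k k' assume t: "t < n" "t' < n" and k: "k < Suc r" "k' < Suc r"
      show "(\<Sum>x\<in>J. frame U V t x k * cnj (frame U V t' x k')) = (if t = t' \<and> k = k' then 1 else 0)"
        by (rule frame_parseval[OF U V t k])
      show "(\<Sum>x\<in>J. frame W Y t x k * cnj (frame W Y t' x k')) = (if t = t' \<and> k = k' then 1 else 0)"
        by (rule frame_parseval[OF W Y t k])
    next
      fix x assume "x \<in> J"
      then show "0 < ?p x" "0 < ?q x" by (fact pp qq)+
    next
      fix i assume "i < n"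
      then show "0 < p' i" by (rule p'(2))
    qed simp_all
    have split: "(\<Sum>x\<in>J. \<Sum>y\<in>J. ?T x y) = (\<Sum>i<n. \<Sum>j<n. ?T (Inl i) (Inl j))
        + ((\<Sum>x\<in>I. \<Sum>y\<in>I. ?T (Inr (Inl x)) (Inr (Inl y))) + (\<Sum>i<n. \<Sum>j<n. ?T (Inr (Inr i)) (Inr (Inr j))))"
    proof -
      have z1: "(\<Sum>i<n. \<Sum>y\<in>I. ?T (Inl i) (Inr (Inl y))) = 0"
        by (intro sum.neutral ballI) (simp only: overlap_stine_defect, simp)
      have z2: "(\<Sum>x\<in>I. \<Sum>i<n. ?T (Inr (Inl x)) (Inl i)) = 0"
        by (intro sum.neutral ballI) (simp only: overlap_defect_stine, simp)
      have z3: "(\<Sum>i<n. \<Sum>j<n. ?T (Inl i) (Inr (Inr j))) = 0" "(\<Sum>x\<in>I. \<Sum>j<n. ?T (Inr (Inl x)) (Inr (Inr j))) = 0"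
        "(\<Sum>i<n. \<Sum>j<n. ?T (Inr (Inr i)) (Inl j)) = 0" "(\<Sum>i<n. \<Sum>y\<in>I. ?T (Inr (Inr i)) (Inr (Inl y))) = 0"
        by (simp_all only: overlap_last) simp_all
      show ?thesis unfolding sum_J sum.distrib z1 z2 z3 by simp
    qed
    \<comment> \<open>Cancelling in the ratios uses \<open>s \<noteq> 0\<close> and
      \<open>s \<noteq> 1\<close>, hence the restriction to the open interval.\<close>
    have c1s: "((1 - s) * u) / ((1 - s) * v) = u / v" and cs: "(s * u) / (s * v) = u / v"
      and cc: "(s * c) / (s * c) = 1" for u v
      using s c by simp_all
    have t1: "(\<Sum>i<n. \<Sum>j<n. ?T (Inl i) (Inl j)) = (1 - s) * S"
      unfolding S overlap_stine_stine unfolding sum_distrib_left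
      by (intro sum.cong refl) (simp only: weight.simps c1s mult.assoc)
    have t2: "(\<Sum>x\<in>I. \<Sum>y\<in>I. ?T (Inr (Inl x)) (Inr (Inl y))) = s * (\<Sum>x\<in>I. \<Sum>y\<in>I. c * f 1 * (cmod (?o (Inr (Inl x)) (Inr (Inl y))))\<^sup>2)"
      unfolding sum_distrib_left
      by (intro sum.cong refl) (simp only: weight.simps cc mult.assoc)
    have t3: "(\<Sum>i<n. \<Sum>j<n. ?T (Inr (Inr i)) (Inr (Inr j))) = s * (\<Sum>i<n. \<Sum>j<n. a i * f (b j / a i) * (cmod (?o (Inr (Inr i)) (Inr (Inr j))))\<^sup>2)"
      unfolding sum_distrib_left
      by (intro sum.cong refl) (simp only: weight.simps cs mult.assoc)
    show ?thesis using dp unfolding split t1 t2 t3 C_def p'(1) q'(1) by (simp only: distrib_left)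
  qed
  have "f_rel_entropy f (chan ?\<rho>) (chan ?\<sigma>) \<le> S"
  proof (rule ccontr)
    \<comment> \<open>A violation by \<open>e > 0\<close> would give
      \<open>e \<le> s * (C - S)\<close> for every admissible \<open>s\<close>; the chosen
      \<open>s\<close> makes the right side at most \<open>e / 2\<close>.\<close>
    assume neg: "\<not> f_rel_entropy f (chan ?\<rho>) (chan ?\<sigma>) \<le> S"
    define e where "e = f_rel_entropy f (chan ?\<rho>) (chan ?\<sigma>) - S"
    have e: "0 < e" using neg by (simp add: e_def)
    define M where "M = \<bar>C - S\<bar> + 1"
    have M: "0 < M" "C - S \<le> M" by (auto simp: M_def)
    define s where "s = min (1/2) (e / (2 * M))"
    have "0 < e / (2 * M)" using e M by simp
    then have s: "0 < s" "s < 1" "s \<le> e / (2 * M)" unfolding s_def by linarith+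
    have "e \<le> s * (C - S)" using le[OF s(1,2)] by (simp add: e_def algebra_simps)
    also have "\<dots> \<le> s * M" using s M by (intro mult_left_mono) auto
    also have "\<dots> \<le> e / (2 * M) * M" using s M by (intro mult_right_mono) auto
    also have "\<dots> = e / 2" using M by (simp add: field_simps)
    finally show False using e by simp
  qed
  then show ?thesis by (simp add: S_def)
qed

end

text \<open>On matrices of size \<open>n\<close> the operation agrees with \<open>chan\<close> for
  its Kraus operators, so the dilation argument applies to the spectral decompositions of both
  states.\<close>

theorem f_rel_entropy_cptp_monotone:
  assumes conv: "operator_convex_on {0<..} f" and E: "cptp n E"
    and pos: "strictly_positive n \<rho>" "strictly_positive n \<sigma>"
    and Epos: "strictly_positive n (E \<rho>)" "strictly_positive n (E \<sigma>)"
  shows "f_rel_entropy f (E \<rho>) (E \<sigma>) \<le> f_rel_entropy f \<rho> \<sigma>"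
proof -
  obtain r :: nat and K :: "nat \<Rightarrow> nat \<Rightarrow> nat \<Rightarrow> complex" where K: "\<forall>X\<in>carrier_mat n n. \<forall>i<n. \<forall>j<n.
      E X $$ (i, j) = (\<Sum>k<r. \<Sum>a<n. \<Sum>b<n. K k i a * X $$ (a, b) * cnj (K k j b))"
    and complete: "\<forall>a<n. \<forall>b<n. (\<Sum>k<r. \<Sum>i<n. cnj (K k i a) * K k i b) = (if a = b then 1 else 0)"
    using cptp_kraus[OF E] by (elim exE conjE) (rule that)
  interpret kraus_family n r K by standard (use complete in blast)
  have chan: "E X = chan X" if X: "X \<in> carrier_mat n n" for X
  proof -
    have "E X \<in> carrier_mat n n" using E X by (simp add: cptp_def)
    then show ?thesis using bspec[OF K X] by (intro eq_matI) (auto simp: chan_def)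
  qed
  have car: "\<rho> \<in> carrier_mat n n" "\<sigma> \<in> carrier_mat n n"
    using pos by (auto simp: strictly_positive_def hermitian_def)
  obtain U p where U: "unitary n U" and \<rho>: "\<rho> = conj_diag n U p" and p: "\<And>i. i < n \<Longrightarrow> 0 < p i"
    using strictly_positive_spectral[OF pos(1)] by blast
  obtain W q where W: "unitary n W" and \<sigma>: "\<sigma> = conj_diag n W q" and q: "\<And>i. i < n \<Longrightarrow> 0 < q i"
    using strictly_positive_spectral[OF pos(2)] by blast
  show ?thesis
    using Epos unfolding chan[OF car(1)] chan[OF car(2)] unfolding \<rho> \<sigma>
    by (intro chan_monotone[OF conv U W p q])
qed

section \<open>Operations on composite systems and ensembles\<close>

lemma cptp_carrier: "cptp d E \<Longrightarrow> A \<in> carrier_mat d d \<Longrightarrow> E A \<in> carrier_mat d d"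
  by (simp add: cptp_def)

lemma block_B_carrier [simp]: "block_B d n M k l \<in> carrier_mat d d"
  by (simp add: block_B_def)

lemma tensor_id_carrier [simp]: "tensor_id d n E M \<in> carrier_mat (d * n) (d * n)"
  by (simp add: tensor_id_def)

lemma tensor_id_index:
  assumes "i < d" "j < d" "k < n" "l < n"
  shows "tensor_id d n E M $$ (i * n + k, j * n + l) = E (block_B d n M k l) $$ (i, j)"
  using assms by (simp add: tensor_id_def mult_add_less_mult)

lemma eq_mat_blockI:
  assumes "A \<in> carrier_mat (d * n) (d * n)" "B \<in> carrier_mat (d * n) (d * n)"
    and eq: "\<And>i j k l. i < d \<Longrightarrow> j < d \<Longrightarrow> k < n \<Longrightarrow> l < n \<Longrightarrow>
      A $$ (i * n + k, j * n + l) = B $$ (i * n + k, j * n + l)"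
  shows "A = B"
proof (rule eq_matI)
  fix r c assume "r < dim_row B" "c < dim_col B"
  then have rc: "r < d * n" "c < d * n" using assms(2) by auto
  have "A $$ (r div n * n + r mod n, c div n * n + c mod n) = B $$ (r div n * n + r mod n, c div n * n + c mod n)"
    using rc by (intro eq less_mult_imp_div_less mod_less_of_mult)
  then show "A $$ (r, c) = B $$ (r, c)" by simp
qed (use assms(1,2) in auto)

lemma block_B_tensor_id:
  assumes E: "cptp d E" and kl: "k < n" "l < n"
  shows "block_B d n (tensor_id d n E M) k l = E (block_B d n M k l)"
proof (rule eq_matI)
  have c: "E (block_B d n M k l) \<in> carrier_mat d d" by (rule cptp_carrier[OF E]) simp
  show "dim_row (block_B d n (tensor_id d n E M) k l) = dim_row (E (block_B d n M k l))"
    "dim_col (block_B d n (tensor_id d n E M) k l) = dim_col (E (block_B d n M k l))"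
    using c by (auto simp: block_B_def)
  fix i j assume "i < dim_row (E (block_B d n M k l))" "j < dim_col (E (block_B d n M k l))"
  then have "i < d" "j < d" using c by auto
  with kl show "block_B d n (tensor_id d n E M) k l $$ (i, j) = E (block_B d n M k l) $$ (i, j)"
    by (simp add: block_B_def[of d n "tensor_id d n E M"] tensor_id_index)
qed

lemma tensor_id_comp:
  assumes E1: "cptp d E1"
  shows "tensor_id d n E2 (tensor_id d n E1 M) = tensor_id d n (E2 \<circ> E1) M"
  by (rule eq_mat_blockI[of _ d n]) (simp_all add: tensor_id_index block_B_tensor_id[OF E1])

text \<open>Two ancillas of dimensions \<open>n\<close> and \<open>m\<close> merge into one of
  dimension \<open>n * m\<close>, since
  \<open>(i * n + k) * m + l = i * (n * m) + (k * m + l)\<close>.\<close>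

lemma tensor_id_tensor_id:
  "tensor_id (d * n) m (tensor_id d n E) M = tensor_id d (n * m) E M"
proof (rule eq_mat_blockI[of _ "d * n" m])
  fix s t k l assume s: "s < d * n" and t: "t < d * n" and kl: "k < m" "l < m"
  have nm: "(s mod n) * m + k < n * m" "(t mod n) * m + l < n * m"
    using s t kl by (auto intro!: mult_add_less_mult mod_less_of_mult)
  have split: "s * m + k = s div n * (n * m) + (s mod n * m + k)" "t * m + l = t div n * (n * m) + (t mod n * m + l)"
    by (metis add.assoc add_mult_distrib div_mult_mod_eq mult.assoc)+
  have "block_B d n (block_B (d * n) m M k l) (s mod n) (t mod n)
      = block_B d (n * m) M (s mod n * m + k) (t mod n * m + l)"
  proof (rule eq_matI)
    fix i j assume "i < dim_row (block_B d (n * m) M (s mod n * m + k) (t mod n * m + l))"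
      "j < dim_col (block_B d (n * m) M (s mod n * m + k) (t mod n * m + l))"
    then have ij: "i < d" "j < d" by (auto simp: block_B_def)
    then have "i * n + s mod n < d * n" "j * n + t mod n < d * n"
      using s t by (auto intro!: mult_add_less_mult mod_less_of_mult)
    with ij show "block_B d n (block_B (d * n) m M k l) (s mod n) (t mod n) $$ (i, j)
        = block_B d (n * m) M (s mod n * m + k) (t mod n * m + l) $$ (i, j)"
      by (simp add: block_B_def add_mult_distrib mult.assoc add.assoc)
  qed (simp_all add: block_B_def)
  then have "tensor_id (d * n) m (tensor_id d n E) M $$ (s * m + k, t * m + l)
      = E (block_B d (n * m) M (s mod n * m + k) (t mod n * m + l)) $$ (s div n, t div n)"
    using s t kl by (simp add: tensor_id_index) (simp add: tensor_id_def)
  also have "\<dots> = tensor_id d (n * m) E M $$ (s * m + k, t * m + l)"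
    unfolding split using s t nm by (simp add: tensor_id_index less_mult_imp_div_less)
  finally show "tensor_id (d * n) m (tensor_id d n E) M $$ (s * m + k, t * m + l)
      = tensor_id d (n * m) E M $$ (s * m + k, t * m + l)" .
qed (simp, simp add: mult.assoc)

lemma mat_tr_block:
  assumes "M \<in> carrier_mat (d * n) (d * n)"
  shows "mat_tr M = (\<Sum>k<n. mat_tr (block_B d n M k k))"
proof -
  have "mat_tr M = (\<Sum>r<d * n. M $$ (r div n * n + r mod n, r div n * n + r mod n))"
    using assms by (simp add: mat_tr_def)
  also have "\<dots> = (\<Sum>i<d. \<Sum>k<n. M $$ (i * n + k, i * n + k))"
    by (rule sum_div_mod)
  also have "\<dots> = (\<Sum>k<n. \<Sum>i<d. M $$ (i * n + k, i * n + k))" by (rule sum.swap)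
  finally show ?thesis by (simp add: mat_tr_def block_B_def)
qed

text \<open>Complete positivity quantifies over all ancillas, so by merging ancillas it passes from
  \<open>E\<close> to its extension. The remaining conditions are checked block by block.\<close>

lemma cptp_tensor_id:
  assumes E: "cptp d E"
  shows "cptp (d * n) (tensor_id d n E)"
  unfolding cptp_def
proof (intro conjI ballI allI impI)
  fix A B :: "complex mat" assume A: "A \<in> carrier_mat (d * n) (d * n)" and B: "B \<in> carrier_mat (d * n) (d * n)"
  show "tensor_id d n E (A + B) = tensor_id d n E A + tensor_id d n E B"
  proof (rule eq_mat_blockI)
    fix i j k l assume ij: "i < d" "j < d" and kl: "k < n" "l < n"
    have "block_B d n (A + B) k l = block_B d n A k l + block_B d n B k l"
      using A B kl by (intro eq_matI) (auto simp: block_B_def mult_add_less_mult)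
    then have "E (block_B d n (A + B) k l) = E (block_B d n A k l) + E (block_B d n B k l)"
      using E by (simp add: cptp_def)
    moreover have "E (block_B d n B k l) \<in> carrier_mat d d" by (rule cptp_carrier[OF E]) simp
    ultimately show "tensor_id d n E (A + B) $$ (i * n + k, j * n + l)
        = (tensor_id d n E A + tensor_id d n E B) $$ (i * n + k, j * n + l)"
      using ij kl carrier_matD[OF tensor_id_carrier] by (simp add: tensor_id_index mult_add_less_mult)
  qed auto
next
  fix c and A :: "complex mat" assume A: "A \<in> carrier_mat (d * n) (d * n)"
  show "tensor_id d n E (c \<cdot>\<^sub>m A) = c \<cdot>\<^sub>m tensor_id d n E A"
  proof (rule eq_mat_blockI)
    fix i j k l assume ij: "i < d" "j < d" and kl: "k < n" "l < n"
    have "block_B d n (c \<cdot>\<^sub>m A) k l = c \<cdot>\<^sub>m block_B d n A k l"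
      using A kl by (intro eq_matI) (auto simp: block_B_def mult_add_less_mult)
    then have "E (block_B d n (c \<cdot>\<^sub>m A) k l) = c \<cdot>\<^sub>m E (block_B d n A k l)"
      using E by (simp add: cptp_def)
    moreover have "E (block_B d n A k l) \<in> carrier_mat d d" by (rule cptp_carrier[OF E]) simp
    ultimately show "tensor_id d n E (c \<cdot>\<^sub>m A) $$ (i * n + k, j * n + l)
        = (c \<cdot>\<^sub>m tensor_id d n E A) $$ (i * n + k, j * n + l)"
      using ij kl carrier_matD[OF tensor_id_carrier] by (simp add: tensor_id_index mult_add_less_mult)
  qed auto
next
  fix A :: "complex mat" assume A: "A \<in> carrier_mat (d * n) (d * n)"
  have "mat_tr (tensor_id d n E A) = (\<Sum>k<n. mat_tr (E (block_B d n A k k)))"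
    unfolding mat_tr_block[OF tensor_id_carrier] by (intro sum.cong refl) (simp add: block_B_tensor_id[OF E])
  also have "\<dots> = mat_tr A"
    using E unfolding mat_tr_block[OF A] by (simp add: cptp_def)
  finally show "mat_tr (tensor_id d n E A) = mat_tr A" .
next
  fix m M assume "pos_semidef (d * n * m) M"
  with E show "pos_semidef (d * n * m) (tensor_id (d * n) m (tensor_id d n E) M)"
    unfolding tensor_id_tensor_id by (simp add: cptp_def mult.assoc)
qed simp

lemma kron_index:
  assumes "A \<in> carrier_mat d d" "B \<in> carrier_mat n n" "i < d" "j < d" "k < n" "l < n"
  shows "(A \<otimes>\<^sub>k B) $$ (i * n + k, j * n + l) = A $$ (i, j) * B $$ (k, l)"
  using assms by (simp add: kron_def mult_add_less_mult)

lemma kron_carrier: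
  "A \<in> carrier_mat d d \<Longrightarrow> B \<in> carrier_mat n n \<Longrightarrow> A \<otimes>\<^sub>k B \<in> carrier_mat (d * n) (d * n)"
  by (auto simp: kron_def)

lemma tensor_id_kron:
  assumes E: "cptp d E" and X: "X \<in> carrier_mat d d" and Y: "Y \<in> carrier_mat n n"
  shows "tensor_id d n E (X \<otimes>\<^sub>k Y) = E X \<otimes>\<^sub>k Y"
proof (rule eq_mat_blockI)
  have EX: "E X \<in> carrier_mat d d" by (rule cptp_carrier[OF E X])
  show "E X \<otimes>\<^sub>k Y \<in> carrier_mat (d * n) (d * n)" by (rule kron_carrier[OF EX Y])
  fix i j k l assume ij: "i < d" "j < d" and kl: "k < n" "l < n"
  have "block_B d n (X \<otimes>\<^sub>k Y) k l = Y $$ (k, l) \<cdot>\<^sub>m X"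
    using X kl by (intro eq_matI) (auto simp: block_B_def kron_index[OF X Y])
  then have "E (block_B d n (X \<otimes>\<^sub>k Y) k l) = Y $$ (k, l) \<cdot>\<^sub>m E X"
    using E X by (simp add: cptp_def)
  then show "tensor_id d n E (X \<otimes>\<^sub>k Y) $$ (i * n + k, j * n + l) = (E X \<otimes>\<^sub>k Y) $$ (i * n + k, j * n + l)"
    using ij kl carrier_matD[OF EX] by (simp add: tensor_id_index kron_index[OF EX Y])
qed simp

lemma ptrace_carrier [simp]:
  "ptrace_B d n M \<in> carrier_mat d d" "ptrace_A d n M \<in> carrier_mat n n"
  by (simp_all add: ptrace_B_def ptrace_A_def)

lemma cptp_zero:
  assumes E: "cptp d E"
  shows "E (0\<^sub>m d d) = 0\<^sub>m d d"
proof -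
  have c: "E (0\<^sub>m d d) \<in> carrier_mat d d" by (rule cptp_carrier[OF E]) simp
  have "E (0 \<cdot>\<^sub>m 0\<^sub>m d d) = 0 \<cdot>\<^sub>m E (0\<^sub>m d d)"
    using E zero_carrier_mat unfolding cptp_def by blast
  moreover have "0 \<cdot>\<^sub>m 0\<^sub>m d d = (0\<^sub>m d d :: complex mat)" by (rule eq_matI) auto
  moreover have "0 \<cdot>\<^sub>m E (0\<^sub>m d d) = 0\<^sub>m d d" using c by (intro eq_matI) auto
  ultimately show ?thesis by simp
qed

lemma ptrace_B_tensor_id:
  assumes E: "cptp d E"
  shows "ptrace_B d n (tensor_id d n E M) = E (ptrace_B d n M)"
proof -
  \<comment> \<open>Partial sums of the partial trace, because additivity is available for two
    summands at a time.\<close>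
  define P where "P m = mat d d (\<lambda>(i, j). \<Sum>k<m. M $$ (i * n + k, j * n + k))" for m
  have P: "P m \<in> carrier_mat d d" for m by (simp add: P_def)
  have "E (P m) $$ (i, j) = (\<Sum>k<m. E (block_B d n M k k) $$ (i, j))" if ij: "i < d" "j < d" and "m \<le> n" for i j m
    using \<open>m \<le> n\<close>
  proof (induction m)
    case 0
    have "P 0 = 0\<^sub>m d d" by (rule eq_matI) (auto simp: P_def)
    then show ?case using cptp_zero[OF E] ij by simp
  next
    case (Suc m)
    have "P (Suc m) = P m + block_B d n M m m"
      by (rule eq_matI) (auto simp: P_def block_B_def)
    then have "E (P (Suc m)) = E (P m) + E (block_B d n M m m)" using E P by (simp add: cptp_def)
    moreover have "E (block_B d n M m m) \<in> carrier_mat d d" by (rule cptp_carrier[OF E]) simp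
    ultimately show ?case using Suc ij by simp
  qed
  from this[of _ _ n] have *: "E (P n) $$ (i, j) = ptrace_B d n (tensor_id d n E M) $$ (i, j)" if "i < d" "j < d" for i j
    using that by (simp add: ptrace_B_def tensor_id_index)
  have "E (P n) \<in> carrier_mat d d" by (rule cptp_carrier[OF E P])
  then have "ptrace_B d n (tensor_id d n E M) = E (P n)"
    using carrier_matD[OF ptrace_carrier(1)] by (intro eq_matI) (auto simp: *)
  then show ?thesis by (simp add: P_def ptrace_B_def)
qed

text \<open>Each entry of the reduced state on B is the trace of a block, and \<open>E\<close>
  preserves traces.\<close>

lemma ptrace_A_tensor_id:
  assumes E: "cptp d E"
  shows "ptrace_A d n (tensor_id d n E M) = ptrace_A d n M"
proof (rule eq_matI)
  fix k l assume "k < dim_row (ptrace_A d n M)" "l < dim_col (ptrace_A d n M)"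
  then have kl: "k < n" "l < n" by (auto simp: ptrace_A_def)
  have "E (block_B d n M k l) \<in> carrier_mat d d" by (rule cptp_carrier[OF E]) simp
  then have "ptrace_A d n (tensor_id d n E M) $$ (k, l) = mat_tr (E (block_B d n M k l))"
    using kl by (simp add: ptrace_A_def tensor_id_index mat_tr_def)
  also have "\<dots> = mat_tr (block_B d n M k l)" using E by (simp add: cptp_def)
  also have "\<dots> = ptrace_A d n M $$ (k, l)" using kl by (simp add: ptrace_A_def mat_tr_def block_B_def)
  finally show "ptrace_A d n (tensor_id d n E M) $$ (k, l) = ptrace_A d n M $$ (k, l)" .
qed (auto simp: ptrace_A_def)

section \<open>Classical-quantum states\<close>

lemma cq_state_carrier [simp]: "cq_state d n p \<rho> \<in> carrier_mat (d * n) (d * n)"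
  by (simp add: cq_state_def)

lemma cq_state_index:
  assumes \<rho>: "\<And>i. i < n \<Longrightarrow> \<rho> i \<in> carrier_mat d d" and ij: "i < d" "j < d" and kl: "k < n" "l < n"
  shows "cq_state d n p \<rho> $$ (i * n + k, j * n + l) = (if k = l then of_real (p k) * \<rho> k $$ (i, j) else 0)"
proof -
  have "cq_state d n p \<rho> $$ (i * n + k, j * n + l)
      = (\<Sum>a<n. of_real (p a) * (\<rho> a \<otimes>\<^sub>k basis_proj n a) $$ (i * n + k, j * n + l))"
    using ij kl by (simp add: cq_state_def mult_add_less_mult)
  also have "\<dots> = (\<Sum>a<n. if a = k then (if k = l then of_real (p k) * \<rho> k $$ (i, j) else 0) else 0)"
  proof (intro sum.cong refl)
    fix a assume "a \<in> {..<n}"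
    then have a: "a < n" by simp
    have "(\<rho> a \<otimes>\<^sub>k basis_proj n a) $$ (i * n + k, j * n + l) = \<rho> a $$ (i, j) * basis_proj n a $$ (k, l)"
      using ij kl by (intro kron_index[OF \<rho>[OF a]]) (auto simp: basis_proj_def)
    then show "of_real (p a) * (\<rho> a \<otimes>\<^sub>k basis_proj n a) $$ (i * n + k, j * n + l)
        = (if a = k then (if k = l then of_real (p k) * \<rho> k $$ (i, j) else 0) else 0)"
      using kl by (auto simp: basis_proj_def)
  qed
  finally show ?thesis using kl by simp
qed

text \<open>The state is block diagonal in B; \<open>E\<close> acts on each diagonal block by
  linearity and fixes the zero blocks.\<close>

lemma tensor_id_cq_state:
  assumes E: "cptp d E" and \<rho>: "\<And>i. i < n \<Longrightarrow> \<rho> i \<in> carrier_mat d d"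
  shows "tensor_id d n E (cq_state d n p \<rho>) = cq_state d n p (\<lambda>i. E (\<rho> i))"
proof (rule eq_mat_blockI)
  fix i j k l assume ij: "i < d" "j < d" and kl: "k < n" "l < n"
  have E\<rho>: "E (\<rho> i) \<in> carrier_mat d d" if "i < n" for i using cptp_carrier[OF E \<rho>[OF that]] .
  show "tensor_id d n E (cq_state d n p \<rho>) $$ (i * n + k, j * n + l)
      = cq_state d n p (\<lambda>i. E (\<rho> i)) $$ (i * n + k, j * n + l)"
  proof (cases "k = l")
    case True
    have "block_B d n (cq_state d n p \<rho>) k l = of_real (p k) \<cdot>\<^sub>m \<rho> k"
      using kl True \<rho>[OF kl(1)] by (intro eq_matI) (auto simp: block_B_def cq_state_index[OF \<rho>])
    then have "E (block_B d n (cq_state d n p \<rho>) k l) = of_real (p k) \<cdot>\<^sub>m E (\<rho> k)"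
      using E \<rho>[OF kl(1)] by (simp add: cptp_def)
    then show ?thesis
      using ij kl True E\<rho>[OF kl(2)] by (simp add: tensor_id_index cq_state_index[OF E\<rho>])
  next
    case False
    have "block_B d n (cq_state d n p \<rho>) k l = 0\<^sub>m d d"
      using kl False by (intro eq_matI) (auto simp: block_B_def cq_state_index[OF \<rho>])
    then show ?thesis
      using ij kl False cptp_zero[OF E] by (simp add: tensor_id_index cq_state_index[OF E\<rho>])
  qed
qed auto

text \<open>The vector \<open>v\<close> tensored with the basis vector \<open>k\<close> of
  B.\<close>

definition embed_B :: "nat \<Rightarrow> nat \<Rightarrow> nat \<Rightarrow> complex vec \<Rightarrow> complex vec" where
  "embed_B d n k v = vec (d * n) (\<lambda>r. if r mod n = k then v $ (r div n) else 0)"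

lemma embed_B_carrier [simp]: "embed_B d n k v \<in> carrier_vec (d * n)"
  by (simp add: embed_B_def)

lemma cq_state_mult_embed_B:
  assumes \<rho>: "\<And>i. i < n \<Longrightarrow> \<rho> i \<in> carrier_mat d d" and k: "k < n" and v: "v \<in> carrier_vec d"
  shows "cq_state d n p \<rho> *\<^sub>v embed_B d n k v = of_real (p k) \<cdot>\<^sub>v embed_B d n k (\<rho> k *\<^sub>v v)"
proof (rule eq_vecI)
  fix r assume "r < dim_vec (of_real (p k) \<cdot>\<^sub>v embed_B d n k (\<rho> k *\<^sub>v v))"
  then have r: "r < d * n" by (simp add: embed_B_def)
  note dm = less_mult_imp_div_less[OF r] mod_less_of_mult[OF r]
  have "(cq_state d n p \<rho> *\<^sub>v embed_B d n k v) $ r = (\<Sum>c<d * n. cq_state d n p \<rho> $$ (r, c) * embed_B d n k v $ c)"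
    by (rule index_mult_vec_sum[OF _ _ r]) simp_all
  also have "\<dots> = (\<Sum>c<d * n. cq_state d n p \<rho> $$ (r div n * n + r mod n, c div n * n + c mod n) * (if c mod n = k then v $ (c div n) else 0))"
    by (intro sum.cong refl) (simp add: embed_B_def)
  also have "\<dots> = (\<Sum>j<d. \<Sum>l<n. cq_state d n p \<rho> $$ (r div n * n + r mod n, j * n + l) * (if l = k then v $ j else 0))"
    by (rule sum_div_mod)
  also have "\<dots> = (\<Sum>j<d. \<Sum>l<n. if l = k then (if r mod n = k then of_real (p k) * \<rho> k $$ (r div n, j) * v $ j else 0) else 0)"
  proof (intro sum.cong refl)
    fix j l assume "j \<in> {..<d}" "l \<in> {..<n}"
    then have "cq_state d n p \<rho> $$ (r div n * n + r mod n, j * n + l)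
        = (if r mod n = l then of_real (p (r mod n)) * \<rho> (r mod n) $$ (r div n, j) else 0)"
      using dm by (intro cq_state_index[OF \<rho>]) auto
    then show "cq_state d n p \<rho> $$ (r div n * n + r mod n, j * n + l) * (if l = k then v $ j else 0)
        = (if l = k then (if r mod n = k then of_real (p k) * \<rho> k $$ (r div n, j) * v $ j else 0) else 0)"
      by (simp only:) auto
  qed
  also have "\<dots> = (\<Sum>j<d. if r mod n = k then of_real (p k) * \<rho> k $$ (r div n, j) * v $ j else 0)"
    using k by simp
  also have "\<dots> = (if r mod n = k then of_real (p k) * (\<rho> k *\<^sub>v v) $ (r div n) else 0)"
    using index_mult_vec_sum[OF \<rho>[OF k] v dm(1)] by (simp add: sum_distrib_left mult.assoc)
  also have "\<dots> = (of_real (p k) \<cdot>\<^sub>v embed_B d n k (\<rho> k *\<^sub>v v)) $ r"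
    using r by (simp add: embed_B_def)
  finally show "(cq_state d n p \<rho> *\<^sub>v embed_B d n k v) $ r = (of_real (p k) \<cdot>\<^sub>v embed_B d n k (\<rho> k *\<^sub>v v)) $ r" .
qed (simp_all add: embed_B_def cq_state_def)

lemma embed_B_cscalar_prod:
  assumes k: "k < n" and v: "v \<in> carrier_vec d" "w \<in> carrier_vec d"
  shows "embed_B d n k v \<bullet>c embed_B d n k w = v \<bullet>c w"
proof -
  have "embed_B d n k v \<bullet>c embed_B d n k w
      = (\<Sum>r<d * n. (\<lambda>j l. if l = k then v $ j * cnj (w $ j) else 0) (r div n) (r mod n))"
    by (simp add: scalar_prod_def lessThan_atLeast0 embed_B_def if_distrib cong: if_cong)
  also have "\<dots> = (\<Sum>j<d. \<Sum>l<n. if l = k then v $ j * cnj (w $ j) else 0)"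
    by (rule sum_div_mod)
  also have "\<dots> = v \<bullet>c w" using k v by (simp add: scalar_prod_def lessThan_atLeast0)
  finally show ?thesis .
qed

lemma embed_B_nonzero:
  assumes k: "k < n" and v: "v \<in> carrier_vec d" "v \<noteq> 0\<^sub>v d"
  shows "embed_B d n k v \<noteq> 0\<^sub>v (d * n)"
proof
  assume *: "embed_B d n k v = 0\<^sub>v (d * n)"
  have "v $ i = 0" if "i < d" for i
    using arg_cong[OF *, of "\<lambda>w. w $ (i * n + k)"] that k by (simp add: embed_B_def mult_add_less_mult)
  with v show False by auto
qed

text \<open>On vectors of the form \<open>v\<close> tensor basis vector \<open>k\<close>, the
  quadratic form of the whole state is \<open>p k\<close> times that of
  \<open>\<rho> k\<close>.\<close>

lemma strictly_positive_cq_state_component: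
  assumes pos: "strictly_positive (d * n) (cq_state d n p \<rho>)"
    and \<rho>: "\<And>i. i < n \<Longrightarrow> \<rho> i \<in> carrier_mat d d" and k: "k < n" and p: "0 < p k"
  shows "strictly_positive d (\<rho> k)"
  unfolding strictly_positive_def
proof (intro conjI ballI impI)
  have herm: "hermitian (d * n) (cq_state d n p \<rho>)" using pos by (simp add: strictly_positive_def)
  show "hermitian d (\<rho> k)"
  proof (rule hermitianI[OF \<rho>[OF k]])
    fix i j assume ij: "i < d" "j < d"
    then have "of_real (p k) * \<rho> k $$ (i, j) = cnj (of_real (p k) * \<rho> k $$ (j, i))"
      using hermitian_index[OF herm, of "i * n + k" "j * n + k"] k by (simp add: mult_add_less_mult cq_state_index[OF \<rho>])
    with p show "\<rho> k $$ (i, j) = cnj (\<rho> k $$ (j, i))" by simp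
  qed
next
  fix v :: "complex vec" assume v: "v \<in> carrier_vec d" "v \<noteq> 0\<^sub>v d"
  have \<rho>v: "\<rho> k *\<^sub>v v \<in> carrier_vec d" using \<rho>[OF k] v by simp
  have mult: "cq_state d n p \<rho> *\<^sub>v embed_B d n k v = of_real (p k) \<cdot>\<^sub>v embed_B d n k (\<rho> k *\<^sub>v v)"
    by (rule cq_state_mult_embed_B[OF \<rho> k v(1)])
  have "(cq_state d n p \<rho> *\<^sub>v embed_B d n k v) \<bullet>c embed_B d n k v
      = of_real (p k) * (embed_B d n k (\<rho> k *\<^sub>v v) \<bullet>c embed_B d n k v)"
    unfolding mult by (rule smult_scalar_prod_distrib[of _ "d * n"]) simp_all
  also have "\<dots> = of_real (p k) * ((\<rho> k *\<^sub>v v) \<bullet>c v)"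
    by (simp only: embed_B_cscalar_prod[OF k \<rho>v v(1)])
  finally have "Re ((cq_state d n p \<rho> *\<^sub>v embed_B d n k v) \<bullet>c embed_B d n k v) = p k * Re ((\<rho> k *\<^sub>v v) \<bullet>c v)"
    by simp
  moreover have "0 < Re ((cq_state d n p \<rho> *\<^sub>v embed_B d n k v) \<bullet>c embed_B d n k v)"
    using pos embed_B_nonzero[OF k v] unfolding strictly_positive_def by simp
  ultimately show "0 < Re ((\<rho> k *\<^sub>v v) \<bullet>c v)" using p by (simp add: zero_less_mult_iff)
qed

lemma ensemble_carrier: "ensemble d n p \<rho> \<Longrightarrow> i < n \<Longrightarrow> \<rho> i \<in> carrier_mat d d"
  by (simp add: ensemble_def strictly_positive_def hermitian_def)

text \<open>Only strict positivity of the images is at stake; it is inherited from the joint output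
  state.\<close>

lemma ensemble_image:
  assumes E: "cptp d E" and ens: "ensemble d n p \<rho>"
    and pos: "strictly_positive (d * n) (tensor_id d n E (cq_state d n p \<rho>))"
  shows "ensemble d n p (\<lambda>i. E (\<rho> i))"
proof -
  note \<rho> = ensemble_carrier[OF ens]
  have eq: "tensor_id d n E (cq_state d n p \<rho>) = cq_state d n p (\<lambda>i. E (\<rho> i))"
    by (rule tensor_id_cq_state[OF E \<rho>])
  have "strictly_positive d (E (\<rho> i))" if "i < n" for i
    using strictly_positive_cq_state_component[OF pos[unfolded eq], of i]
      cptp_carrier[OF E \<rho>] that ens by (simp add: ensemble_def)
  moreover have "mat_tr (E (\<rho> i)) = 1" if "i < n" for i
    using E \<rho>[OF that] ens that by (simp add: cptp_def ensemble_def)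
  ultimately show ?thesis using ens by (simp add: ensemble_def)
qed

text \<open>If all states of the ensemble agree, then \<open>\<rho>\<^sub>A\<^sub>B\<close> is a product state.\<close>

lemma holevo_product_constant:
  assumes E: "cptp d E" and ens: "ensemble d n p \<rho>" and const: "\<And>i. i < n \<Longrightarrow> \<rho> i = \<tau>"
  shows "holevo_product d n E (cq_state d n p \<rho>) = tensor_id d n E (cq_state d n p \<rho>)"
proof (cases "n = 0")
  case True
  then show ?thesis using ens by (simp add: ensemble_def)
next
  case False
  note \<rho> = ensemble_carrier[OF ens]
  let ?R = "cq_state d n p \<rho>"
  have \<tau>: "\<tau> \<in> carrier_mat d d" "mat_tr \<tau> = 1" using False ens \<rho>[of 0] const[of 0] by (auto simp: ensemble_def)
  have E\<tau>: "E \<tau> \<in> carrier_mat d d" by (rule cptp_carrier[OF E \<tau>(1)])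
  have E\<rho>: "E (\<rho> i) \<in> carrier_mat d d" if "i < n" for i using cptp_carrier[OF E \<rho>[OF that]] .
  have "(\<Sum>k<n. complex_of_real (p k)) = 1" using ens by (simp add: ensemble_def flip: of_real_sum)
  then have B: "ptrace_B d n ?R = \<tau>"
    using \<tau> by (intro eq_matI) (auto simp: ptrace_B_def cq_state_index[OF \<rho>] const simp flip: sum_distrib_right)
  have A: "ptrace_A d n ?R $$ (k, l) = (if k = l then of_real (p k) else 0)" if "k < n" "l < n" for k l
    using that \<tau> by (simp add: ptrace_A_def cq_state_index[OF \<rho>] const mat_tr_def flip: sum_distrib_left)
  have eq: "tensor_id d n E ?R = cq_state d n p (\<lambda>i. E (\<rho> i))"
    by (rule tensor_id_cq_state[OF E \<rho>])
  show ?thesis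
    unfolding holevo_product_def B eq
  proof (rule eq_mat_blockI)
    show "E \<tau> \<otimes>\<^sub>k ptrace_A d n ?R \<in> carrier_mat (d * n) (d * n)" by (rule kron_carrier[OF E\<tau>]) simp
    fix i j k l assume "i < d" "j < d" "k < n" "l < n"
    then show "(E \<tau> \<otimes>\<^sub>k ptrace_A d n ?R) $$ (i * n + k, j * n + l)
        = cq_state d n p (\<lambda>i. E (\<rho> i)) $$ (i * n + k, j * n + l)"
      by (simp add: kron_index[OF E\<tau>] A cq_state_index[OF E\<rho>] const)
  qed simp
qed

section \<open>The standing convention and the domain of f\<close>

lemma mat_tr_conj_diag:
  assumes U: "unitary n U"
  shows "mat_tr (conj_diag n U p) = of_real (\<Sum>a<n. p a)"
proof -
  note cU = unitary_carrier[OF U]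
  have "mat_tr (conj_diag n U p) = (\<Sum>i<n. \<Sum>a<n. of_real (p a) * (cnj (U $$ (i, a)) * U $$ (i, a)))"
    using carrier_matD[OF conj_diag_carrier[OF cU]]
    by (simp add: mat_tr_def conj_diag_index[OF cU] mult_ac)
  also have "\<dots> = (\<Sum>a<n. of_real (p a) * (\<Sum>i<n. cnj (U $$ (i, a)) * U $$ (i, a)))"
    by (subst sum.swap) (simp only: sum_distrib_left)
  also have "\<dots> = (\<Sum>a<n. of_real (p a))"
    by (intro sum.cong refl) (simp add: unitary_cols[OF U])
  finally show ?thesis by simp
qed

text \<open>Orthonormality leaves only the diagonal terms, where the eigenvalue ratio is 1. The
  result depends on the state through its trace alone, which a CPTP map preserves.\<close>

lemma f_rel_entropy_self:
  assumes "strictly_positive n \<rho>"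
  shows "f_rel_entropy f \<rho> \<rho> = f 1 * Re (mat_tr \<rho>)"
proof -
  obtain U p where U: "unitary n U" and \<rho>: "\<rho> = conj_diag n U p" and p: "\<forall>i<n. 0 < p i"
    using strictly_positive_spectral[OF assms] by blast
  have "f_rel_entropy f \<rho> \<rho> = (\<Sum>i<n. \<Sum>j<n. p i * f (p j / p i) * (cmod (\<Sum>k<n. cnj (U $$ (k, j)) * U $$ (k, i)))\<^sup>2)"
    unfolding \<rho> by (rule f_rel_entropy_spectral[OF U U]) (use p in blast)
  also have "\<dots> = (\<Sum>i<n. \<Sum>j<n. if j = i then p i * f 1 else 0)"
    using p by (intro sum.cong refl) (force simp: unitary_cols[OF U])
  also have "\<dots> = f 1 * Re (mat_tr \<rho>)"
    unfolding \<rho> mat_tr_conj_diag[OF U] by (simp add: sum_distrib_left mult.commute)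
  finally show ?thesis .
qed

text \<open>The eigenvalues of \<open>rel_modular A A\<close> are all ratios of eigenvalues of
  \<open>A\<close>. Eigenvectors are used as hypotheses because those of a product state are easy to
  write down.\<close>

lemma spectrum_in_rel_modular_self:
  assumes pos: "strictly_positive n A" and D: "spectrum_in (rel_modular A A) D"
    and v: "v \<in> carrier_vec n" "v \<noteq> 0\<^sub>v n" "A *\<^sub>v v = of_real a \<cdot>\<^sub>v v"
    and w: "w \<in> carrier_vec n" "w \<noteq> 0\<^sub>v n" "A *\<^sub>v w = of_real b \<cdot>\<^sub>v w"
  shows "a / b \<in> D"
proof -
  obtain U p where U: "unitary n U" and A: "A = conj_diag n U p" and p: "\<forall>i<n. 0 < p i"
    using strictly_positive_spectral[OF pos] by blast
  obtain i where i: "i < n" "a = p i"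
    using conj_diag_eigenvalue_ex[OF U v(3)[unfolded A] v(1,2)] by auto
  obtain j where j: "j < n" "b = p j"
    using conj_diag_eigenvalue_ex[OF U w(3)[unfolded A] w(1,2)] by auto
  have ij: "i * n + j < n * n" using i j by (intro mult_add_less_mult)
  define Q where "Q = mat (n * n) (n * n) (\<lambda>(r, c). U $$ (r div n, c div n) * cnj (U $$ (r mod n, c mod n)))"
  have Q: "unitary (n * n) Q"
    unfolding Q_def by (rule rel_modular_conj_diag(1)[OF U U, where p = p]) (use p in blast)
  have R: "rel_modular A A = conj_diag (n * n) Q (\<lambda>c. p (c div n) / p (c mod n))"
    unfolding Q_def A by (rule rel_modular_conj_diag(2)[OF U U]) (use p in blast)
  have "complex_of_real (p ((i * n + j) div n) / p ((i * n + j) mod n)) \<in> spectrum (rel_modular A A)"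
    unfolding R spectrum_conj_diag[OF Q] using ij by (intro imageI) simp
  then have "complex_of_real (a / b) \<in> of_real ` D"
    using D i j unfolding spectrum_in_def by auto
  then show ?thesis by (metis imageE of_real_eq_iff)
qed

lemma strictly_positive_eigenvector:
  assumes A: "strictly_positive n A" and n: "0 < n"
  obtains v a where "v \<in> carrier_vec n" "v \<noteq> 0\<^sub>v n" "A *\<^sub>v v = complex_of_real a \<cdot>\<^sub>v v" "0 < a"
proof -
  obtain U p where U: "unitary n U" and AU: "A = conj_diag n U p" and p: "\<forall>i<n. 0 < p i"
    using strictly_positive_spectral[OF A] by blast
  have "col U 0 \<noteq> 0\<^sub>v n"
  proof
    assume *: "col U 0 = 0\<^sub>v n"
    have "U $$ (i, 0) = 0" if "i < n" for i
      using arg_cong[OF *, of "\<lambda>v. v $ i"] that n unitary_carrier[OF U] by simp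
    with unitary_cols[OF U n n] show False by simp
  qed
  with that[of "col U 0" "p 0"] conj_diag_mult_col[OF U n, of p] p n unitary_carrier[OF U]
  show thesis unfolding AU by auto
qed

text \<open>With at least two weights, the ratios \<open>p\<^sub>1/p\<^sub>0\<close> occur as eigenvalues of the relative modular
  operator of a product ensemble, so the standing convention forces the full half-line.\<close>

lemma f_holevo_defined_domain:
  assumes E: "cptp d E" and def: "f_holevo_defined D d n E" and d: "0 < d" and n: "2 \<le> n"
    and D: "D \<subseteq> {0<..}"
  shows "D = {0<..}"
proof (intro equalityI subsetI D[THEN subsetD])
  fix x :: real assume "x \<in> {0<..}"
  then have x: "0 < x" by simp
  \<comment> \<open>One weight is \<open>x * s\<close> and the other \<open>n - 1\<close> are
    \<open>s\<close>: they sum to 1 and have the prescribed ratio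
    \<open>p 1 / p 0 = x\<close>.\<close>
  define s where "s = 1 / (x + real n - 1)"
  define p where "p i = (if i = 1 then x * s else s)" for i :: nat
  have s: "0 < s" "(x + real n - 1) * s = 1" using x n by (auto simp: s_def)
  have "(\<Sum>i<n. p i) = (\<Sum>i<n. s + (if i = 1 then (x - 1) * s else 0))"
    by (intro sum.cong) (auto simp: p_def algebra_simps)
  also have "\<dots> = (x + real n - 1) * s" using n by (simp add: sum.distrib algebra_simps)
  finally have sum: "(\<Sum>i<n. p i) = 1" using s by simp
  have ppos: "0 < p i" for i using s x by (simp add: p_def)
  \<comment> \<open>The maximally mixed state, used for every member of the ensemble.\<close>
  define \<tau> where "\<tau> = conj_diag d (1\<^sub>m d) (\<lambda>_. 1 / real d)"
  have one: "unitary d (1\<^sub>m d)" by (rule unitaryI_cols) (auto simp: if_distrib cong: if_cong)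
  have "strictly_positive d \<tau>"
    unfolding strictly_positive_def
  proof (intro conjI ballI impI)
    show "hermitian d \<tau>" unfolding \<tau>_def by (rule hermitian_conj_diag) simp
    fix v :: "complex vec" assume v: "v \<in> carrier_vec d" "v \<noteq> 0\<^sub>v d"
    have "\<exists>i<d. v $ i \<noteq> 0" using v by (metis carrier_vecD eq_vecI index_zero_vec)
    then have "0 < (\<Sum>i<d. (cmod (v $ i))\<^sup>2)" by (auto intro!: sum_pos2[of _ i for i])
    then show "0 < Re ((\<tau> *\<^sub>v v) \<bullet>c v)"
      unfolding \<tau>_def conj_diag_quadratic[OF one_carrier_mat v(1)]
      using unitary_parseval[OF one v(1)] d by (simp only: sum_distrib_left[symmetric] Re_complex_of_real) simp
  qed
  moreover have "mat_tr \<tau> = 1" unfolding \<tau>_def mat_tr_conj_diag[OF one] using d by simp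
  ultimately have ens: "ensemble d n p (\<lambda>_. \<tau>)" using sum ppos by (simp add: ensemble_def)
  have \<tau>: "\<tau> \<in> carrier_mat d d" by (simp add: \<tau>_def)
  let ?A = "tensor_id d n E (cq_state d n p (\<lambda>_. \<tau>))"
  have "f_rel_entropy_defined D (d * n) ?A (holevo_product d n E (cq_state d n p (\<lambda>_. \<tau>)))"
    using def ens by (simp add: f_holevo_defined_def)
  moreover have "holevo_product d n E (cq_state d n p (\<lambda>_. \<tau>)) = ?A"
    by (rule holevo_product_constant[OF E ens refl])
  ultimately have A: "strictly_positive (d * n) ?A" "spectrum_in (rel_modular ?A ?A) D"
    by (auto simp: f_rel_entropy_defined_def)
  have eq: "?A = cq_state d n p (\<lambda>_. E \<tau>)"
    by (rule tensor_id_cq_state[OF E \<tau>])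
  have E\<tau>: "E \<tau> \<in> carrier_mat d d" by (rule cptp_carrier[OF E \<tau>])
  have "0 < n" using n by simp
  then have "strictly_positive d (E \<tau>)"
    using ensemble_image[OF E ens A(1)] \<open>0 < n\<close> unfolding ensemble_def by blast
  then obtain v a where v: "v \<in> carrier_vec d" "v \<noteq> 0\<^sub>v d" "E \<tau> *\<^sub>v v = complex_of_real a \<cdot>\<^sub>v v" and a: "0 < a"
    using strictly_positive_eigenvector[OF _ d] by blast
  have ev: "?A *\<^sub>v embed_B d n k v = complex_of_real (p k * a) \<cdot>\<^sub>v embed_B d n k v" if "k < n" for k
  proof -
    have "embed_B d n k (complex_of_real a \<cdot>\<^sub>v v) = complex_of_real a \<cdot>\<^sub>v embed_B d n k v"
      using v(1) by (intro eq_vecI) (auto simp: embed_B_def less_mult_imp_div_less)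
    then show ?thesis
      unfolding eq cq_state_mult_embed_B[OF E\<tau> that v(1)] v(3) by (simp add: smult_smult_assoc)
  qed
  \<comment> \<open>The same eigenvector of \<open>E \<tau>\<close> is placed at the basis vectors 1
    and 0 of B, so its eigenvalue \<open>a\<close> cancels and the ratio of the weights
    remains.\<close>
  have "(p 1 * a) / (p 0 * a) \<in> D"
    using n by (intro spectrum_in_rel_modular_self[OF A _ _ ev _ _ ev] embed_B_nonzero v) auto
  then show "x \<in> D" using a s by (simp add: p_def)
qed

section \<open>Data processing for the Holevo quantity\<close>

lemma tensor_id_holevo_product:
  assumes E1: "cptp d E1" and E2: "cptp d E2"
  shows "tensor_id d n E2 (holevo_product d n E1 R) = holevo_product d n (E2 \<circ> E1) R"
  unfolding holevo_product_def o_def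
  by (rule tensor_id_kron[OF E2 cptp_carrier[OF E1]]) simp_all

text \<open>Applying \<open>E1\<close> to the joint state changes its marginal on A by
  \<open>E1\<close> and leaves the marginal on B alone, so the second operand of \<open>S_f\<close>
  is that of the transformed ensemble.\<close>

lemma holevo_product_tensor_id:
  assumes E1: "cptp d E1"
  shows "holevo_product d n E2 (tensor_id d n E1 R) = holevo_product d n (E2 \<circ> E1) R"
  unfolding holevo_product_def ptrace_B_tensor_id[OF E1] ptrace_A_tensor_id[OF E1] by simp

text \<open>In dimension 0 neither the weights nor a trace can sum to 1.\<close>

lemma ensemble_dim_pos:
  assumes ens: "ensemble d n p \<rho>"
  shows "0 < n" "0 < d"
proof -
  show n: "0 < n" using ens by (cases n) (auto simp: ensemble_def)
  show "0 < d"
    using ens ensemble_carrier[OF ens n] n by (cases d) (auto simp: ensemble_def mat_tr_def)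
qed

theorem mainTheorem9:
  fixes f :: "real \<Rightarrow> real" and D :: "real set" and d n :: nat
    and E1 E2 :: "complex mat \<Rightarrow> complex mat"
  assumes "D \<subseteq> {0<..}"
    and "operator_convex_on D f"
    and "cptp d E1"
    and "cptp d E2"
    and "f_holevo_defined D d n E1"
    and "f_holevo_defined D d n E2"
    and "f_holevo_defined D d n (E2 \<circ> E1)"
  shows "f_holevo f d n (E2 \<circ> E1) \<le> min (f_holevo f d n E1) (f_holevo f d n E2)"
proof (rule min.boundedI)
  note conv = assms(2) and E1 = assms(3) and E2 = assms(4)
  note def1 = assms(5) and def12 = assms(7)
  have pos1: "strictly_positive (d * n) (tensor_id d n E1 (cq_state d n p \<rho>))"
    "strictly_positive (d * n) (holevo_product d n E1 (cq_state d n p \<rho>))" if "ensemble d n p \<rho>" for p \<rho>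
    using def1 that by (simp_all add: f_holevo_defined_def f_rel_entropy_defined_def)
  show "f_holevo f d n (E2 \<circ> E1) \<le> f_holevo f d n E1"
    unfolding f_holevo_def
  proof (rule SUP_mono, clarify)
    fix p \<rho> assume ens: "ensemble d n p \<rho>"
    define R where "R = cq_state d n p \<rho>"
    let ?A = "tensor_id d n E1 R" and ?B = "holevo_product d n E1 R"
    have A: "tensor_id d n (E2 \<circ> E1) R = tensor_id d n E2 ?A"
      by (rule tensor_id_comp[OF E1, symmetric])
    have B: "holevo_product d n (E2 \<circ> E1) R = tensor_id d n E2 ?B"
      by (rule tensor_id_holevo_product[OF E1 E2, symmetric])
    have pos: "strictly_positive (d * n) ?A" "strictly_positive (d * n) ?B"
      using pos1[OF ens] by (simp_all add: R_def)
    \<comment> \<open>Here the convention for the composite operation enters: its arguments of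
      \<open>S_f\<close> are the outputs of \<open>E2\<close>.\<close>
    have pos2: "strictly_positive (d * n) (tensor_id d n E2 ?A)" "strictly_positive (d * n) (tensor_id d n E2 ?B)"
      using def12 ens unfolding A[symmetric] B[symmetric]
      by (simp_all add: f_holevo_defined_def f_rel_entropy_defined_def R_def)
    have T: "cptp (d * n) (tensor_id d n E2)" by (rule cptp_tensor_id[OF E2])
    have "f_rel_entropy f (tensor_id d n E2 ?A) (tensor_id d n E2 ?B) \<le> f_rel_entropy f ?A ?B"
    proof (cases "n = 1")
      case True
      have "?B = ?A"
        unfolding R_def using True by (intro holevo_product_constant[OF E1 ens, of "\<rho> 0"]) simp
      moreover have "mat_tr (tensor_id d n E2 ?A) = mat_tr ?A"
        using T by (simp add: cptp_def)
      ultimately show ?thesis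
        using f_rel_entropy_self[OF pos(1)] f_rel_entropy_self[OF pos2(1)] by simp
    next
      case False
      \<comment> \<open>An ensemble has at least one member, so \<open>n \<noteq> 1\<close> leaves
        \<open>2 \<le> n\<close>.\<close>
      then have "D = {0<..}"
        using ensemble_dim_pos[OF ens] by (intro f_holevo_defined_domain[OF E1 def1 _ _ assms(1)]) auto
      with conv have "operator_convex_on {0<..} f" by simp
      then show ?thesis by (rule f_rel_entropy_cptp_monotone[OF _ T pos pos2])
    qed
    with ens show "\<exists>m\<in>{(p, \<rho>). ensemble d n p \<rho>}.
        ereal (f_rel_entropy f (tensor_id d n (E2 \<circ> E1) (cq_state d n p \<rho>)) (holevo_product d n (E2 \<circ> E1) (cq_state d n p \<rho>)))
        \<le> (case m of (p, \<rho>) \<Rightarrow> ereal (f_rel_entropy f (tensor_id d n E1 (cq_state d n p \<rho>)) (holevo_product d n E1 (cq_state d n p \<rho>))))"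
      unfolding R_def[symmetric] A B by (intro bexI[of _ "(p, \<rho>)"]) (auto simp: R_def)
  qed
  show "f_holevo f d n (E2 \<circ> E1) \<le> f_holevo f d n E2"
    unfolding f_holevo_def
  proof (rule SUP_mono, clarify)
    fix p \<rho> assume ens: "ensemble d n p \<rho>"
    let ?R = "cq_state d n p \<rho>" and ?\<rho>' = "\<lambda>i. E1 (\<rho> i)"
    \<comment> \<open>The convention for \<open>E1\<close> makes its output strictly positive, so
      the images are admissible in the supremum for \<open>E2\<close>.\<close>
    have ens': "ensemble d n p ?\<rho>'" by (rule ensemble_image[OF E1 ens pos1(1)[OF ens]])
    have R': "cq_state d n p ?\<rho>' = tensor_id d n E1 ?R"
      by (rule tensor_id_cq_state[OF E1 ensemble_carrier[OF ens], symmetric])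
    have "f_rel_entropy f (tensor_id d n (E2 \<circ> E1) ?R) (holevo_product d n (E2 \<circ> E1) ?R)
        = f_rel_entropy f (tensor_id d n E2 (cq_state d n p ?\<rho>')) (holevo_product d n E2 (cq_state d n p ?\<rho>'))"
      unfolding R' tensor_id_comp[OF E1] holevo_product_tensor_id[OF E1] ..
    with ens' show "\<exists>m\<in>{(p, \<rho>). ensemble d n p \<rho>}.
        ereal (f_rel_entropy f (tensor_id d n (E2 \<circ> E1) (cq_state d n p \<rho>)) (holevo_product d n (E2 \<circ> E1) (cq_state d n p \<rho>)))
        \<le> (case m of (p, \<rho>) \<Rightarrow> ereal (f_rel_entropy f (tensor_id d n E2 (cq_state d n p \<rho>)) (holevo_product d n E2 (cq_state d n p \<rho>))))"
      by (intro bexI[of _ "(p, ?\<rho>')"]) auto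
  qed
qed

end
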